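(* Let $V_\ell$ be the $(\ell+1)$-dimensional simple $U_q(sl_2)$-module, $\ell\ge1$, and let $S_\sigma(V_\ell)$ be its braided symmetric algebra. (a) Let $\ell$ be odd. Then the point modules of $S_\sigma(V_\ell)$ are parametrized by (i.e. are, up to isomorphism, in one-to-one correspondence with) the points of the curve defined by the Veronese algebra $V_q(1,\ell)$ in $\mathbb{P}V_\ell$. (b) Let $\ell$ be even. Then the point modules of $S_\sigma(V_\ell)$ are parametrized by (i.e. are, up to isomorphism, in one-to-one correspondence with) the points of the surface defined by the Veronese algebra $V_q(2,\frac{\ell}{2})$ in $\mathbb{P}V_\ell$.
   Context: $U_q(sl_2)$ is the $\mathbb{C}(q)$-algebra generated by $E,F,K^{\pm1}$ with $KE=q^2EK$, $KF=q^{-2}FK$, $EF-FE=\frac{K-K^{-1}}{q-q^{-1}}$, and coproduct $\Delta(E)=E\otimes1+K\otimes E$, $\Delta(F)=F\otimes K^{-1}+1\otimes F$, $\Delta(K)=K\otimes K$; $V_m$ is the simple type I module of highest weight $m$. $V_\ell\otimes V_\ell\cong\bigoplus_{j=0}^{\ell}V_{2\ell-2j}$ is multiplicity free; $\Lambda^2_\sigma V_\ell$ (the span of the eigenvectors of the braiding with eigenvalues of the form $-q^r$) is the sum of the summands with $j$ odd. The braided symmetric algebra is the graded algebra $S_\sigma(V_\ell)=T(V_\ell)/\langle\Lambda^2_\sigma V_\ell\rangle$, a $U_q(sl_2)$-module algebra. Quantum Veronese algebras. For $n=1,2$, $V_q(n,d)$ is the subalgebra of $S_\sigma(V_n)$ (also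 denoted $\mathbb{C}_q[x_0,\dots,x_n]$) generated by the homogeneous elements of degree $d$, graded so that $V_q(n,d)_k=S_\sigma(V_n)_{kd}$. One has $V_q(1,\ell)_1\cong V_\ell$, and for even $\ell$ there is a unique submodule $V_\ell\subset V_q(2,\frac{\ell}{2})_1$. Point modules. Let $k=\mathbb{C}(q)$. For a graded algebra $A$ generated in degree one with $A_0=k$, a point module is a graded right $A$-module $M=\bigoplus_{i\ge0}M_i$ generated in degree zero with $M_0=k$ and $\dim M_i=1$ for all $i\ge0$. Associated schemes. Let $V$ be a finite-dimensional $k$-vector space and $\mathcal{I}\subset T(V^* )$ a graded ideal. Elements of $\mathcal{I}_d\subset(V^* )^{\otimes d}$ are multilinear forms on $V^{d}$, so they define a zero scheme $\Gamma_d\subset(\mathbb{P}V)^{d}$ ($\mathbb{P}V$ being the space of lines in $V$); $\Gamma$ denotes the inverse limit of the $\Gamma_d$ under the projections to the first $d-1$ factors. The module $V_\ell$ is identified with its dual. For a graded algebra $B$ with $V_\ell\subset B_1$, the geometric object defined by $B$ in $\mathbb{P}V_\ell$ is the inverse limit $\Gamma$ attached to the ideal of relations $\ker(T(V_\ell)\to B)$; for $B=V_q(1,\ell)$ it is the (non-commutative) curve and for $B=V_q(2,\frac{\ell}{2})$ the (non-commutative) surface in question. *)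

theory Defs
  imports
    "HOL-Algebra.QuotRing"
    "HOL-Algebra.Generated_Rings"
    "HOL-Computational_Algebra.Fraction_Field"
    "HOL-Computational_Algebra.Polynomial"
    "HOL-Library.Poly_Mapping"
begin

section \<open>The ground field and quantum integers\<close>

type_synonym kq = "complex poly fract"

definition qq :: kq where
  "qq = Fract [:0, 1:] 1"

definition qint :: "nat \<Rightarrow> kq" where
  "qint n = (qq ^ n - inverse qq ^ n) / (qq - inverse qq)"

definition qfact :: "nat \<Rightarrow> kq" where
  "qfact n = (\<Prod>k = 1..n. qint k)"

section \<open>Tensor algebras\<close>

text \<open>The monoid of words on the alphabet of natural numbers is written additively, so that
  the type \<open>tens\<close> below is its monoid algebra, i.e. the free algebra on
  letters \<open>0, 1, 2, \<dots>\<close>. The letter \<open>i\<close> is the weight vector \<open>v\<^sub>i\<close> of the module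
  \<open>V\<^sub>m\<close>, and \<open>T(V\<^sub>m)\<close> consists of the elements that only involve the letters \<open>0, \<dots>, m\<close>.\<close>

datatype tword = TWord (letters: "nat list")

instantiation tword :: monoid_add
begin

definition zero_tword :: tword where
  "0 = TWord []"

definition plus_tword :: "tword \<Rightarrow> tword \<Rightarrow> tword" where
  "u + w = TWord (letters u @ letters w)"

instance
  by standard (simp_all add: zero_tword_def plus_tword_def)

end

type_synonym tens = "tword \<Rightarrow>\<^sub>0 kq"

definition mon :: "nat list \<Rightarrow> tens" where
  "mon is = Poly_Mapping.single (TWord is) 1"

definition sc :: "kq \<Rightarrow> tens" where
  "sc c = Poly_Mapping.single 0 c"

definition lin_ext :: "(nat list \<Rightarrow> tens) \<Rightarrow> tens \<Rightarrow> tens" where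
  "lin_ext f t = (\<Sum>w\<in>Poly_Mapping.keys t. sc (Poly_Mapping.lookup t w) * f (letters w))"

definition tdeg :: "nat \<Rightarrow> nat \<Rightarrow> tens set" where
  "tdeg m d = {t. \<forall>w\<in>Poly_Mapping.keys t. length (letters w) = d \<and> set (letters w) \<subseteq> {..m}}"

abbreviation Vmod :: "nat \<Rightarrow> tens set" where
  "Vmod m \<equiv> tdeg m 1"

text \<open>Graded algebras over \<open>\<complex>(q)\<close>: rings with a structure map from the ground field and a
  family of homogeneous components.\<close>

record 'a kalg = "'a ring" +
  scal :: "kq \<Rightarrow> 'a"
  hcomp :: "nat \<Rightarrow> 'a set"

definition tensor_alg :: "nat \<Rightarrow> tens kalg" where
  "tensor_alg m =
    \<lparr>carrier = {t. \<forall>w\<in>Poly_Mapping.keys t. set (letters w) \<subseteq> {..m}},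
     monoid.mult = (*), one = 1, zero = 0, add = (+), scal = sc, hcomp = tdeg m\<rparr>"

section \<open>The action of the quantum group\<close>

datatype uq_gen = U1 | UE | UF | UK | UKinv

text \<open>Coproducts as lists of pairs standing for sums of pure tensors; \<open>U1\<close> is the unit.\<close>

fun copr :: "uq_gen \<Rightarrow> (uq_gen \<times> uq_gen) list" where
  "copr U1 = [(U1, U1)]"
| "copr UE = [(UE, U1), (UK, UE)]"
| "copr UF = [(UF, UKinv), (U1, UF)]"
| "copr UK = [(UK, UK)]"
| "copr UKinv = [(UKinv, UKinv)]"

fun counit :: "uq_gen \<Rightarrow> kq" where
  "counit U1 = 1"
| "counit UE = 0"
| "counit UF = 0"
| "counit UK = 1"
| "counit UKinv = 1"

text \<open>The simple type I module \<open>V\<^sub>m\<close> of highest weight \<open>m\<close> in its standard basis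
  \<open>v\<^sub>i = F\<^sup>i v\<^sub>0 / [i]!\<close>, \<open>0 \<le> i \<le> m\<close>. The values for \<open>i > m\<close> are irrelevant.\<close>

fun letter_act :: "nat \<Rightarrow> uq_gen \<Rightarrow> nat \<Rightarrow> tens" where
  "letter_act m U1 i = mon [i]"
| "letter_act m UE i = (if i = 0 then 0 else sc (qint (m + 1 - i)) * mon [i - 1])"
| "letter_act m UF i = (if i < m then sc (qint (i + 1)) * mon [i + 1] else 0)"
| "letter_act m UK i = sc (qq powi (int m - 2 * int i)) * mon [i]"
| "letter_act m UKinv i = sc (qq powi (2 * int i - int m)) * mon [i]"

fun word_act :: "nat \<Rightarrow> uq_gen \<Rightarrow> nat list \<Rightarrow> tens" where
  "word_act m g [] = sc (counit g)"
| "word_act m g (i # is) = (\<Sum>(g1, g2) \<leftarrow> copr g. letter_act m g1 i * word_act m g2 is)"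

definition act :: "nat \<Rightarrow> uq_gen \<Rightarrow> tens \<Rightarrow> tens" where
  "act m g = lin_ext (word_act m g)"

section \<open>Braiding and braided symmetric algebra\<close>

text \<open>The braiding of \<open>V\<^sub>m \<otimes> V\<^sub>m\<close> attached to the above coproduct is \<open>\<Theta> \<circ> f \<circ> P\<close>, where \<open>P\<close>
  is the flip, \<open>f\<close> multiplies a tensor of weights \<open>(\<lambda>, \<mu>)\<close> by \<open>q\<^bsup>-\<lambda>\<mu>/2\<^esup>\<close>, and
  \<open>\<Theta> = \<Sum>n. (-1)\<^sup>n q\<^bsup>-n(n-1)/2\<^esup> (q - q\<^sup>-\<^sup>1)\<^sup>n / [n]! F\<^sup>n \<otimes> E\<^sup>n\<close> (the terms with \<open>n > m\<close>
  vanish on \<open>V\<^sub>m \<otimes> V\<^sub>m\<close>).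
  As \<open>q\<^bsup>m\<^sup>2/2\<^esup>\<close> need not lie in \<open>\<complex>(q)\<close>, the braiding is rescaled by this power of \<open>q\<close>:
  on \<open>v\<^sub>j \<otimes> v\<^sub>i\<close> the factor becomes \<open>q\<^bsup>m(i+j)-2ij\<^esup>\<close>. Rescaling by a power of \<open>q\<close>, or passing
  to the inverse braiding, does not affect the property of an eigenvalue to be minus a
  power of \<open>q\<close>. The rescaled braiding acts on the summand \<open>V\<^bsub>2m-2j\<^esub>\<close> by
  \<open>(-1)\<^sup>j q\<^bsup>j(2m+1-j)\<^esup>\<close>, so integral powers are the only ones that occur.\<close>

definition theta_coeff :: "nat \<Rightarrow> kq" where
  "theta_coeff n =
    (-1) ^ n * inverse qq ^ (n * (n - 1) div 2) * (qq - inverse qq) ^ n / qfact n"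

definition braid_word :: "nat \<Rightarrow> nat \<Rightarrow> nat \<Rightarrow> tens" where
  "braid_word m i j =
    sc (qq powi (int m * (int i + int j) - 2 * int i * int j)) *
      (\<Sum>n\<le>m. sc (theta_coeff n) * ((act m UF ^^ n) (mon [j]) * (act m UE ^^ n) (mon [i])))"

definition braiding :: "nat \<Rightarrow> tens \<Rightarrow> tens" where
  "braiding m = lin_ext (\<lambda>is. braid_word m (is ! 0) (is ! 1))"

definition ext_square :: "nat \<Rightarrow> tens set" where
  "ext_square m = Modules.module.span (\<lambda>c t. sc c * t)
     {t \<in> tdeg m 2. \<exists>r::int. braiding m t = - (sc (qq powi r) * t)}"

definition sym_ideal :: "nat \<Rightarrow> tens set" where
  "sym_ideal m = genideal (tensor_alg m) (ext_square m)"

text \<open>The class in \<open>S\<^sub>\<sigma>(V\<^sub>m)\<close> of an element of \<open>T(V\<^sub>m)\<close>.\<close>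

definition cls :: "nat \<Rightarrow> tens \<Rightarrow> tens set" where
  "cls m t = sym_ideal m +>\<^bsub>tensor_alg m\<^esub> t"

definition sym_alg :: "nat \<Rightarrow> tens set kalg" where
  "sym_alg m = ring.extend (tensor_alg m Quot sym_ideal m)
     (kalg.fields (\<lambda>c. cls m (sc c)) (\<lambda>d. cls m ` tdeg m d))"

definition sym_act :: "nat \<Rightarrow> uq_gen \<Rightarrow> tens set \<Rightarrow> tens set" where
  "sym_act m g C = (\<Union>t\<in>C. cls m (act m g t))"

section \<open>Quantum Veronese algebras\<close>

definition veronese :: "nat \<Rightarrow> nat \<Rightarrow> tens set kalg" where
  "veronese n d = (sym_alg n)
     \<lparr>carrier := generate_ring (sym_alg n) (range (scal (sym_alg n)) \<union> hcomp (sym_alg n) d),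
      hcomp := (\<lambda>k. hcomp (sym_alg n) (k * d))\<rparr>"

text \<open>The algebra homomorphisms \<open>T(V\<^sub>l) \<rightarrow> V\<^sub>q(n,d)\<close> that restrict to an embedding of the
  module \<open>V\<^sub>l\<close> into \<open>V\<^sub>q(n,d)\<^sub>1\<close>.\<close>

definition module_embedding :: "nat \<Rightarrow> nat \<Rightarrow> nat \<Rightarrow> (tens \<Rightarrow> tens set) \<Rightarrow> bool" where
  "module_embedding l n d \<phi> \<longleftrightarrow>
     \<phi> \<in> ring_hom (tensor_alg l) (veronese n d) \<and>
     (\<forall>c. \<phi> (scal (tensor_alg l) c) = scal (veronese n d) c) \<and>
     inj_on \<phi> (Vmod l) \<and>
     \<phi> ` Vmod l \<subseteq> hcomp (veronese n d) 1 \<and>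
     (\<forall>g. \<forall>v\<in>Vmod l. \<phi> (act l g v) = sym_act n g (\<phi> v))"

section \<open>Associated schemes\<close>

text \<open>An identification of \<open>V\<^sub>l\<close> with its dual is given by an invariant nondegenerate
  bilinear form. (It is unique up to a scalar.)\<close>

definition dual_pairing :: "nat \<Rightarrow> (tens \<Rightarrow> tens \<Rightarrow> kq) \<Rightarrow> bool" where
  "dual_pairing l \<beta> \<longleftrightarrow>
     (\<forall>x\<in>Vmod l. \<forall>y\<in>Vmod l. \<forall>z\<in>Vmod l. \<forall>c.
        \<beta> (x + y) z = \<beta> x z + \<beta> y z \<and> \<beta> x (y + z) = \<beta> x y + \<beta> x z \<and>
        \<beta> (sc c * x) z = c * \<beta> x z \<and> \<beta> x (sc c * z) = c * \<beta> x z) \<and>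
     (\<forall>g. \<forall>x\<in>Vmod l. \<forall>y\<in>Vmod l.
        (\<Sum>(g1, g2) \<leftarrow> copr g. \<beta> (act l g1 x) (act l g2 y)) = counit g * \<beta> x y) \<and>
     (\<forall>x\<in>Vmod l. x \<noteq> 0 \<longrightarrow> (\<exists>y\<in>Vmod l. \<beta> x y \<noteq> 0)) \<and>
     (\<forall>y\<in>Vmod l. y \<noteq> 0 \<longrightarrow> (\<exists>x\<in>Vmod l. \<beta> x y \<noteq> 0))"

text \<open>The projective space \<open>\<P>V\<^sub>l\<close> of lines in \<open>V\<^sub>l\<close>.\<close>

definition proj_space :: "nat \<Rightarrow> tens set set" where
  "proj_space l = {L. \<exists>u\<in>Vmod l. u \<noteq> 0 \<and> L = {sc c * u | c. True}}"

text \<open>The value of a tensor, regarded as a multilinear form, on a list of vectors.\<close>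

definition form_eval :: "(tens \<Rightarrow> tens \<Rightarrow> kq) \<Rightarrow> tens \<Rightarrow> tens list \<Rightarrow> kq" where
  "form_eval \<beta> t us = (\<Sum>w\<in>Poly_Mapping.keys t.
     Poly_Mapping.lookup t w * (\<Prod>k<length us. \<beta> (mon [letters w ! k]) (us ! k)))"

definition zero_locus ::
  "nat \<Rightarrow> (tens \<Rightarrow> tens \<Rightarrow> kq) \<Rightarrow> tens set \<Rightarrow> nat \<Rightarrow> tens set list set" where
  "zero_locus l \<beta> I d = {Ls. length Ls = d \<and> set Ls \<subseteq> proj_space l \<and>
     (\<forall>t \<in> I \<inter> tdeg l d. \<forall>us. length us = d \<longrightarrow> (\<forall>k<d. us ! k \<in> Ls ! k) \<longrightarrow>
        form_eval \<beta> t us = 0)}"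

text \<open>A point of the inverse limit is a family of points, one of each \<^const>\<open>zero_locus\<close>,
  that is compatible with the projections forgetting the last factor; such families are
  sequences all of whose initial segments lie in the respective loci.\<close>

definition inv_limit ::
  "nat \<Rightarrow> (tens \<Rightarrow> tens \<Rightarrow> kq) \<Rightarrow> tens set \<Rightarrow> (nat \<Rightarrow> tens set) set" where
  "inv_limit l \<beta> I = {p. \<forall>d. map p [0..<d] \<in> zero_locus l \<beta> I d}"

definition geometric_object ::
  "nat \<Rightarrow> (tens \<Rightarrow> tens \<Rightarrow> kq) \<Rightarrow> 'b kalg \<Rightarrow> (tens \<Rightarrow> 'b) \<Rightarrow> (nat \<Rightarrow> tens set) set" where
  "geometric_object l \<beta> B \<phi> = inv_limit l \<beta> (a_kernel (tensor_alg l) B \<phi>)"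

section \<open>Point modules\<close>

text \<open>Graded right modules; the underlying abelian group is a \<^const>\<open>abelian_group\<close>, whose
  multiplicative fields are not used.\<close>

record ('a, 'm) gmod = "'m ring" +
  ract :: "'m \<Rightarrow> 'a \<Rightarrow> 'm"
  mcomp :: "nat \<Rightarrow> 'm set"

definition right_module :: "'a kalg \<Rightarrow> ('a, 'm) gmod \<Rightarrow> bool" where
  "right_module A M \<longleftrightarrow>
     ring A \<and> abelian_group M \<and>
     (\<forall>x\<in>carrier M. \<forall>a\<in>carrier A. ract M x a \<in> carrier M) \<and>
     (\<forall>x\<in>carrier M. \<forall>y\<in>carrier M. \<forall>a\<in>carrier A.
        ract M (x \<oplus>\<^bsub>M\<^esub> y) a = ract M x a \<oplus>\<^bsub>M\<^esub> ract M y a) \<and>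
     (\<forall>x\<in>carrier M. \<forall>a\<in>carrier A. \<forall>b\<in>carrier A.
        ract M x (a \<oplus>\<^bsub>A\<^esub> b) = ract M x a \<oplus>\<^bsub>M\<^esub> ract M x b) \<and>
     (\<forall>x\<in>carrier M. \<forall>a\<in>carrier A. \<forall>b\<in>carrier A.
        ract M x (a \<otimes>\<^bsub>A\<^esub> b) = ract M (ract M x a) b) \<and>
     (\<forall>x\<in>carrier M. ract M x \<one>\<^bsub>A\<^esub> = x)"

definition graded_right_module :: "'a kalg \<Rightarrow> ('a, 'm) gmod \<Rightarrow> bool" where
  "graded_right_module A M \<longleftrightarrow>
     right_module A M \<and>
     (\<forall>i. additive_subgroup (mcomp M i) M) \<and>
     (\<forall>x\<in>carrier M. \<exists>!f. (\<forall>i. f i \<in> mcomp M i) \<and> finite {i. f i \<noteq> \<zero>\<^bsub>M\<^esub>} \<and>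
        x = finsum M f {i. f i \<noteq> \<zero>\<^bsub>M\<^esub>}) \<and>
     (\<forall>i j. \<forall>x\<in>mcomp M i. \<forall>a\<in>hcomp A j. ract M x a \<in> mcomp M (i + j))"

definition point_module :: "'a kalg \<Rightarrow> ('a, 'm) gmod \<Rightarrow> bool" where
  "point_module A M \<longleftrightarrow>
     graded_right_module A M \<and>
     (\<forall>N. additive_subgroup N M \<and> (\<forall>x\<in>N. \<forall>a\<in>carrier A. ract M x a \<in> N) \<and> mcomp M 0 \<subseteq> N
        \<longrightarrow> N = carrier M) \<and>
     (\<forall>i. \<exists>b\<in>mcomp M i. b \<noteq> \<zero>\<^bsub>M\<^esub> \<and> mcomp M i = {ract M b (scal A c) | c. True})"

definition gmod_iso :: "'a kalg \<Rightarrow> ('a, 'm) gmod \<Rightarrow> ('a, 'm) gmod \<Rightarrow> bool" where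
  "gmod_iso A M N \<longleftrightarrow> (\<exists>h. bij_betw h (carrier M) (carrier N) \<and>
     (\<forall>x\<in>carrier M. \<forall>y\<in>carrier M. h (x \<oplus>\<^bsub>M\<^esub> y) = h x \<oplus>\<^bsub>N\<^esub> h y) \<and>
     (\<forall>x\<in>carrier M. \<forall>a\<in>carrier A. h (ract M x a) = ract N (h x) a) \<and>
     (\<forall>i. h ` mcomp M i = mcomp N i))"

definition iso_class :: "'a kalg \<Rightarrow> ('a, 'm) gmod \<Rightarrow> ('a, 'm) gmod set" where
  "iso_class A M = {N. point_module A N \<and> gmod_iso A M N}"

definition point_module_classes :: "'a kalg \<Rightarrow> ('a, 'm) gmod set set" where
  "point_module_classes A = {iso_class A M | M. point_module A M}"

text \<open>Multiplication \<open>M\<^sub>i \<times> V\<^sub>l \<rightarrow> M\<^bsub>i+1\<^esub>\<close> in a point module \<open>M\<close> of \<open>S\<^sub>\<sigma>(V\<^sub>l)\<close> is, up to the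
  choice of bases of \<open>M\<^sub>i\<close> and \<open>M\<^bsub>i+1\<^esub>\<close>, a nonzero linear form on \<open>V\<^sub>l\<close>, that is, a point of
  \<open>\<P>V\<^sub>l\<close>. The point module \<open>M\<close> corresponds to the sequence of these points.\<close>

definition module_points ::
  "nat \<Rightarrow> (tens \<Rightarrow> tens \<Rightarrow> kq) \<Rightarrow> (tens set, 'm) gmod \<Rightarrow> nat \<Rightarrow> tens set" where
  "module_points l \<beta> M i = {u \<in> Vmod l. \<exists>b\<in>mcomp M i. \<exists>b'\<in>mcomp M (i + 1).
     b' \<noteq> \<zero>\<^bsub>M\<^esub> \<and>
     (\<forall>x\<in>Vmod l. ract M b (cls l x) = ract M b' (scal (sym_alg l) (\<beta> x u)))}"

text \<open>The canonical correspondence is a bijection from isomorphism classes of point modules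
  (with carriers inside the type \<open>'m\<close>) of \<open>S\<^sub>\<sigma>(V\<^sub>l)\<close> onto \<open>X\<close>.\<close>

definition point_modules_parametrized ::
  "'m itself \<Rightarrow> nat \<Rightarrow> (tens \<Rightarrow> tens \<Rightarrow> kq) \<Rightarrow> (nat \<Rightarrow> tens set) set \<Rightarrow> bool" where
  "point_modules_parametrized TY l \<beta> X \<longleftrightarrow>
     (\<exists>\<Phi>. bij_betw \<Phi> (point_module_classes (sym_alg l) :: (tens set, 'm) gmod set set) X \<and>
        (\<forall>M :: (tens set, 'm) gmod. point_module (sym_alg l) M \<longrightarrow>
           \<Phi> (iso_class (sym_alg l) M) = module_points l \<beta> M))"

end

theory Submission
  imports Defs
begin

text \<open>
  Over \<open>S\<^sub>\<sigma>(V\<^sub>l)\<close> a point module has one basis vector \<open>m\<^sub>i\<close> in every degree, and \<open>V\<^sub>l\<close> acts by \<open>m\<^sub>i x = P\<^sub>i(x)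
  m\<^bsub>i+1\<^esub>\<close> for linear forms \<open>P\<^sub>i\<close>. These are nonzero because the module is generated in degree zero, they
  are unique up to scalars, and the only condition on them is that \<open>P\<^sub>i \<otimes> P\<^bsub>i+1\<^esub>\<close> annihilates the
  quadratic relations \<open>\<Lambda>\<^sup>2\<^sub>\<sigma>V\<^sub>l\<close>; such a sequence of forms is called a chain. The pairing turns nonzero
  forms into points of \<open>\<P>V\<^sub>l\<close>. So point modules up to isomorphism are chains up to scalars
  (\<open>point_modules_parametrized_by_chains\<close>), and these are the points of the inverse limit attached
  to the relations of \<open>S\<^sub>\<sigma>(V\<^sub>l)\<close> itself (\<open>inv_limit_sym_ideal\<close>). What remains is that the relations of
  the Veronese algebra \<open>B = V\<^sub>q(n,d)\<close>, \<open>nd = l\<close>, have the same zeros.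

  The relations of \<open>S\<^sub>\<sigma>(V\<^sub>l)\<close> hold in \<open>B\<close> (\<open>sym_ideal_kernel\<close>): as a module, \<open>\<Lambda>\<^sup>2\<^sub>\<sigma>V\<^sub>l\<close> is generated by
  highest weight vectors of weight \<open>2l - 2j\<close> with \<open>j\<close> odd, and \<open>S\<^sub>\<sigma>(V\<^sub>n)\<close> has no such vectors in degree
  \<open>2d\<close>. Indeed the ordered monomials \<open>x\<^sub>0\<^sup>a x\<^sub>1\<^sup>b x\<^sub>2\<^sup>c\<close> form a basis of \<open>S\<^sub>\<sigma>(V\<^sub>n)\<close>, those of weight \<open>2l - 2j\<close>
  have \<open>b\<close> odd, hence positive, and \<open>E\<close> replaces a factor \<open>x\<^sub>1\<close> by \<open>x\<^sub>0\<close>, which makes it injective on such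
  weights (\<open>E_injective_odd\<close>).

  Conversely every chain for \<open>V\<^sub>l\<close> annihilates the relations of \<open>B\<close> (\<open>chain_kernel\<close>). Multiplying \<open>d\<close>
  consecutive forms, a chain for \<open>V\<^sub>n\<close> induces a chain for \<open>V\<^sub>l\<close> that annihilates them, so it suffices
  that every chain is proportional to an induced one. The summand \<open>V\<^bsub>2l-2\<^esub>\<close> of \<open>\<Lambda>\<^sup>2\<^sub>\<sigma>V\<^sub>l\<close> consists of
  quantum Wronskians, whose coefficients vanish only at the two extremal weights. Therefore the
  coordinate \<open>P\<^sub>i(v\<^sub>0)\<close> vanishes for all \<open>i\<close> or for none. In the first case only the last coordinate
  survives, and the chain is induced from a coordinate point of \<open>\<P>V\<^sub>n\<close>. In the second case let \<open>P\<^sub>i(v\<^sub>0)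
  = 1\<close>. A relation of weight \<open>2l - 2k\<close> is linear in the coordinates of index \<open>k\<close> once the earlier ones
  are known, and for \<open>k \<ge> 3\<close> the relations from the summands \<open>j = 1\<close> and \<open>j = 3\<close> are independent. Thus
  the chain is determined by the coordinates of index \<open>1\<close> and \<open>2\<close> of \<open>P\<^sub>0\<close> (\<open>chain_unique\<close>). If the first
  of them is nonzero, the relations of weight \<open>2l - 6\<close> at two consecutive places fix the second one
  (\<open>chain_second_coordinate\<close>); these chains come from \<open>\<P>V\<^sub>1\<close> or from a conic in \<open>\<P>V\<^sub>2\<close>. If it is zero,
  then all coordinates of odd index vanish. For \<open>n = 2\<close> the second coordinate is then arbitrary and
  is matched by the line \<open>x\<^sub>1 = 0\<close> in \<open>\<P>V\<^sub>2\<close>; for odd \<open>l\<close> the last coordinate vanishes as well, and the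
  Wronskians leave only the coordinate point \<open>v\<^sub>0\<close>.
\<close>

section \<open>Powers of the indeterminate and quantum integers\<close>

lemma qq_power: "qq ^ n = Fract (monom 1 n) 1"
  by (induction n) (auto simp: qq_def One_fract_def[symmetric] monom_0 pCons_one monom_Suc)

lemma qq_neq_0 [simp]: "qq \<noteq> 0"
  by (simp add: qq_def eq_fract Zero_fract_def)

text \<open>After multiplication by a high power of \<open>q\<close> this compares coefficients of polynomials.\<close>

lemma qq_powi_sum_eq:
  assumes "qq powi a + qq powi b = qq powi c + qq powi d"
  shows "(a = c \<and> b = d) \<or> (a = d \<and> b = c)"
proof -
  define N where "N = \<bar>a\<bar> + \<bar>b\<bar> + \<bar>c\<bar> + \<bar>d\<bar>"
  have P: "qq powi x * qq powi N = Fract (monom 1 (nat (x + N))) 1" if "x + N \<ge> 0" for x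
  proof -
    have "qq powi x * qq powi N = qq powi (int (nat (x + N)))"
      using that by (simp only: power_int_add[of qq, symmetric] qq_neq_0 simp_thms int_nat_eq if_True)
    thus ?thesis by (simp only: power_int_of_nat qq_power)
  qed
  have nn: "a + N \<ge> 0" "b + N \<ge> 0" "c + N \<ge> 0" "d + N \<ge> 0"
    by (simp_all add: N_def)
  have "(qq powi a + qq powi b) * qq powi N = (qq powi c + qq powi d) * qq powi N"
    using assms by simp
  hence "monom (1::complex) (nat (a + N)) + monom 1 (nat (b + N))
       = monom 1 (nat (c + N)) + monom 1 (nat (d + N))"
    by (simp add: distrib_right P nn eq_fract)
  hence coord: "coeff (monom (1::complex) (nat (a + N)) + monom 1 (nat (b + N))) k
       = coeff (monom 1 (nat (c + N)) + monom 1 (nat (d + N))) k" for k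
    by simp
  show ?thesis
    using coord[of "nat (a + N)"] coord[of "nat (b + N)"] coord[of "nat (c + N)"] nn
    by (auto simp: nat_eq_iff split: if_splits)
qed

lemma qq_powi_eq_iff [simp]: "qq powi a = qq powi b \<longleftrightarrow> a = b"
  using qq_powi_sum_eq[of a 0 b 0] by auto

lemma qq_powi_eq_1_iff [simp]: "qq powi a = 1 \<longleftrightarrow> a = 0"
  using qq_powi_eq_iff[of a 0] by (simp del: qq_powi_eq_iff)

lemma qq_powi_neq_minus: "qq powi a \<noteq> - (qq powi b)"
proof
  assume h: "qq powi a = - (qq powi b)"
  have "qq powi (a + a) = qq powi a * qq powi a" "qq powi (b + b) = qq powi b * qq powi b"
    by (simp_all only: power_int_add qq_neq_0 simp_thms)
  with h have "qq powi (a + a) = qq powi (b + b)" by simp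
  hence "a = b" by simp
  with h have z: "qq powi a + qq powi a = 0" by (simp add: add_eq_0_iff)
  have "qq powi (a + 1) + qq powi (a + 1) = qq * (qq powi a + qq powi a)"
    by (simp add: power_int_add distrib_left mult.commute)
  also have "\<dots> = qq powi a + qq powi a" by (simp only: z mult_zero_right)
  finally show False using qq_powi_sum_eq[of "a + 1" "a + 1" a a] by simp
qed

definition qd :: kq where "qd = qq - inverse qq"

lemma qd_neq_0 [simp]: "qd \<noteq> 0"
  unfolding qd_def using qq_powi_eq_iff[of 1 "-1"] by (simp add: power_int_minus del: qq_powi_eq_iff)

text \<open>Quantum integers with an arbitrary integral argument; they make the formulas for the action
  valid without case distinctions at the two ends of a weight string.\<close>

definition qi :: "int \<Rightarrow> kq" where
  "qi z = (qq powi z - qq powi (- z)) / qd"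

lemma qint_qi: "qint n = qi (int n)"
  by (simp add: qint_def qi_def qd_def power_int_minus power_inverse)

lemma qi_0 [simp]: "qi 0 = 0" and qi_1 [simp]: "qi 1 = 1"
  using qd_neq_0 by (simp_all add: qi_def qd_def power_int_minus)

lemma qi_eq_0_iff [simp]: "qi z = 0 \<longleftrightarrow> z = 0"
  by (auto simp: qi_def)

section \<open>Linear algebra in the tensor algebra\<close>

lemma mon_Nil [simp]: "mon [] = 1"
  by (simp add: mon_def zero_tword_def[symmetric])

lemma mon_append: "mon (u @ v) = mon u * mon v"
  by (simp add: mon_def mult_single plus_tword_def)

lemma mon_Cons: "mon (i # w) = mon [i] * mon w"
  using mon_append[of "[i]" w] by simp

lemma sc_mult: "sc (a * b) = sc a * sc b"
  and sc_add: "sc (a + b) = sc a + sc b"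
  and sc_diff: "sc (a - b) = sc a - sc b"
  and sc_minus: "sc (- a) = - sc a"
  and sc_0 [simp]: "sc 0 = 0"
  and sc_1 [simp]: "sc 1 = 1"
  by (simp_all add: sc_def mult_single single_add single_diff single_uminus)

lemma single_sc: "Poly_Mapping.single w c = sc c * mon (letters w)"
  by (simp add: sc_def mon_def mult_single)

lemma tens_expand: "t = (\<Sum>w\<in>Poly_Mapping.keys t. sc (Poly_Mapping.lookup t w) * mon (letters w))"
  unfolding single_sc[symmetric]
  by (rule poly_mapping_eqI)
     (simp add: Poly_Mapping.lookup_sum lookup_single when_def in_keys_iff sum.delta)

lemma tens_induct_keys:
  assumes "\<And>w. w \<in> Poly_Mapping.keys t \<Longrightarrow> Q (letters w)"
    and "S 0" "\<And>x y. S x \<Longrightarrow> S y \<Longrightarrow> S (x + y)" "\<And>c x. S x \<Longrightarrow> S (sc c * x)"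
    and "\<And>w. Q w \<Longrightarrow> S (mon w)"
  shows "S t"
proof -
  have "S (\<Sum>w\<in>A. sc (Poly_Mapping.lookup t w) * mon (letters w))"
    if "finite A" "A \<subseteq> Poly_Mapping.keys t" for A
    using that by (induction A) (use assms in auto)
  from this[of "Poly_Mapping.keys t"] show ?thesis
    by (simp add: tens_expand[symmetric])
qed

lemma tens_induct [case_names zero add scale mon]:
  assumes "S 0" "\<And>x y. S x \<Longrightarrow> S y \<Longrightarrow> S (x + y)" "\<And>c x. S x \<Longrightarrow> S (sc c * x)"
    and "\<And>w. S (mon w)"
  shows "S t"
  by (rule tens_induct_keys[where Q = "\<lambda>_. True"]) (use assms in auto)

lemma sc_commute: "t * sc c = sc c * t"
proof (induction t rule: tens_induct)
  case (scale d x)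
  have "sc d * x * sc c = (sc d * sc c) * x" by (simp add: mult.assoc scale)
  thus ?case by (simp add: sc_mult[symmetric] mult.assoc[symmetric] mult.commute)
next
  case (mon w)
  show ?case by (simp add: sc_def mon_def mult_single mult.commute)
qed (simp_all add: distrib_left distrib_right)

lemma sc_left_commute: "t * (sc c * u) = sc c * (t * u)"
  by (metis mult.assoc sc_commute)

lemma sc_assoc: "sc a * (sc b * t) = sc (a * b) * t"
  by (simp add: sc_mult mult.assoc)

lemma lookup_sc [simp]: "Poly_Mapping.lookup (sc c * t) w = c * Poly_Mapping.lookup t w"
proof (induction t arbitrary: c rule: tens_induct)
  case (scale d x)
  show ?case by (simp add: sc_assoc scale mult.assoc)
next
  case (mon u)
  show ?case by (simp add: mon_def sc_def mult_single lookup_single when_def)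
qed (simp_all add: distrib_left lookup_add)

lemma lookup_mon: "Poly_Mapping.lookup (mon u) w = (if letters w = u then 1 else 0)"
  by (cases w) (auto simp: mon_def lookup_single when_def)

lemma keys_mon [simp]: "Poly_Mapping.keys (mon u) = {TWord u}"
  by (simp add: mon_def)

lemma keys_sc_mult: "Poly_Mapping.keys (sc c * t) \<subseteq> Poly_Mapping.keys t"
  by (auto simp: in_keys_iff)

subsection \<open>Linear functionals and linear maps given on words\<close>

definition wsum :: "(nat list \<Rightarrow> kq) \<Rightarrow> tens \<Rightarrow> kq" where
  "wsum f t = (\<Sum>w\<in>Poly_Mapping.keys t. Poly_Mapping.lookup t w * f (letters w))"

lemma wsum_superset:
  assumes "finite A" "Poly_Mapping.keys t \<subseteq> A"
  shows "wsum f t = (\<Sum>w\<in>A. Poly_Mapping.lookup t w * f (letters w))"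
  unfolding wsum_def
  by (rule sum.mono_neutral_left) (use assms in \<open>auto simp: in_keys_iff\<close>)

lemma wsum_add: "wsum f (s + t) = wsum f s + wsum f t"
proof -
  let ?A = "Poly_Mapping.keys s \<union> Poly_Mapping.keys t"
  have "Poly_Mapping.keys (s + t) \<subseteq> ?A" by (rule keys_add)
  thus ?thesis
    by (simp add: wsum_superset[of ?A] lookup_add distrib_right sum.distrib)
qed

lemma wsum_sc: "wsum f (sc c * t) = c * wsum f t"
  by (subst wsum_superset[OF finite_keys keys_sc_mult]) (simp add: wsum_def sum_distrib_left mult.assoc)

lemma wsum_0 [simp]: "wsum f 0 = 0"
  by (simp add: wsum_def)

lemma wsum_mon [simp]: "wsum f (mon w) = f w"
  by (simp add: wsum_def lookup_mon)

lemma wsum_minus: "wsum f (- t) = - wsum f t"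
  by (simp add: wsum_def keys_minus sum_negf)

lemma wsum_diff: "wsum f (s - t) = wsum f s - wsum f t"
  using wsum_add[of f s "- t"] by (simp add: wsum_minus)

lemma wsum_sum: "wsum f (sum g A) = (\<Sum>x\<in>A. wsum f (g x))"
  by (induction A rule: infinite_finite_induct) (simp_all add: wsum_add)

lemmas wsum_linear = wsum_add wsum_diff wsum_minus wsum_sc wsum_sum

lemma wsum_mult: "wsum f (s * t) = wsum (\<lambda>u. wsum (\<lambda>v. f (u @ v)) t) s"
proof (induction s rule: tens_induct)
  case (mon u)
  show ?case
    by (induction t rule: tens_induct)
       (simp_all add: wsum_linear distrib_left sc_left_commute mon_append[symmetric])
qed (simp_all add: wsum_linear distrib_right mult.assoc)

lemma wsum_cong:
  assumes "\<And>w. w \<in> Poly_Mapping.keys t \<Longrightarrow> f (letters w) = g (letters w)"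
  shows "wsum f t = wsum g t"
  unfolding wsum_def by (rule sum.cong) (use assms in auto)

lemma wsum_fun_add: "wsum (\<lambda>w. f w + g w) t = wsum f t + wsum g t"
  by (simp add: wsum_def distrib_left sum.distrib)

lemma wsum_fmult: "wsum (\<lambda>w. c * f w) t = c * wsum f t"
  by (simp add: wsum_def sum_distrib_left mult.left_commute)

lemma wsum_f0 [simp]: "wsum (\<lambda>w. 0) t = 0"
  by (simp add: wsum_def)

lemma lin_ext_superset:
  assumes "finite A" "Poly_Mapping.keys t \<subseteq> A"
  shows "lin_ext f t = (\<Sum>w\<in>A. sc (Poly_Mapping.lookup t w) * f (letters w))"
  unfolding lin_ext_def
  by (rule sum.mono_neutral_left) (use assms in \<open>auto simp: in_keys_iff\<close>)

lemma lin_ext_add: "lin_ext f (s + t) = lin_ext f s + lin_ext f t"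
proof -
  let ?A = "Poly_Mapping.keys s \<union> Poly_Mapping.keys t"
  have "Poly_Mapping.keys (s + t) \<subseteq> ?A" by (rule keys_add)
  thus ?thesis
    by (simp add: lin_ext_superset[of ?A] lookup_add distrib_right sum.distrib sc_add)
qed

lemma lin_ext_sc: "lin_ext f (sc c * t) = sc c * lin_ext f t"
  by (subst lin_ext_superset[OF finite_keys keys_sc_mult]) (simp add: lin_ext_def sum_distrib_left mult.assoc sc_mult)

lemma lin_ext_mon [simp]: "lin_ext f (mon w) = f w"
  by (simp add: lin_ext_def lookup_mon)

definition lin :: "(tens \<Rightarrow> tens) \<Rightarrow> bool" where
  "lin L \<longleftrightarrow> (\<forall>x y. L (x + y) = L x + L y) \<and> (\<forall>c x. L (sc c * x) = sc c * L x)"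

lemma linI: "(\<And>x y. L (x + y) = L x + L y) \<Longrightarrow> (\<And>c x. L (sc c * x) = sc c * L x) \<Longrightarrow> lin L"
  by (simp add: lin_def)

lemma lin_lin_ext [simp]: "lin (lin_ext f)"
  by (simp add: lin_def lin_ext_add lin_ext_sc)

lemma lin_add: "lin L \<Longrightarrow> L (x + y) = L x + L y"
  and lin_sc: "lin L \<Longrightarrow> L (sc c * x) = sc c * L x"
  by (simp_all add: lin_def)

lemma lin_0: "lin L \<Longrightarrow> L 0 = 0"
  using lin_sc[of L 0 0] by simp

lemma lin_minus: "lin L \<Longrightarrow> L (- x) = - L x"
  using lin_sc[of L "-1" x] by (simp add: sc_minus)

lemma lin_diff: "lin L \<Longrightarrow> L (x - y) = L x - L y"
  using lin_add[of L x "- y"] by (simp add: lin_minus)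

lemma lin_sum: "lin L \<Longrightarrow> L (sum g A) = (\<Sum>x\<in>A. L (g x))"
  by (induction A rule: infinite_finite_induct) (simp_all add: lin_add lin_0)

lemmas lin_simps = lin_add lin_diff lin_minus lin_sc lin_sum lin_0

lemma lin_eqI:
  assumes "lin L" "lin M" "\<And>w. w \<in> Poly_Mapping.keys t \<Longrightarrow> L (mon (letters w)) = M (mon (letters w))"
  shows "L t = M t"
  by (rule tens_induct_keys[of t "\<lambda>w. L (mon w) = M (mon w)"]) (use assms in \<open>simp_all add: lin_simps\<close>)

definition subsp :: "tens set \<Rightarrow> bool" where
  "subsp S \<longleftrightarrow> 0 \<in> S \<and> (\<forall>x\<in>S. \<forall>y\<in>S. x + y \<in> S) \<and> (\<forall>c. \<forall>x\<in>S. sc c * x \<in> S)"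

lemma subspD:
  assumes "subsp S"
  shows "0 \<in> S" "x \<in> S \<Longrightarrow> y \<in> S \<Longrightarrow> x + y \<in> S" "x \<in> S \<Longrightarrow> sc c * x \<in> S"
    "x \<in> S \<Longrightarrow> - x \<in> S" "x \<in> S \<Longrightarrow> y \<in> S \<Longrightarrow> x - y \<in> S"
proof -
  show "0 \<in> S" and a: "\<And>x y. x \<in> S \<Longrightarrow> y \<in> S \<Longrightarrow> x + y \<in> S" and s: "\<And>c x. x \<in> S \<Longrightarrow> sc c * x \<in> S"
    using assms by (auto simp: subsp_def)
  show m: "- x \<in> S" if "x \<in> S" for x
    using s[OF that, of "-1"] by (simp add: sc_minus)
  show "x - y \<in> S" if "x \<in> S" "y \<in> S"
    using a[OF that(1) m[OF that(2)]] by simp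
qed

lemma subsp_sum: "subsp S \<Longrightarrow> (\<And>x. x \<in> A \<Longrightarrow> g x \<in> S) \<Longrightarrow> sum g A \<in> S"
  by (induction A rule: infinite_finite_induct) (auto simp: subspD)

lemma subsp_scD:
  assumes "subsp S" "sc c * x \<in> S" "c \<noteq> 0"
  shows "x \<in> S"
  using subspD(3)[OF assms(1,2), of "inverse c"] assms(3) by (simp add: sc_assoc)

lemma subsp_vimage: "lin L \<Longrightarrow> subsp S \<Longrightarrow> subsp {t. L t \<in> S}"
  by (auto simp: subsp_def lin_simps)

lemma subsp_Int: "subsp S \<Longrightarrow> subsp T \<Longrightarrow> subsp (S \<inter> T)"
  by (auto simp: subsp_def)

lemma subsp_wsum: "subsp {t. wsum f t = 0}"
  by (simp add: subsp_def wsum_linear)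

lemma subsp_words: "subsp {t. \<forall>w\<in>Poly_Mapping.keys t. Q w}"
  using keys_add keys_sc_mult unfolding subsp_def by fastforce

lemma subsp_tdeg: "subsp (tdeg m d)"
  unfolding tdeg_def by (rule subsp_words)

text \<open>Tensors of degree \<open>d\<close> and of weight \<open>dm - 2s\<close>.\<close>

definition tw :: "nat \<Rightarrow> nat \<Rightarrow> nat \<Rightarrow> tens set" where
  "tw m d s = {t. \<forall>w\<in>Poly_Mapping.keys t.
     length (letters w) = d \<and> set (letters w) \<subseteq> {..m} \<and> sum_list (letters w) = s}"

lemma subsp_tw: "subsp (tw m d s)"
  unfolding tw_def by (rule subsp_words)

lemma tw_tdeg: "tw m d s \<subseteq> tdeg m d"
  by (auto simp: tw_def tdeg_def)

lemma mon_tdeg [simp]: "mon w \<in> tdeg m d \<longleftrightarrow> length w = d \<and> set w \<subseteq> {..m}"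
  by (simp add: tdeg_def)

lemma mon_tw [simp]: "mon w \<in> tw m d s \<longleftrightarrow> length w = d \<and> set w \<subseteq> {..m} \<and> sum_list w = s"
  by (simp add: tw_def)

lemma tdeg_induct [consumes 1, case_names zero add scale mon]:
  assumes "t \<in> tdeg m d"
    and "S 0" "\<And>x y. S x \<Longrightarrow> S y \<Longrightarrow> S (x + y)" "\<And>c x. S x \<Longrightarrow> S (sc c * x)"
    and "\<And>w. length w = d \<Longrightarrow> set w \<subseteq> {..m} \<Longrightarrow> S (mon w)"
  shows "S t"
  by (rule tens_induct_keys[of t "\<lambda>w. length w = d \<and> set w \<subseteq> {..m}"]) (use assms in \<open>auto simp: tdeg_def\<close>)

lemma tw_induct [consumes 1, case_names zero add scale mon]:
  assumes "t \<in> tw m d s"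
    and "S 0" "\<And>x y. S x \<Longrightarrow> S y \<Longrightarrow> S (x + y)" "\<And>c x. S x \<Longrightarrow> S (sc c * x)"
    and "\<And>w. length w = d \<Longrightarrow> set w \<subseteq> {..m} \<Longrightarrow> sum_list w = s \<Longrightarrow> S (mon w)"
  shows "S t"
  by (rule tens_induct_keys[of t "\<lambda>w. length w = d \<and> set w \<subseteq> {..m} \<and> sum_list w = s"])
     (use assms in \<open>auto simp: tw_def\<close>)

lemma tdeg_mult: "s \<in> tdeg m d \<Longrightarrow> t \<in> tdeg m e \<Longrightarrow> s * t \<in> tdeg m (d + e)"
  using keys_mult[of s t] unfolding tdeg_def by (fastforce simp: plus_tword_def)

lemma tw_mult: "s \<in> tw m d a \<Longrightarrow> t \<in> tw m e b \<Longrightarrow> s * t \<in> tw m (d + e) (a + b)"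
  using keys_mult[of s t] unfolding tw_def by (fastforce simp: plus_tword_def)

section \<open>The action of the quantum group on tensors\<close>

lemma lin_act [simp]: "lin (act m g)"
  by (simp add: act_def)

lemmas act_simps = lin_simps[OF lin_act]

lemma act_mon: "act m g (mon w) = word_act m g w"
  by (simp add: act_def)

lemma word_act_U1: "word_act m U1 w = mon w"
proof (induction w)
  case (Cons i w)
  thus ?case by (simp add: mon_append[symmetric])
qed simp

lemma word_act_append:
  "word_act m g (u @ v) = (\<Sum>(g1, g2) \<leftarrow> copr g. word_act m g1 u * word_act m g2 v)"
proof (induction u arbitrary: g)
  case Nil
  show ?case by (cases g) (simp_all add: word_act_U1)
next
  case (Cons i u)
  show ?case
    by (cases g) (simp_all add: Cons.IH algebra_simps)
qed

lemma act_mult: "act m g (s * t) = (\<Sum>(g1, g2) \<leftarrow> copr g. act m g1 s * act m g2 t)"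
proof (induction s rule: tens_induct)
  case (mon u)
  show ?case
  proof (induction t rule: tens_induct)
    case (add x y)
    thus ?case by (cases g) (simp_all add: act_simps distrib_left)
  next
    case (scale c x)
    thus ?case by (cases g) (simp_all add: act_simps distrib_left sc_left_commute)
  next
    case (mon v)
    show ?case by (simp add: mon_append[symmetric] act_mon word_act_append)
  qed (cases g; simp add: act_simps)
next
  case (add x y)
  thus ?case by (cases g) (simp_all add: act_simps distrib_right)
next
  case (scale c x)
  thus ?case by (cases g) (simp_all add: act_simps distrib_left mult.assoc)
qed (cases g; simp add: act_simps)

lemma act_U1 [simp]: "act m U1 t = t"
  using lin_eqI[of "act m U1" "\<lambda>x. x" t] by (simp add: lin_def[of "\<lambda>x. x"] act_mon word_act_U1)

lemma act_E_mult: "act m UE (s * t) = act m UE s * t + act m UK s * act m UE t"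
  and act_F_mult: "act m UF (s * t) = act m UF s * act m UKinv t + s * act m UF t"
  and act_K_mult: "act m UK (s * t) = act m UK s * act m UK t"
  and act_Kinv_mult: "act m UKinv (s * t) = act m UKinv s * act m UKinv t"
  by (simp_all add: act_mult)

lemma act_sc: "act m g (sc c) = sc (counit g * c)"
  using lin_sc[OF lin_act, of m g c 1] act_mon[of m g "[]"]
  by (simp add: sc_mult[symmetric] mult.commute)

section \<open>Quadratic tensors and the braiding\<close>

subsection \<open>Identities for quantum integers\<close>

text \<open>The quantum analogue of \<open>xy - (x-n)(y+n) = n (y-x+n)\<close>.\<close>

lemma qi_mult_diff: "qi x * qi y - qi (x - n) * qi (y + n) = qi n * qi (y - x + n)"
proof -
  have *: "qq powi (a + b) = qq powi a * qq powi b" "qq powi (a - b) = qq powi a / qq powi b"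
    "qq powi (- a) = 1 / qq powi a" for a b :: int
    by (simp_all add: power_int_add power_int_diff power_int_minus field_simps)
  show ?thesis
    unfolding qi_def * minus_add_distrib minus_diff_eq
    by (simp add: * divide_simps) (simp add: algebra_simps)
qed

text \<open>The products that occur in the matrix coefficients of powers of \<open>E\<close> and \<open>F\<close>.\<close>

definition qprod :: "nat \<Rightarrow> int \<Rightarrow> kq" where
  "qprod k x = (\<Prod>s=1..k. qi (x + int s))"

lemma qprod_0 [simp]: "qprod 0 x = 1"
  by (simp add: qprod_def)

lemma qprod_Suc: "qprod (Suc k) x = qprod k x * qi (x + int k + 1)"
  by (simp add: qprod_def algebra_simps)

lemma qprod_Suc_left: "qprod (Suc k) x = qi (x + 1) * qprod k (x + 1)"
proof (induction k)
  case 0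
  show ?case by (simp add: qprod_Suc[of 0])
next
  case (Suc k)
  have "qprod (Suc (Suc k)) x = qprod (Suc k) x * qi (x + int (Suc k) + 1)"
    by (rule qprod_Suc)
  also have "\<dots> = qi (x + 1) * (qprod k (x + 1) * qi (x + 1 + int k + 1))"
    by (simp only: Suc mult.assoc) (simp add: add_ac)
  finally show ?case by (simp only: qprod_Suc)
qed

lemma qprod_eq_0: "x < 0 \<Longrightarrow> - x \<le> int k \<Longrightarrow> qprod k x = 0"
  unfolding qprod_def by (rule prod_zero) (auto intro!: bexI[of _ "nat (- x)"])

lemma theta_coeff_0 [simp]: "theta_coeff 0 = 1"
  by (simp add: theta_coeff_def qfact_def)

lemma theta_coeff_Suc:
  "theta_coeff (Suc k) = - (theta_coeff k * qq powi (- int k) * qd / qi (int k + 1))"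
proof -
  have "Suc k * k div 2 = k * (k - 1) div 2 + k"
    by (cases k) (simp_all add: algebra_simps)
  hence "inverse qq ^ (Suc k * (Suc k - 1) div 2) = inverse qq ^ (k * (k - 1) div 2) * qq powi (- int k)"
    by (simp add: power_add power_int_minus power_inverse)
  moreover have "qfact (Suc k) = qfact k * qi (int k + 1)"
    by (simp add: qfact_def qint_qi add.commute)
  ultimately show ?thesis
    unfolding theta_coeff_def qd_def[symmetric] by (simp only: power_Suc) simp
qed

text \<open>Two consecutive coefficients of the quasi-R-matrix \<open>\<Theta>\<close> are related in the way that makes the
  braiding commute with \<open>E\<close> and \<open>F\<close>.\<close>

lemma theta_coeff_step:
  "theta_coeff (Suc k) * (qi x * qi y - qi (x - int k - 1) * qi (y + int k + 1))
     = theta_coeff k * (qq powi (x - y - 2 * int k - 1) - qq powi (y - x + 1))"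
proof -
  have *: "qi x * qi y - qi (x - int k - 1) * qi (y + int k + 1) = qi (int k + 1) * qi (y - x + int k + 1)"
    using qi_mult_diff[of x y "int k + 1"] by (simp add: algebra_simps)
  have "qq powi (- int k) * (qq powi (y - x + int k + 1) - qq powi (- (y - x + int k + 1)))
      = qq powi (y - x + 1) - qq powi (x - y - 2 * int k - 1)"
    unfolding right_diff_distrib power_int_add[symmetric, OF disjI1[OF qq_neq_0]]
    by (simp add: algebra_simps del: qq_powi_eq_iff)
  hence "qq powi (- int k) * qd * qi (y - x + int k + 1) = qq powi (y - x + 1) - qq powi (x - y - 2 * int k - 1)"
    by (simp add: qi_def)
  moreover have "qi (int k + 1) \<noteq> 0" by simp
  ultimately have "theta_coeff (Suc k) * (qi (int k + 1) * qi (y - x + int k + 1))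
      = - (theta_coeff k * (qq powi (y - x + 1) - qq powi (x - y - 2 * int k - 1)))"
    by (simp only: theta_coeff_Suc) (simp add: mult.assoc[symmetric])
  with * show ?thesis by (simp add: right_diff_distrib)
qed

subsection \<open>Basis vectors with integral indices\<close>

text \<open>Setting the basis vectors outside the range of indices to zero makes the following formulas
  for the action and for the braiding unconditional.\<close>

definition vv :: "nat \<Rightarrow> int \<Rightarrow> tens" where
  "vv m i = (if 0 \<le> i \<and> i \<le> int m then mon [nat i] else 0)"

lemma vv_int: "i \<le> m \<Longrightarrow> vv m (int i) = mon [i]"
  by (simp add: vv_def)

lemma vv_cases:
  obtains a where "i = int a" "a \<le> m" "vv m i = mon [a]" | "i < 0 \<or> i > int m" "vv m i = 0"
  by (cases "0 \<le> i \<and> i \<le> int m") (auto simp: vv_def nat_le_iff intro: that(1)[of "nat i"] that(2))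

lemma act_F_vv: "act m UF (vv m i) = sc (qi (i + 1)) * vv m (i + 1)"
proof (cases rule: vv_cases[of i m])
  case (1 a)
  have "nat (int a + 1) = Suc a" by simp
  with 1 show ?thesis by (auto simp: act_mon qint_qi vv_def add.commute)
next
  case 2
  hence "i + 1 = 0 \<or> vv m (i + 1) = 0" by (auto simp: vv_def)
  with 2 show ?thesis by (auto simp: act_simps)
qed

lemma act_E_vv: "act m UE (vv m i) = sc (qi (int m + 1 - i)) * vv m (i - 1)"
proof (cases rule: vv_cases[of i m])
  case (1 a)
  have "int (Suc m - a) = int m + 1 - int a" using 1 by simp
  moreover have "nat (int a - 1) = a - 1" by simp
  ultimately show ?thesis using 1 by (auto simp: act_mon qint_qi vv_def simp del: of_nat_diff)
next
  case 2
  hence "int m + 1 - i = 0 \<or> vv m (i - 1) = 0" by (auto simp: vv_def)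
  with 2 show ?thesis by (auto simp: act_simps)
qed

lemma act_K_vv: "act m UK (vv m i) = sc (qq powi (int m - 2 * i)) * vv m i"
  and act_Kinv_vv: "act m UKinv (vv m i) = sc (qq powi (2 * i - int m)) * vv m i"
  by (cases rule: vv_cases[of i m]; auto simp: act_mon act_simps)+

lemmas act_vv = act_F_vv act_E_vv act_K_vv act_Kinv_vv

lemma vv_sc: "vv m i * (sc c * t) = sc c * (vv m i * t)"
  by (rule sc_left_commute)

lemma act_F_pow_vv: "(act m UF ^^ k) (vv m i) = sc (qprod k i) * vv m (i + int k)"
  by (induction k) (simp_all add: act_simps act_vv sc_assoc qprod_Suc add_ac)

lemma act_E_pow_vv: "(act m UE ^^ k) (vv m i) = sc (qprod k (int m - i)) * vv m (i - int k)"
  by (induction k) (simp_all add: act_simps act_vv sc_assoc qprod_Suc algebra_simps)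

text \<open>The pure tensor \<open>v\<^sub>i \<otimes> v\<^sub>j\<close>.\<close>

definition ee :: "nat \<Rightarrow> int \<Rightarrow> int \<Rightarrow> tens" where
  "ee m i j = vv m i * vv m j"

lemma ee_out: "i < 0 \<or> i > int m \<or> j < 0 \<or> j > int m \<Longrightarrow> ee m i j = 0"
  by (auto simp: ee_def vv_def)

lemma ee_int: "i \<le> m \<Longrightarrow> j \<le> m \<Longrightarrow> ee m (int i) (int j) = mon [i, j]"
  by (simp add: ee_def vv_int mon_Cons[of i "[j]"])

lemma ee_mon: "0 \<le> i \<Longrightarrow> i \<le> int m \<Longrightarrow> 0 \<le> j \<Longrightarrow> j \<le> int m \<Longrightarrow> ee m i j = mon [nat i, nat j]"
  using ee_int[of "nat i" m "nat j"] by simp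

lemma act_ee:
  "act m UF (ee m i j) = sc (qi (i + 1) * qq powi (2 * j - int m)) * ee m (i + 1) j + sc (qi (j + 1)) * ee m i (j + 1)"
  "act m UE (ee m i j) = sc (qi (int m + 1 - i)) * ee m (i - 1) j
     + sc (qq powi (int m - 2 * i) * qi (int m + 1 - j)) * ee m i (j - 1)"
  "act m UK (ee m i j) = sc (qq powi (2 * int m - 2 * i - 2 * j)) * ee m i j"
  "act m UKinv (ee m i j) = sc (qq powi (2 * i + 2 * j - 2 * int m)) * ee m i j"
proof -
  have q: "qq powi a * qq powi b = qq powi (a + b)" for a b by (simp add: power_int_add)
  show "act m UF (ee m i j) = sc (qi (i + 1) * qq powi (2 * j - int m)) * ee m (i + 1) j + sc (qi (j + 1)) * ee m i (j + 1)"
    and "act m UE (ee m i j) = sc (qi (int m + 1 - i)) * ee m (i - 1) j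
     + sc (qq powi (int m - 2 * i) * qi (int m + 1 - j)) * ee m i (j - 1)"
    by (simp_all add: ee_def act_F_mult act_E_mult act_vv vv_sc mult.assoc sc_assoc)
  show "act m UK (ee m i j) = sc (qq powi (2 * int m - 2 * i - 2 * j)) * ee m i j"
    and "act m UKinv (ee m i j) = sc (qq powi (2 * i + 2 * j - 2 * int m)) * ee m i j"
    by (simp_all add: ee_def act_K_mult act_Kinv_mult act_vv vv_sc mult.assoc sc_assoc q algebra_simps)
qed

lemma T2_induct [consumes 1, case_names zero add scale ee]:
  assumes "t \<in> tdeg m 2"
    and "S 0" "\<And>x y. S x \<Longrightarrow> S y \<Longrightarrow> S (x + y)" "\<And>c x. S x \<Longrightarrow> S (sc c * x)"
    and "\<And>i j. 0 \<le> i \<Longrightarrow> i \<le> int m \<Longrightarrow> 0 \<le> j \<Longrightarrow> j \<le> int m \<Longrightarrow> S (ee m i j)"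
  shows "S t"
  using assms(1)
proof (induction rule: tdeg_induct)
  case (mon w)
  then obtain a b where "w = [a, b]" "a \<le> m" "b \<le> m"
    by (auto simp: numeral_2_eq_2 length_Suc_conv)
  thus ?case using assms(5)[of "int a" "int b"] by (simp add: ee_int)
qed (use assms in auto)

lemma tw2_induct [consumes 1, case_names zero add scale ee]:
  assumes "t \<in> tw m 2 n"
    and "S 0" "\<And>x y. S x \<Longrightarrow> S y \<Longrightarrow> S (x + y)" "\<And>c x. S x \<Longrightarrow> S (sc c * x)"
    and "\<And>i j. 0 \<le> i \<Longrightarrow> i \<le> int m \<Longrightarrow> 0 \<le> j \<Longrightarrow> j \<le> int m \<Longrightarrow> i + j = int n \<Longrightarrow> S (ee m i j)"
  shows "S t"
  using assms(1)
proof (induction rule: tw_induct)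
  case (mon w)
  then obtain a b where "w = [a, b]" "a \<le> m" "b \<le> m" "a + b = n"
    by (auto simp: numeral_2_eq_2 length_Suc_conv)
  thus ?case using assms(5)[of "int a" "int b"] by (simp add: ee_int)
qed (use assms in auto)

lemma ee_tw: "i + j = int n \<Longrightarrow> ee m i j \<in> tw m 2 n"
proof (cases "i < 0 \<or> i > int m \<or> j < 0 \<or> j > int m")
  case False
  moreover assume "i + j = int n"
  ultimately show ?thesis by (auto simp: ee_mon simp flip: nat_add_distrib)
qed (simp add: ee_out subspD[OF subsp_tw])

lemma ee_T2: "ee m i j \<in> tdeg m 2"
  by (cases "i < 0 \<or> i > int m \<or> j < 0 \<or> j > int m")
     (auto simp: ee_out ee_mon subspD[OF subsp_tdeg])

lemma act_T2: "t \<in> tdeg m 2 \<Longrightarrow> act m g t \<in> tdeg m 2"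
proof (induction rule: T2_induct)
  case (ee i j)
  show ?case
    by (cases g) (simp_all add: act_ee ee_T2 subspD[OF subsp_tdeg])
qed (simp_all add: act_simps subspD[OF subsp_tdeg])

lemma act_F_tw2: "t \<in> tw m 2 n \<Longrightarrow> act m UF t \<in> tw m 2 (Suc n)"
  by (induction rule: tw2_induct) (simp_all add: act_simps subspD[OF subsp_tw] act_ee ee_tw)

lemma act_E_tw2: "t \<in> tw m 2 (Suc n) \<Longrightarrow> act m UE t \<in> tw m 2 n"
  by (induction rule: tw2_induct) (simp_all add: act_simps subspD[OF subsp_tw] act_ee ee_tw)

subsection \<open>The braiding commutes with the action\<close>

definition braid_coeff :: "nat \<Rightarrow> int \<Rightarrow> int \<Rightarrow> nat \<Rightarrow> kq" where
  "braid_coeff m i j k = qq powi (int m * (i + j) - 2 * i * j) * (theta_coeff k * (qprod k j * qprod k (int m - i)))"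

lemma lin_braiding [simp]: "lin (braiding m)"
  by (simp add: braiding_def)

lemmas braiding_simps = lin_simps[OF lin_braiding]

lemma braiding_ee:
  "braiding m (ee m i j) = (\<Sum>k\<le>m. sc (braid_coeff m i j k) * ee m (j + int k) (i - int k))"
proof (cases "0 \<le> i \<and> i \<le> int m \<and> 0 \<le> j \<and> j \<le> int m")
  case True
  then obtain a b where ab: "i = int a" "j = int b" "a \<le> m" "b \<le> m"
    using zero_le_imp_eq_int by (metis of_nat_le_iff)
  have "braiding m (ee m i j) = braid_word m a b"
    by (simp add: ab ee_int braiding_def)
  also have "\<dots> = (\<Sum>k\<le>m. sc (braid_coeff m i j k) * ee m (j + int k) (i - int k))"
    unfolding braid_word_def vv_int[OF ab(3), symmetric] vv_int[OF ab(4), symmetric]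
      act_F_pow_vv act_E_pow_vv
    by (simp add: sum_distrib_left ee_def vv_sc mult.assoc sc_assoc braid_coeff_def ab)
  finally show ?thesis .
next
  case False
  have "sc (braid_coeff m i j k) * ee m (j + int k) (i - int k) = 0" for k
  proof (cases "ee m (j + int k) (i - int k) = 0")
    case nz: False
    hence *: "0 \<le> j + int k" "j + int k \<le> int m" "0 \<le> i - int k" "i - int k \<le> int m"
      using ee_out[of "j + int k" m "i - int k"] by force+
    have "qprod k j = 0 \<or> qprod k (int m - i) = 0"
    proof (cases "j < 0")
      case True
      thus ?thesis using * by (intro disjI1 qprod_eq_0) auto
    next
      case f: False
      thus ?thesis using False * by (intro disjI2 qprod_eq_0) auto
    qed
    thus ?thesis by (auto simp: braid_coeff_def)
  qed simp
  thus ?thesis using False by (subst ee_out) (auto simp: braiding_simps)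
qed

lemma braiding_T2: "t \<in> tdeg m 2 \<Longrightarrow> braiding m t \<in> tdeg m 2"
  by (induction rule: T2_induct)
     (simp_all add: braiding_simps braiding_ee subspD[OF subsp_tdeg] ee_T2 subsp_sum[OF subsp_tdeg])

lemma braiding_tw2: "t \<in> tw m 2 n \<Longrightarrow> braiding m t \<in> tw m 2 n"
  by (induction rule: tw2_induct)
     (simp_all add: braiding_simps braiding_ee subspD[OF subsp_tw] ee_tw subsp_sum[OF subsp_tw])

text \<open>Both sides of the commutation relation between the braiding and \<open>E\<close> or \<open>F\<close> are sums of two
  families, one of them with indices shifted by one. The hypothesis on \<open>x (Suc N)\<close> takes care of the
  boundary term, which lies outside the range of weights.\<close>

lemma shifted_sums_eq:
  fixes x :: "nat \<Rightarrow> tens"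
  assumes "A 0 = D 0" "\<And>k. A (Suc k) + B k = C k + D (Suc k)" "x (Suc N) = 0"
  shows "(\<Sum>k\<le>N. sc (A k) * x k) + (\<Sum>k\<le>N. sc (B k) * x (Suc k))
       = (\<Sum>k\<le>N. sc (C k) * x (Suc k)) + (\<Sum>k\<le>N. sc (D k) * x k)"
proof -
  have "(\<Sum>k\<le>n. sc (A k) * x k) + (\<Sum>k\<le>n. sc (B k) * x (Suc k)) + sc (A (Suc n)) * x (Suc n)
      = (\<Sum>k\<le>n. sc (C k) * x (Suc k)) + (\<Sum>k\<le>n. sc (D k) * x k) + sc (D (Suc n)) * x (Suc n)" for n
  proof (induction n)
    case 0
    show ?case using assms(1) assms(2)[of 0]
      by (simp add: distrib_right[symmetric] sc_add[symmetric] add.assoc) (simp add: add.left_commute add.commute sc_add[symmetric] distrib_right[symmetric])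
  next
    case (Suc n)
    have "sc (A (Suc (Suc n))) * x (Suc (Suc n)) + sc (B (Suc n)) * x (Suc (Suc n))
        = sc (C (Suc n)) * x (Suc (Suc n)) + sc (D (Suc (Suc n))) * x (Suc (Suc n))"
      by (simp add: distrib_right[symmetric] sc_add[symmetric] assms(2))
    with Suc show ?case by (simp add: algebra_simps)
  qed
  from this[of N] show ?thesis by (simp add: assms(3))
qed

lemma qq_powi_mult: "qq powi a * qq powi b = qq powi (a + b)"
  by (simp add: power_int_add)

lemma braiding_act_F:
  assumes "t \<in> tdeg m 2"
  shows "braiding m (act m UF t) = act m UF (braiding m t)"
  using assms
proof (induction rule: T2_induct)
  case (ee i j)
  let ?A = "\<lambda>k. qi (i + 1) * qq powi (2 * j - int m) * braid_coeff m (i + 1) j k"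
  let ?B = "\<lambda>k. qi (j + 1) * braid_coeff m i (j + 1) k"
  let ?C = "\<lambda>k. braid_coeff m i j k * (qi (j + int k + 1) * qq powi (2 * (i - int k) - int m))"
  let ?D = "\<lambda>k. braid_coeff m i j k * qi (i - int k + 1)"
  let ?x = "\<lambda>k. ee m (j + int k) (i + 1 - int k)"
  let ?Q = "int m * (i + j) - 2 * i * j"
  have rec: "?A (Suc k) + ?B k = ?C k + ?D (Suc k)" for k
  proof -
    let ?Z = "qq powi ?Q * (qprod k j * qprod k (int m - i) * qi (j + int k + 1))"
    have "?A (Suc k) = ?Z * (theta_coeff (Suc k) * (qi (i + 1) * qi (int m - i)))"
      using qprod_Suc_left[of k "int m - i - 1"]
        qq_powi_mult[of "2 * j - int m" "int m * (i + 1 + j) - 2 * (i + 1) * j"]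
      by (simp add: braid_coeff_def qprod_Suc algebra_simps)
    moreover have "?B k = ?Z * (theta_coeff k * qq powi (int m - 2 * i))"
      using qprod_Suc_left[of k j] qprod_Suc[of k j] qq_powi_mult[of ?Q "int m - 2 * i"]
      by (simp add: braid_coeff_def algebra_simps)
    moreover have "?C k = ?Z * (theta_coeff k * qq powi (2 * (i - int k) - int m))"
      by (simp add: braid_coeff_def)
    moreover have "?D (Suc k) = ?Z * (theta_coeff (Suc k) * (qi (i - int k) * qi (int m - i + int k + 1)))"
      by (simp add: braid_coeff_def qprod_Suc algebra_simps)
    moreover have "theta_coeff (Suc k) * (qi (i + 1) * qi (int m - i)) + theta_coeff k * qq powi (int m - 2 * i)
      = theta_coeff k * qq powi (2 * (i - int k) - int m)
        + theta_coeff (Suc k) * (qi (i - int k) * qi (int m - i + int k + 1))"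
      using theta_coeff_step[of k "i + 1" "int m - i"] by (simp add: algebra_simps)
    ultimately show ?thesis by (simp only: distrib_left[symmetric])
  qed
  have zero: "?A 0 = ?D 0"
    using qq_powi_mult[of "2 * j - int m" "int m * (i + 1 + j) - 2 * (i + 1) * j"]
    by (simp add: braid_coeff_def algebra_simps)
  have "braiding m (act m UF (ee m i j)) = (\<Sum>k\<le>m. sc (?A k) * ?x k) + (\<Sum>k\<le>m. sc (?B k) * ?x (Suc k))"
    by (simp add: act_ee braiding_simps braiding_ee sum_distrib_left sc_assoc mult.assoc add_ac)
  also have "\<dots> = (\<Sum>k\<le>m. sc (?C k) * ?x (Suc k)) + (\<Sum>k\<le>m. sc (?D k) * ?x k)"
    by (rule shifted_sums_eq[OF zero rec]) (use ee in \<open>simp add: ee_out\<close>)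
  also have "\<dots> = act m UF (braiding m (ee m i j))"
    by (simp add: act_simps braiding_ee act_ee distrib_left sum.distrib sc_assoc algebra_simps)
  finally show ?case .
qed (simp_all add: act_simps braiding_simps)

lemma braiding_act_E:
  assumes "t \<in> tdeg m 2"
  shows "braiding m (act m UE t) = act m UE (braiding m t)"
  using assms
proof (induction rule: T2_induct)
  case (ee i j)
  let ?A = "\<lambda>k. qq powi (int m - 2 * i) * qi (int m + 1 - j) * braid_coeff m i (j - 1) k"
  let ?B = "\<lambda>k. qi (int m + 1 - i) * braid_coeff m (i - 1) j k"
  let ?C = "\<lambda>k. braid_coeff m i j k * (qq powi (int m - 2 * (j + int k)) * qi (int m + 1 - (i - int k)))"
  let ?D = "\<lambda>k. braid_coeff m i j k * qi (int m + 1 - (j + int k))"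
  let ?x = "\<lambda>k. ee m (j - 1 + int k) (i - int k)"
  let ?Q = "int m * (i + j) - 2 * i * j"
  have rec: "?A (Suc k) + ?B k = ?C k + ?D (Suc k)" for k
  proof -
    let ?Z = "qq powi ?Q * (qprod k j * qprod k (int m - i) * qi (int m - i + int k + 1))"
    have "?A (Suc k) = ?Z * (theta_coeff (Suc k) * (qi (int m + 1 - j) * qi j))"
      using qprod_Suc_left[of k "j - 1"]
        qq_powi_mult[of "int m - 2 * i" "int m * (i + (j - 1)) - 2 * i * (j - 1)"]
      by (simp add: braid_coeff_def qprod_Suc[of k "int m - i"] algebra_simps)
    moreover have "?B k = ?Z * (theta_coeff k * qq powi (2 * j - int m))"
      using qprod_Suc_left[of k "int m - i"] qprod_Suc[of k "int m - i"] qq_powi_mult[of ?Q "2 * j - int m"]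
      by (simp add: braid_coeff_def algebra_simps)
    moreover have "?C k = ?Z * (theta_coeff k * qq powi (int m - 2 * (j + int k)))"
      by (simp add: braid_coeff_def algebra_simps)
    moreover have "?D (Suc k) = ?Z * (theta_coeff (Suc k) * (qi (int m - j - int k) * qi (j + int k + 1)))"
      by (simp add: braid_coeff_def qprod_Suc algebra_simps)
    moreover have "theta_coeff (Suc k) * (qi (int m + 1 - j) * qi j) + theta_coeff k * qq powi (2 * j - int m)
      = theta_coeff k * qq powi (int m - 2 * (j + int k))
        + theta_coeff (Suc k) * (qi (int m - j - int k) * qi (j + int k + 1))"
      using theta_coeff_step[of k "int m + 1 - j" j] by (simp add: algebra_simps)
    ultimately show ?thesis by (simp only: distrib_left[symmetric])
  qed
  have zero: "?A 0 = ?D 0"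
    using qq_powi_mult[of "int m - 2 * i" "int m * (i + (j - 1)) - 2 * i * (j - 1)"]
    by (simp add: braid_coeff_def algebra_simps)
  have "braiding m (act m UE (ee m i j)) = (\<Sum>k\<le>m. sc (?A k) * ?x k) + (\<Sum>k\<le>m. sc (?B k) * ?x (Suc k))"
    by (simp add: act_ee braiding_simps braiding_ee sum_distrib_left sc_assoc mult.assoc algebra_simps)
  also have "\<dots> = (\<Sum>k\<le>m. sc (?C k) * ?x (Suc k)) + (\<Sum>k\<le>m. sc (?D k) * ?x k)"
    by (rule shifted_sums_eq[OF zero rec]) (use ee in \<open>simp add: ee_out\<close>)
  also have "\<dots> = act m UE (braiding m (ee m i j))"
    by (simp add: act_simps braiding_ee act_ee distrib_left sum.distrib sc_assoc algebra_simps)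
  finally show ?case .
qed (simp_all add: act_simps braiding_simps)

lemma braiding_act:
  assumes "t \<in> tdeg m 2"
  shows "braiding m (act m g t) = act m g (braiding m t)"
proof (cases g)
  case UK
  have "braiding m (act m UK t) = act m UK (braiding m t)"
    using assms
    by (induction rule: T2_induct)
       (simp_all add: act_simps braiding_simps act_ee braiding_ee sum_distrib_left sc_assoc algebra_simps)
  with UK show ?thesis by simp
next
  case UKinv
  have "braiding m (act m UKinv t) = act m UKinv (braiding m t)"
    using assms
    by (induction rule: T2_induct)
       (simp_all add: act_simps braiding_simps act_ee braiding_ee sum_distrib_left sc_assoc algebra_simps)
  with UKinv show ?thesis by simp
qed (simp_all add: assms braiding_act_E braiding_act_F)

subsection \<open>The quantum exterior square\<close>

lemma module_tens: "Modules.module (\<lambda>c t. sc c * t)"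
  by standard (simp_all add: distrib_left distrib_right sc_add sc_mult mult.assoc)

lemma ext_squareI:
  assumes "t \<in> tdeg m 2" "braiding m t = - (sc (qq powi r) * t)"
  shows "t \<in> ext_square m"
  unfolding ext_square_def by (rule Modules.module.span_base[OF module_tens]) (use assms in blast)

lemma ext_square_subset:
  assumes "subsp S"
    and "\<And>t r. t \<in> tdeg m 2 \<Longrightarrow> braiding m t = - (sc (qq powi r) * t) \<Longrightarrow> t \<in> S"
  shows "ext_square m \<subseteq> S"
  unfolding ext_square_def
proof (rule Modules.module.span_minimal[OF module_tens])
  show "Modules.module.subspace (\<lambda>c t. sc c * t) S"
    using assms(1) by (simp add: Modules.module.subspace_def[OF module_tens] subsp_def)
qed (use assms(2) in auto)

lemma subsp_ext_square: "subsp (ext_square m)"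
  using Modules.module.subspace_span[OF module_tens, of "{t \<in> tdeg m 2. \<exists>r::int. braiding m t = - (sc (qq powi r) * t)}"]
  by (simp add: ext_square_def Modules.module.subspace_def[OF module_tens] subsp_def)

lemma ext_square_T2: "ext_square m \<subseteq> tdeg m 2"
  by (rule ext_square_subset[OF subsp_tdeg])

lemma ext_square_act:
  assumes "t \<in> ext_square m"
  shows "act m g t \<in> ext_square m"
proof -
  have "ext_square m \<subseteq> {t. act m g t \<in> ext_square m}"
  proof (rule ext_square_subset)
    fix t r assume t: "t \<in> tdeg m 2" and e: "braiding m t = - (sc (qq powi r) * t)"
    have "braiding m (act m g t) = - (sc (qq powi r) * act m g t)"
      by (simp only: braiding_act[OF t] e) (simp add: act_simps)
    thus "t \<in> {t. act m g t \<in> ext_square m}"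
      using ext_squareI[OF act_T2[OF t]] by blast
  qed (simp add: subsp_vimage subsp_ext_square)
  with assms show ?thesis by blast
qed

text \<open>The eigenvalue of the braiding on the summand of highest weight \<open>2m - 2n\<close>.\<close>

definition braid_eigenvalue :: "nat \<Rightarrow> nat \<Rightarrow> kq" where
  "braid_eigenvalue m n = (-1) ^ n * qq powi (int n * (2 * int m + 1 - int n))"

lemma braiding_ee0: "braiding m (ee m 0 j) = sc (qq powi (int m * j)) * ee m j 0"
proof -
  have "braid_coeff m 0 j k * 1 = 0 \<or> ee m (j + int k) (0 - int k) = 0" if "k \<noteq> 0" for k
    using that by (auto intro: ee_out)
  hence "(\<Sum>k\<le>m. sc (braid_coeff m 0 j k) * ee m (j + int k) (0 - int k))
      = (\<Sum>k\<in>{0}. sc (braid_coeff m 0 j k) * ee m (j + int k) (0 - int k))"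
    by (intro sum.mono_neutral_right) (auto simp: ee_out)
  thus ?thesis by (simp add: braiding_ee braid_coeff_def)
qed

text \<open>Applying \<open>F\<close> to \<open>v\<^sub>i \<otimes> v\<^sub>j\<close> trades \<open>v\<^bsub>i+1\<^esub> \<otimes> v\<^sub>j\<close> for a multiple of \<open>v\<^sub>i \<otimes> v\<^bsub>j+1\<^esub>\<close>, which moves a tensor
  towards \<open>v\<^sub>0 \<otimes> v\<^sub>n\<close>. The explicit scalar is used for \<open>v\<^sub>n \<otimes> v\<^sub>0\<close>, where it yields the eigenvalue of the
  braiding.\<close>

lemma ee_reduce:
  "\<exists>s\<in>{s. \<forall>n. int n + 1 = int i + j \<longrightarrow> s \<in> tw m 2 n}.
     ee m (int i) j = act m UF s
       + sc ((-1) ^ i * (\<Prod>t<i. qi (int i + j - int t) / qi (int t + 1))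
             * qq powi (int i * int m - 2 * int i * (int i + j - 1) + int i * (int i - 1))) * ee m 0 (int i + j)"
proof (induction i arbitrary: j)
  case 0
  show ?case by (intro bexI[of _ 0]) (simp_all add: act_simps subspD[OF subsp_tw])
next
  case (Suc i)
  obtain s where s: "\<And>n. int n + 1 = int (Suc i) + j \<Longrightarrow> s \<in> tw m 2 n"
    and es: "ee m (int i) (j + 1) = act m UF s
       + sc ((-1) ^ i * (\<Prod>t<i. qi (int (Suc i) + j - int t) / qi (int t + 1))
             * qq powi (int i * int m - 2 * int i * (int (Suc i) + j - 1) + int i * (int i - 1))) * ee m 0 (int (Suc i) + j)"
    using Suc[of "j + 1"] by (auto simp: add_ac)
  define a b where "a = qi (int i + 1) * qq powi (2 * j - int m)" and "b = qi (j + 1)"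
  have a0: "a \<noteq> 0" by (simp add: a_def)
  have "act m UF (ee m (int i) j) = sc a * ee m (int (Suc i)) j + sc b * ee m (int i) (j + 1)"
    by (simp add: act_ee a_def b_def add_ac)
  hence "ee m (int (Suc i)) j = sc (1 / a) * (act m UF (ee m (int i) j) - sc b * ee m (int i) (j + 1))"
    using a0 by (simp add: sc_assoc)
  also have "\<dots> = act m UF (sc (1 / a) * (ee m (int i) j - sc b * s))
       + sc (- (b / a) * ((-1) ^ i * (\<Prod>t<i. qi (int (Suc i) + j - int t) / qi (int t + 1))
             * qq powi (int i * int m - 2 * int i * (int (Suc i) + j - 1) + int i * (int i - 1)))) * ee m 0 (int (Suc i) + j)"
    by (simp add: es act_simps sc_assoc distrib_left right_diff_distrib sc_minus mult_ac)
  finally have 1: "ee m (int (Suc i)) j = \<dots>" .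
  have ex: "int m - 2 * j + (int i * int m - 2 * int i * (int (Suc i) + j - 1) + int i * (int i - 1))
      = int (Suc i) * int m - 2 * int (Suc i) * (int (Suc i) + j - 1) + int (Suc i) * (int (Suc i) - 1)"
    by (simp add: algebra_simps)
  have "b / a = qi (int (Suc i) + j - int i) / qi (int i + 1) * qq powi (int m - 2 * j)"
    using power_int_minus[of qq "2 * j - int m"] by (simp add: a_def b_def field_simps)
  hence 2: "- (b / a) * ((-1) ^ i * (\<Prod>t<i. qi (int (Suc i) + j - int t) / qi (int t + 1))
             * qq powi (int i * int m - 2 * int i * (int (Suc i) + j - 1) + int i * (int i - 1)))
    = (-1) ^ Suc i * (\<Prod>t<Suc i. qi (int (Suc i) + j - int t) / qi (int t + 1))
             * qq powi (int (Suc i) * int m - 2 * int (Suc i) * (int (Suc i) + j - 1) + int (Suc i) * (int (Suc i) - 1))"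
    unfolding ex[symmetric] qq_powi_mult[symmetric] by (simp add: mult_ac)
  have "sc (1 / a) * (ee m (int i) j - sc b * s) \<in> tw m 2 n" if "int n + 1 = int (Suc i) + j" for n
    using that s[of n] by (intro subspD[OF subsp_tw] ee_tw) auto
  thus ?case using 1 unfolding 2 by blast
qed

lemma tw2_reduce:
  assumes "t \<in> tw m 2 (Suc n)"
  shows "\<exists>s\<in>tw m 2 n. \<exists>c. t = act m UF s + sc c * ee m 0 (int (Suc n))"
  using assms
proof (induction rule: tw2_induct)
  case zero
  show ?case by (intro bexI[of _ 0] exI[of _ 0]) (simp_all add: act_simps subspD[OF subsp_tw])
next
  case (add x y)
  then obtain s c s' c' where "s \<in> tw m 2 n" "s' \<in> tw m 2 n"
    "x = act m UF s + sc c * ee m 0 (int (Suc n))" "y = act m UF s' + sc c' * ee m 0 (int (Suc n))" by blast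
  thus ?case
    by (intro bexI[of _ "s + s'"] exI[of _ "c + c'"])
       (simp_all add: act_simps subspD[OF subsp_tw] sc_add distrib_right)
next
  case (scale a x)
  then obtain s c where "s \<in> tw m 2 n" "x = act m UF s + sc c * ee m 0 (int (Suc n))" by blast
  thus ?case
    by (intro bexI[of _ "sc a * s"] exI[of _ "a * c"])
       (simp_all add: act_simps subspD[OF subsp_tw] sc_assoc distrib_left)
next
  case (ee i j)
  then obtain s c where "\<And>k. int k + 1 = int (nat i) + j \<Longrightarrow> s \<in> tw m 2 k"
    "ee m (int (nat i)) j = act m UF s + sc c * ee m 0 (int (nat i) + j)"
    using ee_reduce[of "nat i" j m] by blast
  with ee show ?case by (intro bexI[of _ s] exI[of _ c]) auto
qed

text \<open>The braiding maps \<open>v\<^sub>0 \<otimes> v\<^sub>n\<close> to a multiple of \<open>v\<^sub>n \<otimes> v\<^sub>0\<close>. Modulo the image of \<open>F\<close> the weight space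
  is a line, on which the braiding therefore acts by the eigenvalue of the summand \<open>V\<^bsub>2m-2n\<^esub>\<close>.\<close>

lemma braiding_ee0_reduce:
  "\<exists>s. (\<forall>k. n = Suc k \<longrightarrow> s \<in> tw m 2 k) \<and>
     braiding m (ee m 0 (int n)) = act m UF s + sc (braid_eigenvalue m n) * ee m 0 (int n)"
proof -
  obtain s where s: "\<And>k. int k + 1 = int n \<Longrightarrow> s \<in> tw m 2 k"
    and e: "ee m (int n) 0 = act m UF s + sc ((-1) ^ n * (\<Prod>t<n. qi (int n - int t) / qi (int t + 1))
             * qq powi (int n * int m - 2 * int n * (int n - 1) + int n * (int n - 1))) * ee m 0 (int n)"
    using ee_reduce[of n 0 m] by auto
  have "(\<Prod>t<n. qi (int n - int t)) = (\<Prod>t<n. qi (int (n - Suc t) + 1))"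
    by (rule prod.cong) (auto simp: of_nat_diff algebra_simps)
  also have "\<dots> = (\<Prod>t<n. qi (int t + 1))"
    by (rule prod.nat_diff_reindex)
  finally have "(\<Prod>t<n. qi (int n - int t) / qi (int t + 1)) = 1"
    by (simp add: prod_dividef)
  moreover have "int m * int n + (int n * int m - 2 * int n * (int n - 1) + int n * (int n - 1)) = int n * (2 * int m + 1 - int n)"
    by (simp add: algebra_simps)
  ultimately have "braiding m (ee m 0 (int n)) = act m UF (sc (qq powi (int m * int n)) * s) + sc (braid_eigenvalue m n) * ee m 0 (int n)"
    by (simp add: braiding_ee0 e distrib_left act_simps sc_assoc braid_eigenvalue_def mult.left_commute qq_powi_mult)
  moreover have "sc (qq powi (int m * int n)) * s \<in> tw m 2 k" if "n = Suc k" for k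
    using s[of k] that by (simp add: subspD[OF subsp_tw])
  ultimately show ?thesis by blast
qed

text \<open>The polynomial in the braiding whose roots are the eigenvalues on the summands with \<open>j\<close> even,
  for \<open>j \<le> n\<close>.\<close>

fun sym_killer :: "nat \<Rightarrow> nat \<Rightarrow> tens \<Rightarrow> tens" where
  "sym_killer m 0 t = braiding m t - t"
| "sym_killer m (Suc n) t = (if odd n then sym_killer m n (braiding m t - sc (braid_eigenvalue m (Suc n)) * t)
     else sym_killer m n t)"

lemma lin_sym_killer [simp]: "lin (sym_killer m n)"
proof (induction n)
  case 0
  show ?case by (rule linI) (simp_all add: braiding_simps right_diff_distrib)
next
  case (Suc n)
  show ?case
    by (rule linI) (simp_all add: braiding_simps lin_simps[OF Suc] distrib_left right_diff_distrib sc_assoc mult.commute)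
qed

lemmas sym_killer_simps = lin_simps[OF lin_sym_killer]

lemma sym_killer_act: "t \<in> tdeg m 2 \<Longrightarrow> sym_killer m n (act m g t) = act m g (sym_killer m n t)"
proof (induction n arbitrary: t)
  case (Suc n)
  have "braiding m t - sc (braid_eigenvalue m (Suc n)) * t \<in> tdeg m 2"
    using Suc.prems by (simp add: subspD[OF subsp_tdeg] braiding_T2)
  from Suc.IH[OF this] show ?case
    using Suc by (simp add: braiding_act[OF Suc.prems] act_simps)
qed (simp add: braiding_act act_simps)

lemma sym_killer_tw2: "t \<in> tw m 2 k \<Longrightarrow> sym_killer m n t \<in> tw m 2 k"
  by (induction n arbitrary: t) (simp_all add: subspD[OF subsp_tw] braiding_tw2)

text \<open>Minus a power of \<open>q\<close> is never one of the eigenvalues with \<open>j\<close> even, since these are powers of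
  \<open>q\<close>.\<close>

lemma sym_killer_eigen:
  assumes "braiding m t = - (sc (qq powi r) * t)"
  shows "\<exists>c. c \<noteq> 0 \<and> sym_killer m n t = sc c * t"
proof (induction n)
  case 0
  have "sym_killer m 0 t = sc (- (qq powi r) - 1) * t"
    by (simp add: assms sc_diff sc_minus left_diff_distrib)
  moreover have "- (qq powi r) - 1 \<noteq> 0"
    using qq_powi_neq_minus[of 0 r] by (simp add: eq_diff_eq[symmetric])
  ultimately show ?case by blast
next
  case (Suc n)
  then obtain c where c: "c \<noteq> 0" "sym_killer m n t = sc c * t" by blast
  show ?case
  proof (cases "odd n")
    case True
    have "sym_killer m (Suc n) t = sc ((- (qq powi r) - braid_eigenvalue m (Suc n)) * c) * t"
      using True by (simp add: assms sym_killer_simps c sc_assoc sc_diff sc_minus left_diff_distrib right_diff_distrib mult.commute)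
    moreover have "- (qq powi r) - braid_eigenvalue m (Suc n) \<noteq> 0"
      using True qq_powi_neq_minus[of "int (Suc n) * (2 * int m + 1 - int (Suc n))" r] by (auto simp: braid_eigenvalue_def)
    ultimately show ?thesis using c(1) by (metis mult_eq_0_iff)
  qed (use c in auto)
qed

text \<open>The polynomial above vanishes on the summands with \<open>j\<close> even, and on an eigenvector in the
  exterior square it is a nonzero scalar; so it suffices that it maps everything into \<open>K\<close>. This is
  shown by induction on the weight. By the reduction modulo the image of \<open>F\<close> only \<open>v\<^sub>0 \<otimes> v\<^sub>n\<close> has to be
  treated: for even \<open>n\<close> the next factor of the polynomial moves it into the image of \<open>F\<close>, and for odd
  \<open>n\<close> the hypothesis \<open>odd\<close> applies, because \<open>E\<close> lowers the index of the weight.\<close>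

lemma ext_square_subset_submodule:
  assumes K: "subsp K" and KF: "\<And>t. t \<in> tdeg m 2 \<Longrightarrow> t \<in> K \<Longrightarrow> act m UF t \<in> K"
    and odd: "\<And>t n. t \<in> tw m 2 (Suc n) \<Longrightarrow> even n \<Longrightarrow> act m UE t \<in> K \<Longrightarrow> t \<in> K"
  shows "ext_square m \<subseteq> K"
proof -
  have kill: "k \<le> n \<Longrightarrow> t \<in> tw m 2 k \<Longrightarrow> sym_killer m n t \<in> K" for n k t
  proof (induction n arbitrary: k t)
    case 0
    hence "t \<in> tw m 2 0" by simp
    thus ?case
    proof (induction rule: tw2_induct)
      case (ee i j)
      hence "i = 0" "j = 0" by linarith+
      thus ?case using braiding_ee0[of m 0] by (simp add: subspD[OF K])
    qed (use K in \<open>simp_all only: sym_killer_simps subspD[OF K]\<close>)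
  next
    case (Suc n)
    show ?case
    proof (cases "k \<le> n")
      case True
      have "braiding m t - sc (braid_eigenvalue m (Suc n)) * t \<in> tw m 2 k"
        using Suc.prems by (simp add: subspD[OF subsp_tw] braiding_tw2)
      thus ?thesis using Suc.IH[OF True] Suc.prems by simp
    next
      case False
      with Suc.prems have k: "k = Suc n" by simp
      from Suc.prems obtain s c where s: "s \<in> tw m 2 n" and t: "t = act m UF s + sc c * ee m 0 (int (Suc n))"
        using tw2_reduce[of t m n] unfolding k by blast
      have s2: "s \<in> tdeg m 2" using s tw_tdeg by blast
      show ?thesis
      proof (cases "odd n")
        case True
        obtain s' where s': "s' \<in> tw m 2 n"
          and e: "braiding m (ee m 0 (int (Suc n))) = act m UF s' + sc (braid_eigenvalue m (Suc n)) * ee m 0 (int (Suc n))"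
          using braiding_ee0_reduce[of "Suc n" m] by blast
        define u where "u = braiding m s - sc (braid_eigenvalue m (Suc n)) * s + sc c * s'"
        have u: "u \<in> tw m 2 n" using s s' by (simp add: u_def subspD[OF subsp_tw] braiding_tw2)
        have "braiding m t - sc (braid_eigenvalue m (Suc n)) * t = act m UF u"
          unfolding t u_def braiding_simps act_simps braiding_act[OF s2] e
          by (simp add: distrib_left right_diff_distrib sc_assoc mult.commute)
        hence "sym_killer m (Suc n) t = act m UF (sym_killer m n u)"
          using True subsetD[OF tw_tdeg u] by (simp add: sym_killer_act)
        also have "\<dots> \<in> K"
          using Suc.IH[OF order_refl u] sym_killer_tw2[OF u, of n] tw_tdeg by (intro KF) auto
        finally show ?thesis .
      next
        case False
        let ?e = "ee m 0 (int (Suc n))"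
        have e: "?e \<in> tw m 2 (Suc n)" by (rule ee_tw) simp
        have "act m UE (sym_killer m n ?e) = sym_killer m n (act m UE ?e)"
          by (rule sym_killer_act[symmetric]) (rule ee_T2)
        also have "\<dots> \<in> K" by (rule Suc.IH[OF order_refl act_E_tw2[OF e]])
        finally have "sym_killer m n ?e \<in> K"
          using odd[OF sym_killer_tw2[OF e]] False by blast
        moreover have "sym_killer m n (act m UF s) \<in> K"
          unfolding sym_killer_act[OF s2]
          using Suc.IH[OF order_refl s] sym_killer_tw2[OF s, of n] tw_tdeg by (intro KF) auto
        ultimately show ?thesis
          using False by (simp add: t sym_killer_simps subspD[OF K])
      qed
    qed
  qed
  have all: "sym_killer m (2 * m) t \<in> K" if "t \<in> tdeg m 2" for t
    using that
  proof (induction rule: T2_induct)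
    case (ee i j)
    thus ?case using ee_tw[of i j "nat (i + j)" m] kill[of "nat (i + j)" "2 * m"] by simp
  qed (use K in \<open>simp_all only: sym_killer_simps subspD[OF K]\<close>)
  show ?thesis
  proof (rule ext_square_subset[OF K])
    fix t r assume "t \<in> tdeg m 2" "braiding m t = - (sc (qq powi r) * t)"
    with all[of t] sym_killer_eigen[of m t r "2 * m"] show "t \<in> K"
      using subsp_scD[OF K] by metis
  qed
qed

subsection \<open>Highest weight vectors in the quantum exterior square\<close>

definition coeff2 :: "tens \<Rightarrow> nat \<Rightarrow> nat \<Rightarrow> kq" where
  "coeff2 t i k = Poly_Mapping.lookup t (TWord [i, k])"

lemma coeff2_lin: "coeff2 (x + y) i k = coeff2 x i k + coeff2 y i k" "coeff2 (x - y) i k = coeff2 x i k - coeff2 y i k"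
  "coeff2 (sc c * x) i k = c * coeff2 x i k" "coeff2 0 i k = 0" "coeff2 (- x) i k = - coeff2 x i k"
  by (simp_all add: coeff2_def lookup_add lookup_minus)

lemma coeff2_sum: "coeff2 (sum g A) i k = (\<Sum>x\<in>A. coeff2 (g x) i k)"
  by (simp add: coeff2_def Poly_Mapping.lookup_sum)

lemma coeff2_ee: "i \<le> m \<Longrightarrow> k \<le> m \<Longrightarrow> coeff2 (ee m a b) i k = (if a = int i \<and> b = int k then 1 else 0)"
  by (cases "a < 0 \<or> a > int m \<or> b < 0 \<or> b > int m")
     (auto simp: ee_out ee_mon coeff2_def lookup_mon)

lemma coeff2_F:
  assumes "t \<in> tdeg m 2" "i \<le> m" "k \<le> m"
  shows "coeff2 (act m UF t) i k = (if i = 0 then 0 else qi (int i) * qq powi (2 * int k - int m) * coeff2 t (i - 1) k)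
     + (if k = 0 then 0 else qi (int k) * coeff2 t i (k - 1))"
  using assms(1)
proof (induction rule: T2_induct)
  case (ee a b)
  have "a + 1 = int i \<longleftrightarrow> i \<noteq> 0 \<and> a = int (i - 1)" "b + 1 = int k \<longleftrightarrow> k \<noteq> 0 \<and> b = int (k - 1)"
    using ee by auto
  with assms show ?case by (auto simp: act_ee coeff2_lin coeff2_ee)
qed (simp_all add: act_simps coeff2_lin distrib_left mult_ac)

lemma coeff2_E:
  assumes "t \<in> tdeg m 2" "i < m" "k < m"
  shows "coeff2 (act m UE t) i k = qi (int m - int i) * coeff2 t (Suc i) k
     + qq powi (int m - 2 * int i) * qi (int m - int k) * coeff2 t i (Suc k)"
  using assms(1)
proof (induction rule: T2_induct)
  case (ee a b)
  have "a - 1 = int i \<longleftrightarrow> a = int (Suc i)" "b - 1 = int k \<longleftrightarrow> b = int (Suc k)" by auto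
  with assms show ?case by (auto simp: act_ee coeff2_lin coeff2_ee)
qed (simp_all add: act_simps coeff2_lin algebra_simps)

lemma tw2_eq_0:
  assumes "t \<in> tw m 2 n" "\<And>i k. i \<le> m \<Longrightarrow> k \<le> m \<Longrightarrow> i + k = n \<Longrightarrow> coeff2 t i k = 0"
  shows "t = 0"
proof (rule ccontr)
  assume "t \<noteq> 0"
  then obtain w where w: "w \<in> Poly_Mapping.keys t"
    using keys_eq_empty[of t] by blast
  with assms(1) have *: "length (letters w) = 2" "set (letters w) \<subseteq> {..m}" "sum_list (letters w) = n"
    by (auto simp: tw_def)
  then obtain a b where ab: "letters w = [a, b]"
    by (auto simp: numeral_2_eq_2 length_Suc_conv)
  with * w assms(2)[of a b] show False
    by (cases w) (auto simp: coeff2_def in_keys_iff)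
qed

text \<open>\<open>E t = 0\<close> is a recursion for the coefficients of \<open>v\<^sub>i \<otimes> v\<^bsub>n-i\<^esub>\<close>, whose leading scalars do not
  vanish for \<open>n \<le> m\<close>.\<close>

lemma kernel_E_unique:
  assumes "t \<in> tw m 2 n" "n \<le> m" "act m UE t = 0" "coeff2 t 0 n = 0"
  shows "t = 0"
proof -
  have "i \<le> n \<Longrightarrow> coeff2 t i (n - i) = 0" for i
  proof (induction i)
    case (Suc i)
    have "coeff2 (act m UE t) i (n - Suc i) = 0" by (simp add: assms coeff2_lin)
    moreover have "Suc (n - Suc i) = n - i" using Suc by simp
    ultimately have "qi (int m - int i) * coeff2 t (Suc i) (n - Suc i) = 0"
      using Suc assms tw_tdeg by (subst (asm) coeff2_E) auto
    thus ?case using Suc assms(2) by simp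
  qed (simp add: assms)
  thus ?thesis using tw2_eq_0[OF assms(1)] by (metis diff_add_inverse le_add1)
qed

text \<open>The solution of the recursion that \<open>E t = 0\<close> imposes on the coefficients of \<open>v\<^sub>i \<otimes> v\<^bsub>j-i\<^esub>\<close> in \<open>t\<close>,
  with value one at \<open>i = 0\<close>.\<close>

definition hw_coeff :: "nat \<Rightarrow> nat \<Rightarrow> nat \<Rightarrow> kq" where
  "hw_coeff m j i = (\<Prod>t<i. - (qq powi (int m - 2 * int t) * qi (int m + 1 - int j + int t) / qi (int m - int t)))"

definition hw :: "nat \<Rightarrow> nat \<Rightarrow> tens" where
  "hw m j = (\<Sum>i\<le>j. sc (hw_coeff m j i) * ee m (int i) (int j - int i))"

lemma hw_tw: "hw m j \<in> tw m 2 j"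
  unfolding hw_def by (intro subsp_sum[OF subsp_tw] subspD(3)[OF subsp_tw] ee_tw) simp

lemma coeff2_hw: "i + k = j \<Longrightarrow> j \<le> m \<Longrightarrow> coeff2 (hw m j) i k = hw_coeff m j i"
proof -
  assume a: "i + k = j" "j \<le> m"
  have "coeff2 (hw m j) i k = (\<Sum>x\<le>j. if x = i then hw_coeff m j x else 0)"
    unfolding hw_def coeff2_sum by (rule sum.cong) (use a in \<open>auto simp: coeff2_lin coeff2_ee\<close>)
  thus ?thesis using a by simp
qed

lemma hw_coeff_Suc: "hw_coeff m j (Suc i) = - (qq powi (int m - 2 * int i) * qi (int m + 1 - int j + int i) / qi (int m - int i)) * hw_coeff m j i"
  by (simp add: hw_coeff_def)

lemma hw_coeff_0 [simp]: "hw_coeff m j 0 = 1"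
  by (simp add: hw_coeff_def)

lemma act_E_hw:
  assumes "j \<le> m"
  shows "act m UE (hw m j) = 0"
proof (cases j)
  case 0
  thus ?thesis by (simp add: hw_def act_ee ee_out)
next
  case (Suc n)
  show ?thesis
  proof (rule tw2_eq_0)
    show "act m UE (hw m j) \<in> tw m 2 n" using hw_tw[of m j] unfolding Suc by (rule act_E_tw2)
  next
    fix i k assume ik: "i \<le> m" "k \<le> m" "i + k = n"
    hence "coeff2 (act m UE (hw m j)) i k = qi (int m - int i) * hw_coeff m j (Suc i)
     + qq powi (int m - 2 * int i) * qi (int m - int k) * hw_coeff m j i"
      using assms Suc hw_tw[of m j] tw_tdeg by (subst coeff2_E) (auto simp: coeff2_hw)
    also have "int m - int k = int m + 1 - int j + int i" using ik Suc by simp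
    finally show "coeff2 (act m UE (hw m j)) i k = 0"
      using ik assms Suc by (simp add: hw_coeff_Suc divide_simps)
  qed
qed

lemma hw_coeff_last:
  assumes "j \<le> m"
  shows "hw_coeff m j j = (-1) ^ j * qq powi (int j * int m - int j * (int j - 1))"
proof -
  have pw: "(\<Prod>t<i. qq powi (int m - 2 * int t)) = qq powi (int i * int m - int i * (int i - 1))" for i
    by (induction i) (simp_all add: qq_powi_mult algebra_simps)
  have "(\<Prod>t<j. qi (int m + 1 - int j + int t)) = (\<Prod>t<j. qi (int m - int (j - Suc t)))"
    by (rule prod.cong) (auto simp: of_nat_diff algebra_simps)
  also have "\<dots> = (\<Prod>t<j. qi (int m - int t))"
    by (rule prod.nat_diff_reindex)
  finally have "(\<Prod>t<j. qi (int m + 1 - int j + int t) / qi (int m - int t)) = 1"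
    using assms by (simp add: prod_dividef)
  moreover have "hw_coeff m j j = (\<Prod>t<j. (-1) * qq powi (int m - 2 * int t) * (qi (int m + 1 - int j + int t) / qi (int m - int t)))"
    by (simp add: hw_coeff_def)
  ultimately show ?thesis
    by (simp only: prod.distrib pw prod_constant card_lessThan mult_1_right)
qed

text \<open>The braiding preserves the line of highest weight vectors, and its eigenvalue can be read
  off at \<open>v\<^sub>0 \<otimes> v\<^sub>j\<close>, where only one term of the braiding contributes.\<close>

lemma hw_ext_square:
  assumes "odd j" "j \<le> m"
  shows "hw m j \<in> ext_square m"
proof -
  define c where "c = coeff2 (braiding m (hw m j)) 0 j"
  have T: "hw m j \<in> tdeg m 2" using hw_tw tw_tdeg by blast
  have c: "c = hw_coeff m j j * qq powi (int m * int j)"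
  proof -
    have "coeff2 (braiding m (hw m j)) 0 j
        = (\<Sum>i\<le>j. \<Sum>k\<le>m. hw_coeff m j i * (braid_coeff m (int i) (int j - int i) k *
             coeff2 (ee m (int j - int i + int k) (int i - int k)) 0 j))"
      by (simp add: hw_def braiding_simps braiding_ee coeff2_sum coeff2_lin sum_distrib_left)
    also have "\<dots> = (\<Sum>i\<le>j. \<Sum>k\<le>m. if k = 0 then (if i = j then hw_coeff m j j * braid_coeff m (int j) 0 0 else 0) else 0)"
      by (intro sum.cong) (use assms in \<open>auto simp: coeff2_ee\<close>)
    also have "\<dots> = hw_coeff m j j * braid_coeff m (int j) 0 0" by simp
    finally show ?thesis by (simp add: c_def braid_coeff_def)
  qed
  have "braiding m (hw m j) - sc c * hw m j = 0"
  proof (rule kernel_E_unique[OF _ assms(2)])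
    show "braiding m (hw m j) - sc c * hw m j \<in> tw m 2 j"
      by (intro subspD[OF subsp_tw] braiding_tw2 hw_tw)
    show "act m UE (braiding m (hw m j) - sc c * hw m j) = 0"
      using braiding_act[OF T, of UE] assms by (simp add: act_simps act_E_hw braiding_simps)
    show "coeff2 (braiding m (hw m j) - sc c * hw m j) 0 j = 0"
      using assms by (simp add: coeff2_lin coeff2_hw c_def)
  qed
  hence "braiding m (hw m j) = - (sc (qq powi (int j * int m - int j * (int j - 1) + int m * int j)) * hw m j)"
    using assms by (simp add: c hw_coeff_last qq_powi_mult sc_minus eq_neg_iff_add_eq_0)
  thus ?thesis by (rule ext_squareI[OF T])
qed

definition desc :: "nat \<Rightarrow> nat \<Rightarrow> nat \<Rightarrow> tens" where
  "desc m j N = (act m UF ^^ N) (hw m j)"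

lemma desc_simps [simp]: "desc m j 0 = hw m j" "desc m j (Suc N) = act m UF (desc m j N)"
  by (simp_all add: desc_def)

lemma desc_tw: "desc m j N \<in> tw m 2 (j + N)"
  by (induction N) (simp_all add: hw_tw act_F_tw2)

lemma desc_T2: "desc m j N \<in> tdeg m 2"
  using desc_tw tw_tdeg by blast

lemma desc_ext_square: "odd j \<Longrightarrow> j \<le> m \<Longrightarrow> desc m j N \<in> ext_square m"
  by (induction N) (simp_all add: hw_ext_square ext_square_act)

text \<open>At the two ends \<open>v\<^sub>0 \<otimes> v\<^bsub>j+N\<^esub>\<close> and \<open>v\<^bsub>j+N\<^esub> \<otimes> v\<^sub>0\<close> the action of \<open>F\<close> has a single contribution, so the
  ratio of these coefficients is known for all \<open>j\<close>. It depends on \<open>j\<close>, which is what makes the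
  relations from different summands independent.\<close>

lemma desc_extremal:
  assumes "j + N \<le> m"
  shows "coeff2 (desc m j N) 0 (j + N) \<noteq> 0"
    and "coeff2 (desc m j N) (j + N) 0 = (-1) ^ j * qq powi (2 * int j * int m - int j * (int j - 1) - (int j + int N) * int m) * coeff2 (desc m j N) 0 (j + N)"
proof -
  have "coeff2 (desc m j N) 0 (j + N) \<noteq> 0 \<and>
    coeff2 (desc m j N) (j + N) 0 = (-1) ^ j * qq powi (2 * int j * int m - int j * (int j - 1) - (int j + int N) * int m) * coeff2 (desc m j N) 0 (j + N)"
    using assms
  proof (induction N)
    case 0
    thus ?case by (simp add: coeff2_hw hw_coeff_last algebra_simps)
  next
    case (Suc N)
    hence IH: "coeff2 (desc m j N) 0 (j + N) \<noteq> 0"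
      "coeff2 (desc m j N) (j + N) 0 = (-1) ^ j * qq powi (2 * int j * int m - int j * (int j - 1) - (int j + int N) * int m) * coeff2 (desc m j N) 0 (j + N)"
      by auto
    have "coeff2 (desc m j (Suc N)) 0 (j + Suc N) = qi (int (j + Suc N)) * coeff2 (desc m j N) 0 (j + N)"
      using Suc.prems by (simp add: coeff2_F desc_T2 del: of_nat_add)
    moreover have "coeff2 (desc m j (Suc N)) (j + Suc N) 0 = qi (int (j + Suc N)) * qq powi (- int m) * coeff2 (desc m j N) (j + N) 0"
      using Suc.prems by (simp add: coeff2_F desc_T2 del: of_nat_add)
    moreover have "qq powi (2 * int j * int m - int j * (int j - 1) - (int j + int (Suc N)) * int m)
       = qq powi (- int m) * qq powi (2 * int j * int m - int j * (int j - 1) - (int j + int N) * int m)"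
      by (simp add: qq_powi_mult algebra_simps)
    moreover have "qi (int (j + Suc N)) \<noteq> 0" by (subst qi_eq_0_iff) simp
    ultimately show ?case using IH by simp
  qed
  thus "coeff2 (desc m j N) 0 (j + N) \<noteq> 0"
    and "coeff2 (desc m j N) (j + N) 0 = (-1) ^ j * qq powi (2 * int j * int m - int j * (int j - 1) - (int j + int N) * int m) * coeff2 (desc m j N) 0 (j + N)"
    by auto
qed

text \<open>Up to a scalar in each weight, these are the coefficients of the tensors in the summand
  \<open>V\<^bsub>2m-2\<^esub>\<close>, which form a quantum analogue of the Wronskian of two polynomials of degree \<open>m\<close>.\<close>

definition wronski :: "nat \<Rightarrow> nat \<Rightarrow> nat \<Rightarrow> kq" where
  "wronski m i k = qq powi (int i * int k - int i * int m - int i - int k) *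
     (qq powi (2 * int i + 2 * int k) + qq powi (2 * int m) - qq powi (2 * int i) - qq powi (2 * int i + 2 * int m)) / qd"

text \<open>The recursion by which \<open>F\<close> acts on the coefficients.\<close>

lemma wronski_rec:
  "(if i = 0 then 0 else qi (int i) * qq powi (2 * int k - int m) * wronski m (i - 1) k)
     + (if k = 0 then 0 else qi (int k) * wronski m i (k - 1)) = qi (int i + int k - 1) * wronski m i k"
proof -
  define a b L X where "a = qq powi int i" and "b = qq powi int k" and "L = qq powi int m"
    and "X = qq powi (int i * int k) / qq powi (int i * int m)"
  have nz: "a \<noteq> 0" "b \<noteq> 0" "L \<noteq> 0" "X \<noteq> 0" "qq \<noteq> 0" "qd \<noteq> 0" by (simp_all add: a_def b_def L_def X_def)
  have pw: "qq powi (x + y) = qq powi x * qq powi y" "qq powi (x - y) = qq powi x / qq powi y"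
    "qq powi (2 * x) = (qq powi x)^2" "qq powi (- x) = 1 / qq powi x" for x y
    using power_int_add[of qq x x]
    by (simp_all add: power_int_add power_int_diff power2_eq_square power_int_minus divide_inverse)
  note fold = a_def[symmetric] b_def[symmetric] L_def[symmetric] X_def[symmetric] power_int_1_right
  have W: "wronski m i k = X / a / b * (a^2 * b^2 + L^2 - a^2 - a^2 * L^2) / qd"
    by (simp only: wronski_def pw fold)
  have qis: "qi (int i) = (a - 1 / a) / qd" "qi (int k) = (b - 1 / b) / qd"
    "qi (int i + int k - 1) = (a * b / qq - 1 / (a * b / qq)) / qd"
    by (simp_all only: qi_def pw fold)
  have 1: "(if i = 0 then 0 else qi (int i) * qq powi (2 * int k - int m) * wronski m (i - 1) k)
     = (a - 1 / a) / qd * (b^2 / L) * (X / b * L * qq / (a * b) * (a^2 * b^2 / qq^2 + L^2 - a^2 / qq^2 - a^2 / qq^2 * L^2) / qd)"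
  proof (cases "i = 0")
    case True
    thus ?thesis by (simp add: a_def)
  next
    case False
    hence e: "int (i - 1) = int i - 1" by simp
    have "wronski m (i - 1) k = qq powi (int i * int k) / b / (qq powi (int i * int m) / L) / (a / qq) / b
        * ((a / qq)^2 * b^2 + L^2 - (a / qq)^2 - (a / qq)^2 * L^2) / qd"
      by (simp only: wronski_def e left_diff_distrib mult_1_left pw fold)
    also have "\<dots> = X / b * L * qq / (a * b) * (a^2 * b^2 / qq^2 + L^2 - a^2 / qq^2 - a^2 / qq^2 * L^2) / qd"
      by (simp add: X_def power_divide)
    finally show ?thesis using False by (simp only: qis pw fold if_False)
  qed
  have 2: "(if k = 0 then 0 else qi (int k) * wronski m i (k - 1))
     = (b - 1 / b) / qd * (X / a * qq / (a * b) * (a^2 * b^2 / qq^2 + L^2 - a^2 - a^2 * L^2) / qd)"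
  proof (cases "k = 0")
    case True
    thus ?thesis by (simp add: b_def)
  next
    case False
    hence e: "int (k - 1) = int k - 1" by simp
    have "wronski m i (k - 1) = qq powi (int i * int k) / a / qq powi (int i * int m) / a / (b / qq)
        * (a^2 * (b / qq)^2 + L^2 - a^2 - a^2 * L^2) / qd"
      by (simp only: wronski_def e right_diff_distrib[of "int i" "int k" 1] right_diff_distrib[of 2 "int k" 1] distrib_left mult_1_right[of "int i"] power_divide pw fold)
    also have "\<dots> = X / a * qq / (a * b) * (a^2 * b^2 / qq^2 + L^2 - a^2 - a^2 * L^2) / qd"
      by (simp add: X_def power_divide)
    finally show ?thesis using False by (simp only: qis if_False)
  qed
  \<comment> \<open>After extraction of the common factor \<open>K\<close> all terms are polynomials in the squares of \<open>a\<close>, \<open>b\<close>, \<open>q\<close>, \<open>L\<close>.\<close>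
  define A B p Q K where "A = a^2" and "B = b^2" and "p = qq^2" and "Q = L^2"
    and "K = X / (qd^2 * A * B * qq)"
  note defs = K_def A_def B_def p_def Q_def
  have "(a - 1 / a) / qd * (b^2 / L) * (X / b * L * qq / (a * b) * (Y / qq^2) / qd) = K * ((A - 1) * B * Y)" for Y
    using nz by (simp add: defs divide_simps power2_eq_square)
  from this[of "A * B + p * Q - A - A * Q"]
  have t1: "(a - 1 / a) / qd * (b^2 / L) * (X / b * L * qq / (a * b) * (a^2 * b^2 / qq^2 + L^2 - a^2 / qq^2 - a^2 / qq^2 * L^2) / qd)
     = K * ((A - 1) * B * (A * B + p * Q - A - A * Q))"
    by (simp add: A_def B_def p_def Q_def add_divide_distrib diff_divide_distrib)
  have "(b - 1 / b) / qd * (X / a * qq / (a * b) * (Y / qq^2) / qd) = K * ((B - 1) * Y)" for Y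
    using nz by (simp add: defs divide_simps power2_eq_square)
  from this[of "A * B + p * Q - p * A - p * A * Q"]
  have t2: "(b - 1 / b) / qd * (X / a * qq / (a * b) * (a^2 * b^2 / qq^2 + L^2 - a^2 - a^2 * L^2) / qd)
     = K * ((B - 1) * (A * B + p * Q - p * A - p * A * Q))"
    using nz by (simp add: A_def B_def p_def Q_def add_divide_distrib diff_divide_distrib)
  have "(a * b / qq - 1 / (a * b / qq)) / qd * (X / a / b * Y / qd) = K * ((A * B - p) * Y)" for Y
    using nz by (simp add: defs divide_simps power2_eq_square)
  hence t3: "(a * b / qq - 1 / (a * b / qq)) / qd * (X / a / b * (a^2 * b^2 + L^2 - a^2 - a^2 * L^2) / qd)
     = K * ((A * B - p) * (A * B + Q - A - A * Q))"
    by (simp add: A_def B_def Q_def)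
  show ?thesis unfolding 1 2 unfolding t1 t2 W qis(3) unfolding t3 by (simp add: algebra_simps)
qed

lemma desc_1:
  assumes "m \<ge> 1"
  shows "\<exists>c. c \<noteq> 0 \<and> (\<forall>i k. i \<le> m \<longrightarrow> k \<le> m \<longrightarrow> i + k = Suc N \<longrightarrow> coeff2 (desc m 1 N) i k = c * wronski m i k)"
proof (induction N)
  case 0
  have "coeff2 (hw m 1) i k = 1 * wronski m i k" if "i + k = Suc 0" for i k
  proof -
    from that consider "i = 0" "k = 1" | "i = 1" "k = 0" by linarith
    thus ?thesis
    proof cases
      case 1
      have "qq powi (- 1) * (qq powi 2 - 1) = qd"
        by (simp add: qd_def power_int_minus field_simps power2_eq_square)
      with 1 show ?thesis using assms by (simp add: coeff2_hw wronski_def)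
    next
      case 2
      have e: "qq powi (- int m - 1) * (qq powi (2 * int m) - qq powi (2 + 2 * int m)) = - (qq powi int m * qd)"
        by (simp add: qd_def right_diff_distrib qq_powi_mult) (simp add: power_int_diff power_int_add field_simps power_int_minus)
      show ?thesis using 2 assms e by (simp add: coeff2_hw wronski_def hw_coeff_Suc)
    qed
  qed
  thus ?case using assms by (intro exI[of _ 1]) simp
next
  case (Suc N)
  then obtain c where c: "c \<noteq> 0" "\<And>i k. i \<le> m \<Longrightarrow> k \<le> m \<Longrightarrow> i + k = Suc N \<Longrightarrow> coeff2 (desc m 1 N) i k = c * wronski m i k"
    by blast
  have "coeff2 (desc m 1 (Suc N)) i k = (c * qi (int N + 1)) * wronski m i k"
    if ik: "i \<le> m" "k \<le> m" "i + k = Suc (Suc N)" for i k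
  proof -
    have "coeff2 (desc m 1 (Suc N)) i k = (if i = 0 then 0 else qi (int i) * qq powi (2 * int k - int m) * (c * wronski m (i - 1) k))
     + (if k = 0 then 0 else qi (int k) * (c * wronski m i (k - 1)))"
      using ik c(2)[of "i - 1" k] c(2)[of i "k - 1"] unfolding desc_simps
      by (subst coeff2_F[OF desc_T2]) (auto simp del: One_nat_def)
    also have "\<dots> = c * ((if i = 0 then 0 else qi (int i) * qq powi (2 * int k - int m) * wronski m (i - 1) k)
     + (if k = 0 then 0 else qi (int k) * wronski m i (k - 1)))"
      by (simp add: algebra_simps)
    also have "int i + int k - 1 = int N + 1" using ik by linarith
    hence "qi (int i + int k - 1) = qi (int N + 1)" by (simp only:)
    hence "c * ((if i = 0 then 0 else qi (int i) * qq powi (2 * int k - int m) * wronski m (i - 1) k)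
     + (if k = 0 then 0 else qi (int k) * wronski m i (k - 1))) = (c * qi (int N + 1)) * wronski m i k"
      using wronski_rec[of i k m] by simp
    finally show ?thesis .
  qed
  moreover have "c * qi (int N + 1) \<noteq> 0" using c by simp
  ultimately show ?case by blast
qed

text \<open>The numerator is a signed sum of four powers of \<open>q\<close>, two of each sign, so it only vanishes if
  these cancel in pairs.\<close>

lemma wronski_eq_0:
  assumes "wronski m i k = 0"
  shows "(i = 0 \<and> k = 0) \<or> (i = m \<and> k = m)"
proof -
  from assms have "qq powi (2 * int i + 2 * int k) + qq powi (2 * int m) = qq powi (2 * int i) + qq powi (2 * int i + 2 * int m)"
    by (simp add: wronski_def diff_diff_eq)
  from qq_powi_sum_eq[OF this] show ?thesis by auto
qed

section \<open>Chains of linear forms that annihilate the exterior square\<close>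

text \<open>A linear form on \<open>V\<^sub>l\<close> is given by its values on the basis; \<open>ev2 u w\<close> is the bilinear form \<open>u \<otimes>
  w\<close>.\<close>

definition ev2 :: "(nat \<Rightarrow> kq) \<Rightarrow> (nat \<Rightarrow> kq) \<Rightarrow> tens \<Rightarrow> kq" where
  "ev2 u w = wsum (\<lambda>x. u (x ! 0) * w (x ! 1))"

definition kills :: "nat \<Rightarrow> (nat \<Rightarrow> kq) \<Rightarrow> (nat \<Rightarrow> kq) \<Rightarrow> bool" where
  "kills l u w \<longleftrightarrow> (\<forall>h\<in>ext_square l. ev2 u w h = 0)"

definition chain :: "nat \<Rightarrow> (nat \<Rightarrow> nat \<Rightarrow> kq) \<Rightarrow> bool" where
  "chain l P \<longleftrightarrow> (\<forall>s. kills l (P s) (P (Suc s)))"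

lemmas ev2_simps = wsum_linear[of "\<lambda>x. u (x ! 0) * w (x ! 1)" for u w, folded ev2_def]

lemma ev2_0 [simp]: "ev2 u w 0 = 0" by (simp add: ev2_def)

lemma ev2_ee: "ev2 u w (ee l i j) = (if 0 \<le> i \<and> i \<le> int l \<and> 0 \<le> j \<and> j \<le> int l then u (nat i) * w (nat j) else 0)"
  by (auto simp: ev2_def ee_out ee_mon)

lemma ev2_coeff2:
  assumes "t \<in> tw l 2 n" "n \<le> l"
  shows "ev2 u w t = (\<Sum>i\<le>n. coeff2 t i (n - i) * (u i * w (n - i)))"
  using assms(1)
proof (induction rule: tw2_induct)
  case (ee a b)
  have "(\<Sum>i\<le>n. coeff2 (ee l a b) i (n - i) * (u i * w (n - i)))
      = (\<Sum>i\<le>n. if i = nat a then u (nat a) * w (nat b) else 0)"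
    by (rule sum.cong) (use assms ee in \<open>auto simp: coeff2_ee nat_diff_distrib\<close>)
  with ee assms show ?case by (simp add: ev2_ee nat_le_iff)
qed (simp_all add: ev2_simps coeff2_lin sum.distrib distrib_right sum_distrib_left mult.assoc)

lemma ev2_single:
  assumes "t \<in> tw l 2 (m + m')" "m \<le> l" "m' \<le> l"
    and "\<And>i k. i + k = m + m' \<Longrightarrow> i \<noteq> m \<Longrightarrow> u i * w k = 0"
  shows "ev2 u w t = coeff2 t m m' * (u m * w m')"
  using assms(1)
proof (induction rule: tw2_induct)
  case (ee a b)
  have "nat a + nat b = m + m'" using ee by simp
  with assms(4)[of "nat a" "nat b"] ee assms show ?case
    by (cases "nat a = m") (auto simp: ev2_ee coeff2_ee)
qed (simp_all add: ev2_simps coeff2_lin distrib_right mult.assoc)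

text \<open>If only one term of a quantum Wronskian survives on \<open>u \<otimes> w\<close>, its coefficient has to vanish,
  which happens at the two extremal weights only. Applied to the lowest and to the highest indices
  in the supports of \<open>u\<close> and \<open>w\<close>, this shows that the supports begin and end together.\<close>

lemma kills_corner:
  assumes "kills l u w" "l \<ge> 1" "m \<le> l" "m' \<le> l" "u m \<noteq> 0" "w m' \<noteq> 0"
    and "\<And>i k. i + k = m + m' \<Longrightarrow> i \<noteq> m \<Longrightarrow> u i * w k = 0"
  shows "(m = 0 \<and> m' = 0) \<or> (m = l \<and> m' = l)"
proof (cases "m + m'")
  case (Suc N)
  obtain c where c: "c \<noteq> 0" "\<And>i k. i \<le> l \<Longrightarrow> k \<le> l \<Longrightarrow> i + k = Suc N \<Longrightarrow> coeff2 (desc l 1 N) i k = c * wronski l i k"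
    using desc_1[OF assms(2)] by blast
  have "desc l 1 N \<in> tw l 2 (m + m')" using desc_tw[of l 1 N] Suc by simp
  hence "ev2 u w (desc l 1 N) = coeff2 (desc l 1 N) m m' * (u m * w m')"
    using assms by (intro ev2_single) auto
  moreover have "ev2 u w (desc l 1 N) = 0"
    using assms(1,2) desc_ext_square[of 1 l N] by (simp add: kills_def)
  ultimately have "wronski l m m' = 0" using c assms Suc by simp
  thus ?thesis by (rule wronski_eq_0)
qed simp

lemma kills_low:
  assumes "kills l u w" "l \<ge> 1" "\<exists>i\<le>l. u i \<noteq> 0" "\<exists>i\<le>l. w i \<noteq> 0"
  shows "(u 0 \<noteq> 0 \<and> w 0 \<noteq> 0) \<or> (\<forall>i<l. u i = 0 \<and> w i = 0)"
proof -
  define m where "m = (LEAST i. u i \<noteq> 0)"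
  define m' where "m' = (LEAST i. w i \<noteq> 0)"
  have "u m \<noteq> 0" "w m' \<noteq> 0"
    unfolding m_def m'_def using assms(3,4) by (metis (mono_tags, lifting) LeastI_ex)+
  moreover have le: "m \<le> l" "m' \<le> l"
    unfolding m_def m'_def using assms(3,4) by (auto intro: Least_le order_trans)
  moreover have z: "i < m \<Longrightarrow> u i = 0" "i < m' \<Longrightarrow> w i = 0" for i
    unfolding m_def m'_def by (auto dest: not_less_Least)
  have "u i * w k = 0" if "i + k = m + m'" "i \<noteq> m" for i k
    using z[of i] z(2)[of k] that by (cases "i < m") auto
  ultimately have "(m = 0 \<and> m' = 0) \<or> (m = l \<and> m' = l)"
    using kills_corner[OF assms(1,2)] by blast
  thus ?thesis using z \<open>u m \<noteq> 0\<close> \<open>w m' \<noteq> 0\<close> by auto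
qed

lemma kills_high:
  assumes "kills l u w" "l \<ge> 1" "\<exists>i\<le>l. u i \<noteq> 0" "\<exists>i\<le>l. w i \<noteq> 0"
    and out: "\<And>i. i > l \<Longrightarrow> u i = 0 \<and> w i = 0"
  shows "(u l \<noteq> 0 \<and> w l \<noteq> 0) \<or> (\<forall>i>0. u i = 0 \<and> w i = 0)"
proof -
  define m where "m = Max {i. u i \<noteq> 0}"
  define m' where "m' = Max {i. w i \<noteq> 0}"
  have sub: "{i. u i \<noteq> 0} \<subseteq> {..l}" "{i. w i \<noteq> 0} \<subseteq> {..l}" using out by (auto simp: not_le[symmetric])
  hence fin: "finite {i. u i \<noteq> 0}" "finite {i. w i \<noteq> 0}" by (auto intro: finite_subset)
  have "m \<in> {i. u i \<noteq> 0}" "m' \<in> {i. w i \<noteq> 0}"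
    unfolding m_def m'_def by (intro Max_in fin; use assms(3,4) in auto)+
  hence nz: "u m \<noteq> 0" "w m' \<noteq> 0" by auto
  moreover have le: "m \<le> l" "m' \<le> l" using nz out not_le by blast+
  moreover have z: "i > m \<Longrightarrow> u i = 0" "i > m' \<Longrightarrow> w i = 0" for i
    unfolding m_def m'_def using Max_ge[OF fin(1), of i] Max_ge[OF fin(2), of i] by force+
  have "u i * w k = 0" if "i + k = m + m'" "i \<noteq> m" for i k
    using z[of i] z(2)[of k] that by (cases "i > m") auto
  ultimately have "(m = 0 \<and> m' = 0) \<or> (m = l \<and> m' = l)"
    using kills_corner[OF assms(1,2)] by blast
  thus ?thesis using z nz by auto
qed

subsection \<open>Normalized chains\<close>

text \<open>The exponent in the ratio of the coefficients at \<open>v\<^sub>n \<otimes> v\<^sub>0\<close> and \<open>v\<^sub>0 \<otimes> v\<^sub>n\<close> of the relations in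
  the summand \<open>j\<close>, up to the sign \<open>-1\<close>.\<close>

definition kexp :: "nat \<Rightarrow> nat \<Rightarrow> nat \<Rightarrow> int" where
  "kexp l j n = 2 * int j * int l - int j * (int j - 1) - int n * int l"

lemma kills_eq:
  assumes "kills l u w" "u 0 = 1" "w 0 = 1" "odd j" "j \<le> n" "n \<le> l"
  shows "coeff2 (desc l j (n - j)) 0 n * (w n - qq powi (kexp l j n) * u n)
     + (\<Sum>i\<in>{1..<n}. coeff2 (desc l j (n - j)) i (n - i) * (u i * w (n - i))) = 0"
proof -
  let ?t = "desc l j (n - j)"
  have n: "n \<noteq> 0" using assms(4,5) by (cases n) auto
  have T: "?t \<in> tw l 2 n" using desc_tw[of l j "n - j"] assms by simp
  have "0 = ev2 u w ?t"
    using assms(1) desc_ext_square[of j l "n - j"] assms by (simp add: kills_def)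
  also have "\<dots> = (\<Sum>i\<le>n. coeff2 ?t i (n - i) * (u i * w (n - i)))"
    by (rule ev2_coeff2[OF T assms(6)])
  also have "{..n} = {0} \<union> {n} \<union> {1..<n}" by auto
  also have "(\<Sum>i\<in>\<dots>. coeff2 ?t i (n - i) * (u i * w (n - i)))
     = coeff2 ?t 0 n * w n + coeff2 ?t n 0 * u n + (\<Sum>i\<in>{1..<n}. coeff2 ?t i (n - i) * (u i * w (n - i)))"
    using assms(2,3) n by (subst sum.union_disjoint; simp)+
  also have "coeff2 ?t n 0 = - (qq powi (kexp l j n)) * coeff2 ?t 0 n"
    using desc_extremal(2)[of j "n - j" l] assms by (simp add: kexp_def)
  finally show ?thesis by (simp add: algebra_simps)
qed

lemma desc_corner: "j \<le> n \<Longrightarrow> n \<le> l \<Longrightarrow> coeff2 (desc l j (n - j)) 0 n \<noteq> 0"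
  using desc_extremal(1)[of j "n - j" l] by simp

text \<open>Two chains that agree below index \<open>n\<close> satisfy relations of weight \<open>2l - 2n\<close> with the same mixed
  terms, so these cancel in the difference.\<close>

lemma kills_diff:
  assumes "kills l u w" "u 0 = 1" "w 0 = 1" "kills l u' w'" "u' 0 = 1" "w' 0 = 1"
    and "odd j" "j \<le> n" "n \<le> l"
    and "\<And>i. i < n \<Longrightarrow> u i = u' i \<and> w i = w' i"
  shows "w n - w' n = qq powi (kexp l j n) * (u n - u' n)"
proof -
  have "(\<Sum>i\<in>{1..<n}. coeff2 (desc l j (n - j)) i (n - i) * (u i * w (n - i)))
      = (\<Sum>i\<in>{1..<n}. coeff2 (desc l j (n - j)) i (n - i) * (u' i * w' (n - i)))"
    by (rule sum.cong) (use assms(10) in auto)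
  hence "coeff2 (desc l j (n - j)) 0 n * (w n - qq powi (kexp l j n) * u n)
      = coeff2 (desc l j (n - j)) 0 n * (w' n - qq powi (kexp l j n) * u' n)"
    using trans[OF kills_eq[OF assms(1-3,7-9)] kills_eq[OF assms(4-9), symmetric]] by simp
  with desc_corner[of j n l] assms(8,9) have "w n - qq powi (kexp l j n) * u n = w' n - qq powi (kexp l j n) * u' n"
    by simp
  thus ?thesis by (simp add: algebra_simps)
qed

lemma kexp_neq: "qq powi (kexp l 1 n) \<noteq> qq powi (kexp l 3 n)"
proof -
  have "kexp l 1 n \<noteq> kexp l 3 n"
  proof
    assume "kexp l 1 n = kexp l 3 n"
    hence "4 * int l = 6" by (simp add: kexp_def)
    thus False by presburger
  qed
  thus ?thesis by simp
qed

text \<open>From index three on there are the two relations with \<open>j = 1\<close> and \<open>j = 3\<close>, whose ratios differ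
  because \<open>4l \<noteq> 6\<close>. They determine the coordinate of the first form.\<close>

lemma kills_diff_eq:
  assumes "kills l u w" "u 0 = 1" "w 0 = 1" "kills l u' w'" "u' 0 = 1" "w' 0 = 1"
    and "3 \<le> n" "n \<le> l"
    and "\<And>i. i < n \<Longrightarrow> u i = u' i \<and> w i = w' i"
  shows "u n = u' n"
proof -
  have "w n - w' n = qq powi (kexp l j n) * (u n - u' n)" if "odd j" "j \<le> 3" for j
    by (rule kills_diff[OF assms(1-6) that(1) _ assms(8,9)]) (use that assms(7) in auto)
  from trans[OF this[of 1, symmetric] this[of 3]]
  have "qq powi (kexp l 1 n) * (u n - u' n) = qq powi (kexp l 3 n) * (u n - u' n)"
    by simp
  with kexp_neq[of l n] show ?thesis by (metis mult_cancel_right eq_iff_diff_eq_0)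
qed

text \<open>At the indices one and two only the relation with \<open>j = 1\<close> is available; it expresses the
  coordinate of each form by that of the preceding one.\<close>

lemma chain_unique:
  assumes P: "chain l P" "\<And>s. P s 0 = 1" and Q: "chain l Q" "\<And>s. Q s 0 = 1"
    and "P 0 1 = Q 0 1" "2 \<le> l \<Longrightarrow> P 0 2 = Q 0 2" "i \<le> l"
  shows "P s i = Q s i"
  using assms(7)
proof (induction i arbitrary: s rule: less_induct)
  case (less n)
  have k: "kills l (P s) (P (Suc s))" "kills l (Q s) (Q (Suc s))" for s
    using P Q by (auto simp: chain_def)
  have IH: "P s i = Q s i \<and> P (Suc s) i = Q (Suc s) i" if "i < n" for i s
    using less.IH[OF that] less.prems that by simp
  consider "n = 0" | "n \<in> {1, 2}" | "n \<ge> 3" by fastforce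
  thus ?case
  proof cases
    case 1
    thus ?thesis by (simp add: P(2) Q(2))
  next
    case 2
    show ?thesis
    proof (induction s)
      case 0
      show ?case using 2 assms(5,6) less.prems by blast
    next
      case (Suc s)
      have "P (Suc s) n - Q (Suc s) n = qq powi (kexp l 1 n) * (P s n - Q s n)"
        by (rule kills_diff[OF k(1) P(2) P(2) k(2) Q(2) Q(2) _ _ less.prems IH]) (use 2 in auto)
      with Suc show ?case by simp
    qed
  next
    case 3
    show ?thesis by (rule kills_diff_eq[OF k(1) P(2) P(2) k(2) Q(2) Q(2) 3 less.prems IH])
  qed
qed

lemma kills_1:
  assumes "kills l u w" "u 0 = 1" "w 0 = 1" "l \<ge> 1"
  shows "w 1 = qq powi int l * u 1"
  using kills_eq[OF assms(1-3), of 1 1] desc_corner[of 1 1 l] assms by (simp add: kexp_def)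

text \<open>In a relation of weight \<open>2l - 2n\<close> with \<open>n\<close> odd every mixed term contains one coordinate of odd
  index, so by induction the two relations with \<open>j = 1\<close> and \<open>j = 3\<close> become homogeneous.\<close>

lemma chain_odd_zero:
  assumes P: "chain l P" "\<And>s. P s 0 = 1" "P 0 1 = 0" "odd i" "i \<le> l"
  shows "P s i = 0"
  using assms(4,5)
proof (induction i arbitrary: s rule: less_induct)
  case (less n)
  have k: "kills l (P s) (P (Suc s))" for s using P by (auto simp: chain_def)
  show ?case
  proof (cases "n = 1")
    case True
    have "P s 1 = 0"
    proof (induction s)
      case (Suc s)
      thus ?case using kills_1[OF k[of s]] P less True by simp
    qed (rule P(3))
    with True show ?thesis by simp
  next
    case False
    hence n: "3 \<le> n" using less.prems by presburger
    have z: "P s i * P (Suc s) (n - i) = 0" if "i \<in> {1..<n}" for i s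
    proof (cases "odd i")
      case True
      thus ?thesis using less that by simp
    next
      case False
      hence "odd (n - i)" "n - i < n" using less.prems that by auto
      thus ?thesis using less by simp
    qed
    have "P (Suc s) n = qq powi (kexp l j n) * P s n" if "odd j" "j \<le> n" for j
      using kills_eq[OF k[of s] P(2) P(2) that less.prems(2)] desc_corner[OF that(2) less.prems(2)] z
      by simp
    from this[of 1] this[of 3] show ?thesis using n kexp_neq[of l n] by auto
  qed
qed

subsection \<open>The second coordinate of a normalized chain\<close>

lemma qq_power_eq_iff [simp]: "qq ^ a = qq ^ b \<longleftrightarrow> a = b"
  using qq_powi_eq_iff[of "int a" "int b"] by (simp only: power_int_of_nat of_nat_eq_iff)

lemma qq_power_eq_1_iff [simp]: "qq ^ a = 1 \<longleftrightarrow> a = 0"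
  using qq_power_eq_iff[of a 0] by (simp del: qq_power_eq_iff)

text \<open>For two chains that agree at index one, the relations of weight \<open>2l - 6\<close> at two consecutive
  places yield a scalar multiple of \<open>P\<^sub>0(v\<^sub>1)\<close> times the difference at index two that vanishes. The
  scalar is computed here, with \<open>L = q\<^sup>l\<close>; it is nonzero because of \<open>4l \<noteq> 6\<close>.\<close>

lemma obstruction_scalar:
  fixes q L :: "'a :: field"
  assumes "q \<noteq> 0" "L \<noteq> 0" "L^2 \<noteq> 1" "q^6 \<noteq> 1"
    and "R = (L / q^2 - q^2 / L) / (L - 1 / L)"
    and "K = ((q^6 + L^2 - q^2 - q^2 * L^2) / (q * L) + L * ((q^6 + L^2 - q^4 - q^4 * L^2) / (q * L^2))) / ((q^6 - 1) / q^3)"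
  shows "(L - 1 / L) * (L * (L^2 / q^2 * R) - L * R) + (L^3 / q^6 - L) * K
     = (q^2 - 1) * (q^4 - 1) * (L^4 - q^6) / (q^4 * (q^6 - 1))"
proof -
  have LL: "L - 1 / L \<noteq> 0" using assms(2,3) by (simp add: divide_simps power2_eq_square)
  have q6: "q^6 - 1 \<noteq> 0" using assms(4) by simp
  have K: "K = q^2 / L * (2 * q^6 + 2 * L^2 - q^2 - q^4 - q^2 * L^2 - q^4 * L^2) / (q^6 - 1)"
    using assms(1,2) q6 unfolding assms(6) by (simp add: divide_simps) (simp add: algebra_simps eval_nat_numeral)
  have "(L - 1 / L) * (L * (L^2 / q^2 * R) - L * R) = ((L - 1 / L) * R) * (L * (L^2 / q^2 - 1))"
    by (simp add: algebra_simps)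
  also have "(L - 1 / L) * R = L / q^2 - q^2 / L"
    using LL by (simp add: assms(5))
  finally have 1: "(L - 1 / L) * (L * (L^2 / q^2 * R) - L * R) = (L / q^2 - q^2 / L) * (L * (L^2 / q^2 - 1))" .
  show ?thesis unfolding 1 K using assms(1,2) q6
    by (simp add: divide_simps) (simp add: algebra_simps eval_nat_numeral)
qed

lemma subtract_relations:
  fixes y :: "'a :: field"
  assumes "y * (w3 - r * u3) + (a * (u1 * w2) + b * (u2 * w1)) = 0"
    and "y * (w3' - r * u3') + (a * (u1 * w2') + b * (u2' * w1)) = 0"
    and "u2 - u2' = d" "w2 - w2' = d" "w1 = L * u1"
  shows "y * ((w3 - w3') - r * (u3 - u3')) + (a + L * b) * (u1 * d) = 0"
proof -
  have e: "u2 = u2' + d" "w2 = w2' + d" using assms(3,4) by (simp_all add: algebra_simps)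
  have "y * ((w3 - w3') - r * (u3 - u3')) + (a + L * b) * (u1 * d)
      = (y * (w3 - r * u3) + (a * (u1 * w2) + b * (u2 * w1))) - (y * (w3' - r * u3') + (a * (u1 * w2') + b * (u2' * w1)))"
    unfolding e assms(5) by (simp add: algebra_simps)
  also have "\<dots> = 0" unfolding assms(1,2) by simp
  finally show ?thesis .
qed

text \<open>Let \<open>d\<close> be the difference of the two chains at index two, which is the same at all places,
  and \<open>e\<close> the difference at index three. For \<open>l \<ge> 3\<close> the two relations with \<open>j = 1\<close> and \<open>j = 3\<close> determine
  \<open>e\<close> at two consecutive places from \<open>d\<close>, and also relate the two values of \<open>e\<close>; these conditions are
  incompatible unless \<open>P\<^sub>0(v\<^sub>1) d = 0\<close>. For \<open>l = 2\<close> there is no coordinate of index three, and the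
  relation with \<open>j = 1\<close> at one place suffices.\<close>

lemma chain_second_coordinate:
  assumes P: "chain l P" "\<And>s. P s 0 = 1" and Q: "chain l Q" "\<And>s. Q s 0 = 1"
    and "P 0 1 = Q 0 1" "P 0 1 \<noteq> 0" "l \<ge> 2"
  shows "P 0 2 = Q 0 2"
proof -
  have k: "kills l (P s) (P (Suc s))" "kills l (Q s) (Q (Suc s))" for s
    using P Q by (auto simp: chain_def)
  define L where "L = qq powi int l"
  have p1: "P (Suc s) 1 = L * P s 1" "Q (Suc s) 1 = L * Q s 1" for s
    unfolding L_def using kills_1[OF k(1)] kills_1[OF k(2)] P Q assms by auto
  have e1: "P s 1 = Q s 1" for s
    by (induction s) (simp_all add: p1[unfolded One_nat_def] assms[unfolded One_nat_def])
  define d where "d = P 0 2 - Q 0 2"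
  have d: "P s 2 - Q s 2 = d" for s
  proof (induction s)
    case (Suc s)
    have "P s i = Q s i \<and> P (Suc s) i = Q (Suc s) i" if "i < 2" for i
      using that e1[of s] e1[of "Suc s"] P Q by (auto simp: less_2_cases_iff)
    from kills_diff[OF k(1) P(2) P(2) k(2) Q(2) Q(2) _ _ assms(7) this, of 1]
    show ?case using Suc by (simp add: kexp_def)
  qed (simp add: d_def)
  show ?thesis
  proof (cases "l = 2")
    case True
    obtain c where c: "c \<noteq> 0" "\<And>i k. i \<le> l \<Longrightarrow> k \<le> l \<Longrightarrow> i + k = Suc 2 \<Longrightarrow> coeff2 (desc l 1 2) i k = c * wronski l i k"
      using desc_1[of l 2] assms by auto
    have T: "desc l 1 2 \<in> tw l 2 3" using desc_tw[of l 1 2] by (simp only: one_plus_numeral add_num_simps)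
    have ev: "ev2 u w (desc l 1 2) = c * (wronski 2 1 2 * (u 1 * w 2) + wronski 2 2 1 * (u 2 * w 1))" for u w
    proof -
      have "ev2 u w t = coeff2 t 1 2 * (u 1 * w 2) + coeff2 t 2 1 * (u 2 * w 1)" if "t \<in> tw 2 2 3" for t
        using that
      proof (induction rule: tw2_induct)
        case (ee i j)
        hence "(i = 1 \<and> j = 2) \<or> (i = 2 \<and> j = 1)" by auto
        thus ?case by (auto simp: ev2_ee coeff2_ee)
      qed (simp_all add: ev2_simps coeff2_lin algebra_simps)
      with T True c show ?thesis by (simp add: algebra_simps)
    qed
    have z: "wronski 2 1 2 * (u 1 * w 2) + wronski 2 2 1 * (u 2 * w 1) = 0" if "kills l u w" for u w
      using that desc_ext_square[of 1 l 2] ev[of u w] c assms by (simp add: kills_def)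
    have "(wronski 2 1 2 + qq^2 * wronski 2 2 1) * P 0 1 * d = 0"
    proof -
      have p: "P 1 1 = qq^2 * P 0 1" "Q 1 1 = qq^2 * P 0 1" "Q 0 1 = P 0 1" "P 0 2 - Q 0 2 = d" "P 1 2 - Q 1 2 = d"
        using p1[of 0] e1[of 0] d[of 0] d[of 1] True by (simp_all add: L_def)
      have "wronski 2 1 2 * (P 0 1 * P 1 2) + wronski 2 2 1 * (P 0 2 * P 1 1) = 0"
        "wronski 2 1 2 * (Q 0 1 * Q 1 2) + wronski 2 2 1 * (Q 0 2 * Q 1 1) = 0"
        using z[OF k(1)[of 0]] z[OF k(2)[of 0]] by simp_all
      moreover have "(wronski 2 1 2 + qq^2 * wronski 2 2 1) * P 0 1 * d
        = (wronski 2 1 2 * (P 0 1 * P 1 2) + wronski 2 2 1 * (P 0 2 * P 1 1))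
          - (wronski 2 1 2 * (Q 0 1 * Q 1 2) + wronski 2 2 1 * (Q 0 2 * Q 1 1))"
      proof -
        have "P 1 2 = Q 1 2 + d" "P 0 2 = Q 0 2 + d" using p(4,5) by (simp_all add: algebra_simps)
        thus ?thesis unfolding p(1-3) by (simp add: algebra_simps)
      qed
      ultimately show ?thesis by simp
    qed
    moreover have "wronski 2 1 2 + qq^2 * wronski 2 2 1 \<noteq> 0"
    proof -
      have "(wronski 2 1 2 + qq^2 * wronski 2 2 1) * qd = - (qq powi (-3) * (qq powi 6 - qq powi 2) * (qq powi 2 - 1))"
        by (simp add: wronski_def power_int_minus) (simp add: field_simps eval_nat_numeral)
      thus ?thesis by auto
    qed
    ultimately show ?thesis using assms by (simp add: d_def)
  next
    case False
    hence l3: "3 \<le> l" using assms by simp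
    define e where "e s = P s 3 - Q s 3" for s
    have rel: "coeff2 (desc l j (3 - j)) 0 3 * (e (Suc s) - qq powi (kexp l j 3) * e s)
       + (coeff2 (desc l j (3 - j)) 1 2 + L * coeff2 (desc l j (3 - j)) 2 1) * (P s 1 * d) = 0"
      if "odd j" "j \<le> 3" for j s
    proof -
      have i: "{1..<3::nat} = {1, 2}" by auto
      have "coeff2 (desc l j (3 - j)) 0 3 * (P (Suc s) 3 - qq powi (kexp l j 3) * P s 3)
        + (coeff2 (desc l j (3 - j)) 1 2 * (P s 1 * P (Suc s) 2) + coeff2 (desc l j (3 - j)) 2 1 * (P s 2 * P (Suc s) 1)) = 0"
        using kills_eq[OF k(1)[of s] P(2) P(2) that l3] unfolding i by simp
      moreover have "coeff2 (desc l j (3 - j)) 0 3 * (Q (Suc s) 3 - qq powi (kexp l j 3) * Q s 3)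
        + (coeff2 (desc l j (3 - j)) 1 2 * (P s 1 * Q (Suc s) 2) + coeff2 (desc l j (3 - j)) 2 1 * (Q s 2 * P (Suc s) 1)) = 0"
        using kills_eq[OF k(2)[of s] Q(2) Q(2) that l3] e1[of s] e1[of "Suc s"] unfolding i by simp
      ultimately show ?thesis
        unfolding e_def using d[of s] d[of "Suc s"] p1(1)[of s] by (rule subtract_relations)
    qed
    define K1 where "K1 = (wronski l 1 2 + L * wronski l 2 1) / wronski l 0 3"
    define K3 where "K3 = hw_coeff l 3 1 + L * hw_coeff l 3 2"
    obtain c where c: "c \<noteq> 0" "\<And>i k. i \<le> l \<Longrightarrow> k \<le> l \<Longrightarrow> i + k = Suc 2 \<Longrightarrow> coeff2 (desc l 1 2) i k = c * wronski l i k"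
      using desc_1[of l 2] assms by auto
    have w03: "wronski l 0 3 \<noteq> 0" using wronski_eq_0[of l 0 3] by auto
    have r1: "e (Suc s) - qq powi (kexp l 1 3) * e s + K1 * (P s 1 * d) = 0" for s
    proof -
      have "c * (wronski l 0 3 * (e (Suc s) - qq powi (kexp l 1 3) * e s)
       + (wronski l 1 2 + L * wronski l 2 1) * (P s 1 * d)) = 0"
        using rel[of 1 s] c(2)[of 0 3] c(2)[of 1 2] c(2)[of 2 1] l3 by (simp add: algebra_simps)
      thus ?thesis using c(1) w03 by (simp add: K1_def divide_simps) (simp add: algebra_simps)
    qed
    have r3: "e (Suc s) - qq powi (kexp l 3 3) * e s + K3 * (P s 1 * d) = 0" for s
      using rel[of 3 s] l3 coeff2_hw[of 0 3 3 l] coeff2_hw[of 1 2 3 l] coeff2_hw[of 2 1 3 l] by (simp add: K3_def)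
    define A B where "A = qq powi (kexp l 1 3)" and "B = qq powi (kexp l 3 3)"
    \<comment> \<open>Eliminating the value of \<open>e\<close> at the next place from the two relations.\<close>
    have ba: "(B - A) * e s = (K3 - K1) * (P s 1 * d)" for s
    proof -
      have "(B - A) * e s - (K3 - K1) * (P s 1 * d)
        = (e (Suc s) - A * e s + K1 * (P s 1 * d)) - (e (Suc s) - B * e s + K3 * (P s 1 * d))"
        by (simp add: algebra_simps)
      also have "\<dots> = 0" unfolding A_def B_def r1 r3 by simp
      finally show ?thesis by simp
    qed
    have "((L - A) * K3 + (B - L) * K1) * (P 0 1 * d) = 0"
    proof -
      define X where "X = P 0 1 * d"
      have X1: "P 1 1 * d = L * X" using p1(1)[of 0] by (simp add: X_def)
      have e1: "e 1 = A * e 0 - K1 * X" using r1[of 0] by (simp add: A_def X_def algebra_simps)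
      have "(K3 - K1) * (L * X) = (B - A) * e 1" using ba[of 1] X1 by simp
      also have "\<dots> = A * ((B - A) * e 0) - (B - A) * K1 * X"
        unfolding e1 by (simp add: algebra_simps)
      also have "(B - A) * e 0 = (K3 - K1) * X" using ba[of 0] by (simp add: X_def)
      finally show ?thesis unfolding X_def[symmetric] by (simp add: algebra_simps)
    qed
    moreover have "(L - A) * K3 + (B - L) * K1 \<noteq> 0"
    proof -
      have AB: "A = 1 / L" "B = L^3 / qq^6"
        using power_int_add[of qq "int l" "int l"] power_int_add[of qq "int l + int l" "int l"]
        by (simp_all add: A_def B_def L_def kexp_def power_int_minus power_int_diff divide_inverse power3_eq_cube)
      have L: "L \<noteq> 0" "L^2 \<noteq> 1" "L^4 \<noteq> qq^6"
        using l3 by (simp_all add: L_def power_mult[symmetric])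
      have q: "qq^6 \<noteq> 1" "qq^4 \<noteq> 1" "qq^2 \<noteq> 1"
        by simp_all
      have L2: "qq powi (2 * int l) = L^2" "qq powi (int l * 2) = L^2"
        by (simp_all add: L_def power_int_mult mult.commute[of 2])
      have Lf: "qq powi int l = L" "qq powi (- int l) = 1 / L"
        "qq powi (int l - 2) = L / qq^2" "qq powi (2 - int l) = qq^2 / L"
        by (simp_all add: L_def power_int_minus power_int_diff divide_inverse)
      define R where "R = (L / qq^2 - qq^2 / L) / (L - 1 / L)"
      have R: "qi (int l - 2) / qi (int l) = R"
        by (simp only: qi_def Lf minus_diff_eq R_def) simp
      have "K3 = - (L * R) + L * (L^2 / qq^2 * R)"
      proof -
        have "hw_coeff l 3 1 = - (L * R)"
          using hw_coeff_Suc[of l 3 0] by (simp add: L_def R[symmetric])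
        moreover have "hw_coeff l 3 2 = - (L / qq^2) * hw_coeff l 3 1"
          using hw_coeff_Suc[of l 3 1] l3 Lf(3) by (simp add: numeral_2_eq_2)
        ultimately show ?thesis by (simp add: K3_def power2_eq_square)
      qed
      hence K3: "K3 = L * (L^2 / qq^2 * R) - L * R" by simp
      have W: "wronski l 0 3 = (qq^6 - 1) / qq^3 / qd"
        "wronski l 1 2 = (qq^6 + L^2 - qq^2 - qq^2 * L^2) / (qq * L) / qd"
        "wronski l 2 1 = (qq^6 + L^2 - qq^4 - qq^4 * L^2) / (qq * L^2) / qd"
      proof -
        have e: "qq powi (2 - int l - 3) = 1 / (qq * L)" "qq powi (- (2 * int l) - 1) = 1 / (qq * L^2)"
          "qq powi (2 + 2 * int l) = qq^2 * L^2" "qq powi (4 + 2 * int l) = qq^4 * L^2"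
          by (simp_all add: power_int_diff power_int_add power_int_minus L_def power_int_mult mult.commute[of 2] field_simps eval_nat_numeral)
        show "wronski l 0 3 = (qq^6 - 1) / qq^3 / qd"
          by (simp add: wronski_def power_int_minus divide_inverse mult_ac)
        show "wronski l 1 2 = (qq^6 + L^2 - qq^2 - qq^2 * L^2) / (qq * L) / qd"
          "wronski l 2 1 = (qq^6 + L^2 - qq^4 - qq^4 * L^2) / (qq * L^2) / qd"
          using e by (simp_all add: wronski_def L2)
      qed
      have K1: "K1 = ((qq^6 + L^2 - qq^2 - qq^2 * L^2) / (qq * L) + L * ((qq^6 + L^2 - qq^4 - qq^4 * L^2) / (qq * L^2))) / ((qq^6 - 1) / qq^3)"
      proof -
        have "(X / qd + L * (Y / qd)) / (Z / qd) = (X + L * Y) / Z" for X Y Z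
        proof -
          have "X / qd + L * (Y / qd) = (X + L * Y) / qd" by (simp add: add_divide_distrib)
          thus ?thesis by simp
        qed
        thus ?thesis unfolding K1_def W .
      qed
      have "(L - A) * K3 + (B - L) * K1 = (qq^2 - 1) * (qq^4 - 1) * (L^4 - qq^6) / (qq^4 * (qq^6 - 1))"
        unfolding AB K3 by (rule obstruction_scalar[OF qq_neq_0 L(1,2) q(1) R_def K1])
      thus ?thesis using L q by simp
    qed
    ultimately show ?thesis using assms by (simp add: d_def)
  qed
qed

section \<open>The braided symmetric algebra as a quotient\<close>

definition TT :: "nat \<Rightarrow> tens set" where
  "TT m = {t. \<forall>w\<in>Poly_Mapping.keys t. set (letters w) \<subseteq> {..m}}"

lemma tensor_alg_simps [simp]:
  "carrier (tensor_alg m) = TT m" "monoid.mult (tensor_alg m) = (*)" "one (tensor_alg m) = 1"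
  "zero (tensor_alg m) = 0" "add (tensor_alg m) = (+)" "scal (tensor_alg m) = sc" "hcomp (tensor_alg m) = tdeg m"
  by (simp_all add: tensor_alg_def TT_def)

lemma subsp_TT: "subsp (TT m)"
  unfolding TT_def by (rule subsp_words)

lemma TT_mult: "s \<in> TT m \<Longrightarrow> t \<in> TT m \<Longrightarrow> s * t \<in> TT m"
  using keys_mult[of s t] unfolding TT_def by (fastforce simp: plus_tword_def)

lemma mon_TT [simp]: "mon w \<in> TT m \<longleftrightarrow> set w \<subseteq> {..m}"
  by (simp add: TT_def)

lemma one_TT [simp]: "1 \<in> TT m"
  using mon_TT[of "[]" m] by simp

lemma sc_TT [simp]: "sc c \<in> TT m"
  using subspD(3)[OF subsp_TT one_TT, of c m] by simp

lemma tdeg_TT: "tdeg m d \<subseteq> TT m"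
  by (auto simp: tdeg_def TT_def)

lemma TT_induct [consumes 1, case_names zero add scale mon]:
  assumes "t \<in> TT m"
    and "S 0" "\<And>x y. S x \<Longrightarrow> S y \<Longrightarrow> S (x + y)" "\<And>c x. S x \<Longrightarrow> S (sc c * x)"
    and "\<And>w. set w \<subseteq> {..m} \<Longrightarrow> S (mon w)"
  shows "S t"
  by (rule tens_induct_keys[of t "\<lambda>w. set w \<subseteq> {..m}"]) (use assms in \<open>auto simp: TT_def\<close>)

lemma ring_tensor_alg: "ring (tensor_alg m)"
proof (rule ringI)
  show "abelian_group (tensor_alg m)"
  proof (rule abelian_groupI)
    fix x assume "x \<in> carrier (tensor_alg m)"
    thus "\<exists>y\<in>carrier (tensor_alg m). y \<oplus>\<^bsub>tensor_alg m\<^esub> x = \<zero>\<^bsub>tensor_alg m\<^esub>"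
      by (intro bexI[of _ "- x"]) (simp_all add: subspD[OF subsp_TT])
  qed (simp_all add: subspD[OF subsp_TT] add_ac)
  show "monoid (tensor_alg m)"
    by (rule monoidI) (simp_all add: TT_mult mult.assoc)
qed (simp_all add: distrib_left distrib_right)

lemma ideal_sym_ideal: "ideal (sym_ideal m) (tensor_alg m)"
  unfolding sym_ideal_def
  using ext_square_T2 tdeg_TT by (intro ring.genideal_ideal[OF ring_tensor_alg]) fastforce

lemma sym_ideal_TT: "sym_ideal m \<subseteq> TT m"
  using ideal.Icarr[OF ideal_sym_ideal] by fastforce

lemma ext_square_sym_ideal: "ext_square m \<subseteq> sym_ideal m"
  unfolding sym_ideal_def
  using ext_square_T2 tdeg_TT ring.genideal_self[OF ring_tensor_alg, of "ext_square m" m] by fastforce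

lemma sym_ideal_mult: "x \<in> sym_ideal m \<Longrightarrow> t \<in> TT m \<Longrightarrow> t * x \<in> sym_ideal m"
  "x \<in> sym_ideal m \<Longrightarrow> t \<in> TT m \<Longrightarrow> x * t \<in> sym_ideal m"
  using ideal.I_l_closed[OF ideal_sym_ideal] ideal.I_r_closed[OF ideal_sym_ideal] by fastforce+

lemma subsp_sym_ideal: "subsp (sym_ideal m)"
proof -
  interpret ideal "sym_ideal m" "tensor_alg m" by (rule ideal_sym_ideal)
  show ?thesis
    using additive_subgroup.zero_closed[OF is_additive_subgroup] additive_subgroup.a_closed[OF is_additive_subgroup]
      sym_ideal_mult(1)[OF _ sc_TT] by (auto simp: subsp_def)
qed

text \<open>Stability under multiplication is only required for elements of \<open>T(V\<^sub>m)\<close>, so that \<open>J\<close> may be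
  defined by a condition on all tensors.\<close>

lemma sym_ideal_minimal:
  assumes "subsp J" "ext_square m \<subseteq> J"
    and "\<And>x t. x \<in> J \<Longrightarrow> x \<in> TT m \<Longrightarrow> t \<in> TT m \<Longrightarrow> t * x \<in> J \<and> x * t \<in> J"
  shows "sym_ideal m \<subseteq> J"
proof -
  have "ideal (J \<inter> TT m) (tensor_alg m)"
  proof (rule idealI[OF ring_tensor_alg])
    have S: "subsp (J \<inter> TT m)" by (rule subsp_Int[OF assms(1) subsp_TT])
    have inv: "\<ominus>\<^bsub>tensor_alg m\<^esub> x = - x" if "x \<in> TT m" for x
      by (rule abelian_group.minus_equality[OF ring.is_abelian_group[OF ring_tensor_alg]])
         (use that in \<open>simp_all add: subspD[OF subsp_TT]\<close>)
    show "subgroup (J \<inter> TT m) (add_monoid (tensor_alg m))"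
    proof (rule group.subgroupI)
      show "group (add_monoid (tensor_alg m))"
        using abelian_group.a_group[OF ring.is_abelian_group[OF ring_tensor_alg]] .
      fix x assume "x \<in> J \<inter> TT m"
      thus "inv\<^bsub>add_monoid (tensor_alg m)\<^esub> x \<in> J \<inter> TT m"
        using inv[of x] subspD(4)[OF S, of x] by (simp add: a_inv_def)
    qed (use subspD[OF S] in auto)
  qed (use assms(3) TT_mult in auto)
  moreover have "ext_square m \<subseteq> J \<inter> TT m"
    using assms(2) ext_square_T2 tdeg_TT by fastforce
  ultimately show ?thesis
    unfolding sym_ideal_def using ring.genideal_minimal[OF ring_tensor_alg] by blast
qed

lemma sym_alg_simps:
  "carrier (sym_alg m) = carrier (tensor_alg m Quot sym_ideal m)"
  "monoid.mult (sym_alg m) = monoid.mult (tensor_alg m Quot sym_ideal m)"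
  "one (sym_alg m) = one (tensor_alg m Quot sym_ideal m)"
  "zero (sym_alg m) = zero (tensor_alg m Quot sym_ideal m)"
  "add (sym_alg m) = add (tensor_alg m Quot sym_ideal m)"
  "scal (sym_alg m) = (\<lambda>c. cls m (sc c))" "hcomp (sym_alg m) = (\<lambda>d. cls m ` tdeg m d)"
  by (simp_all add: sym_alg_def ring.defs kalg.defs)

lemma ring_sym_alg: "ring (sym_alg m)"
proof -
  interpret Q: ring "tensor_alg m Quot sym_ideal m"
    by (rule ideal.quotient_is_ring[OF ideal_sym_ideal])
  show ?thesis
  proof (rule ringI)
    show "abelian_group (sym_alg m)"
      by (rule abelian_groupI) (use Q.l_neg Q.a_inv_closed in \<open>auto simp: sym_alg_simps Q.a_ac\<close>)
    show "monoid (sym_alg m)"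
      by (rule monoidI) (simp_all add: sym_alg_simps Q.m_assoc)
  qed (simp_all add: sym_alg_simps Q.l_distr Q.r_distr)
qed

lemma mem_cls_iff: "t \<in> TT m \<Longrightarrow> x \<in> cls m t \<longleftrightarrow> x - t \<in> sym_ideal m"
proof
  assume "x \<in> cls m t"
  then obtain i where "i \<in> sym_ideal m" "x = i + t"
    by (auto simp: cls_def a_r_coset_def r_coset_def)
  thus "x - t \<in> sym_ideal m" by simp
next
  assume "x - t \<in> sym_ideal m"
  hence "\<exists>i\<in>sym_ideal m. x = i + t" by (intro bexI[of _ "x - t"]) simp_all
  thus "x \<in> cls m t" unfolding cls_def a_r_coset_def r_coset_def by auto
qed

lemma cls_eq_iff:
  assumes "s \<in> TT m" "t \<in> TT m"
  shows "cls m s = cls m t \<longleftrightarrow> s - t \<in> sym_ideal m"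
proof
  assume "cls m s = cls m t"
  moreover have "s \<in> cls m s" by (simp add: mem_cls_iff assms subspD[OF subsp_sym_ideal])
  ultimately show "s - t \<in> sym_ideal m" by (simp add: mem_cls_iff assms)
next
  assume st: "s - t \<in> sym_ideal m"
  have "x - s \<in> sym_ideal m \<longleftrightarrow> x - t \<in> sym_ideal m" for x
    using subspD(2)[OF subsp_sym_ideal _ st, of "x - s"] subspD(5)[OF subsp_sym_ideal _ st, of "x - t"] by auto
  thus "cls m s = cls m t" by (auto simp: mem_cls_iff assms)
qed

lemma cls_carrier: "carrier (sym_alg m) = cls m ` TT m"
  by (auto simp: sym_alg_simps FactRing_def A_RCOSETS_def' cls_def)

lemma cls_in_carrier [simp]: "t \<in> TT m \<Longrightarrow> cls m t \<in> carrier (sym_alg m)"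
  by (simp add: cls_carrier)

lemma cls_mult: "s \<in> TT m \<Longrightarrow> t \<in> TT m \<Longrightarrow> cls m s \<otimes>\<^bsub>sym_alg m\<^esub> cls m t = cls m (s * t)"
  using ideal.rcoset_mult_add[OF ideal_sym_ideal, of s m t]
  by (simp add: sym_alg_simps FactRing_def cls_def)

lemma cls_add: "s \<in> TT m \<Longrightarrow> t \<in> TT m \<Longrightarrow> cls m s \<oplus>\<^bsub>sym_alg m\<^esub> cls m t = cls m (s + t)"
proof -
  assume a: "s \<in> TT m" "t \<in> TT m"
  interpret ideal "sym_ideal m" "tensor_alg m" by (rule ideal_sym_ideal)
  show ?thesis
    using a_rcos_sum[of s t] a by (simp add: sym_alg_simps FactRing_def cls_def)
qed

lemma cls_one: "\<one>\<^bsub>sym_alg m\<^esub> = cls m 1"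
  by (simp add: sym_alg_simps FactRing_def cls_def)

lemma cls_zero: "\<zero>\<^bsub>sym_alg m\<^esub> = cls m 0"
  by (simp add: sym_alg_simps FactRing_def cls_def a_r_coset_def r_coset_def)

lemma cls_eq_zero_iff: "t \<in> TT m \<Longrightarrow> cls m t = \<zero>\<^bsub>sym_alg m\<^esub> \<longleftrightarrow> t \<in> sym_ideal m"
  unfolding cls_zero by (simp add: cls_eq_iff subspD[OF subsp_TT])

section \<open>Forms attached to a chain\<close>

text \<open>The value of the form \<open>P\<^sub>s \<otimes> P\<^bsub>s+1\<^esub> \<otimes> \<dots>\<close> on a word.\<close>

fun evw :: "(nat \<Rightarrow> nat \<Rightarrow> kq) \<Rightarrow> nat \<Rightarrow> nat list \<Rightarrow> kq" where
  "evw P s [] = 1"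
| "evw P s (i # w) = P s i * evw P (Suc s) w"

lemma evw_append: "evw P s (u @ v) = evw P s u * evw P (s + length u) v"
  by (induction u arbitrary: s) (simp_all add: mult.assoc)

lemma evw_prod: "evw P s w = (\<Prod>k<length w. P (s + k) (w ! k))"
  by (induction w arbitrary: s) (simp_all add: prod.lessThan_Suc_shift del: prod.lessThan_Suc)

definition ev :: "(nat \<Rightarrow> nat \<Rightarrow> kq) \<Rightarrow> nat \<Rightarrow> tens \<Rightarrow> kq" where
  "ev P s = wsum (evw P s)"

lemmas ev_simps = wsum_linear[of "evw P s" for P s, folded ev_def]

lemma ev_mon [simp]: "ev P s (mon w) = evw P s w"
  by (simp add: ev_def)

lemma ev_0 [simp]: "ev P s 0 = 0" by (simp add: ev_def)

lemma ev_mult: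
  assumes "a \<in> tdeg m d"
  shows "ev P s (a * b) = ev P s a * ev P (s + d) b"
proof -
  have "ev P s (a * b) = wsum (\<lambda>u. wsum (\<lambda>v. evw P s (u @ v)) b) a"
    by (simp add: ev_def wsum_mult)
  also have "\<dots> = wsum (\<lambda>u. ev P (s + d) b * evw P s u) a"
    by (rule wsum_cong) (use assms in \<open>simp add: evw_append wsum_fmult ev_def tdeg_def mult.commute\<close>)
  also have "\<dots> = ev P (s + d) b * ev P s a" by (simp only: wsum_fmult) (simp add: ev_def)
  finally show ?thesis by (simp only: mult.commute)
qed

lemma ev_ev2:
  assumes "t \<in> tdeg m 2"
  shows "ev P s t = ev2 (P s) (P (Suc s)) t"
  unfolding ev_def ev2_def
proof (rule wsum_cong)
  fix w assume "w \<in> Poly_Mapping.keys t"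
  with assms have "length (letters w) = 2" by (auto simp: tdeg_def)
  then obtain a b where "letters w = [a, b]" by (auto simp: numeral_2_eq_2 length_Suc_conv)
  thus "evw P s (letters w) = P s (letters w ! 0) * P (Suc s) (letters w ! 1)" by simp
qed

text \<open>The ideal is generated by the exterior square, and evaluation is multiplicative.\<close>

lemma ev_sym_ideal:
  assumes P: "chain m P" and t: "t \<in> sym_ideal m"
  shows "ev P s t = 0"
proof -
  \<comment> \<open>The condition has to be stable under multiplication from both sides.\<close>
  define J where "J = {t. \<forall>a\<in>TT m. \<forall>b\<in>TT m. \<forall>s. ev P s (a * (t * b)) = 0}"
  have "sym_ideal m \<subseteq> J"
  proof (rule sym_ideal_minimal)
    show "subsp J"
      by (simp add: subsp_def J_def distrib_left distrib_right ev_simps mult.assoc sc_left_commute)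
    show "ext_square m \<subseteq> J"
    proof
      fix h assume h: "h \<in> ext_square m"
      hence h2: "h \<in> tdeg m 2" using ext_square_T2 by blast
      have hb: "ev P s (h * b) = 0" for s b
        using P h by (simp add: ev_mult[OF h2] ev_ev2[OF h2] chain_def kills_def)
      have "ev P s (a * (h * b)) = 0" for s a b
      proof (induction a rule: tens_induct)
        case (mon w)
        have "mon w \<in> tdeg (Max (insert 0 (set w))) (length w)" by auto
        from ev_mult[OF this] show ?case by (simp add: hb)
      qed (simp_all add: distrib_right ev_simps mult.assoc)
      thus "h \<in> J" by (simp add: J_def)
    qed
    fix x t assume "x \<in> J" "t \<in> TT m"
    thus "t * x \<in> J \<and> x * t \<in> J"
      unfolding J_def using TT_mult by (auto simp: mult.assoc) (metis mult.assoc)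
  qed
  with t have "ev P s (1 * (t * 1)) = 0" unfolding J_def using one_TT by blast
  thus ?thesis by simp
qed

section \<open>Normal forms in the braided symmetric algebras of V1 and V2\<close>

lemma hw_1: "m \<ge> 1 \<Longrightarrow> hw m 1 = ee m 0 1 - sc (qq powi int m) * ee m 1 0"
  by (simp add: hw_def hw_coeff_Suc sc_minus)

lemma braiding_weight_1:
  assumes "t \<in> tw m 2 1" "m \<ge> 1"
  shows "\<exists>c. braiding m t - t = sc c * hw m 1"
proof -
  obtain s c where s: "s \<in> tw m 2 0" and t: "t = act m UF s + sc c * ee m 0 1"
    using tw2_reduce[of t m 0] assms(1) by auto
  have "s \<in> tdeg m 2" using s tw_tdeg by blast
  moreover have "braiding m s = s"
    using s
  proof (induction rule: tw2_induct)
    case (ee i j)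
    hence "i = 0" "j = 0" by linarith+
    thus ?case using braiding_ee0[of m 0] by simp
  qed (simp_all add: braiding_simps)
  moreover have "braiding m (ee m 0 1) - ee m 0 1 = - hw m 1"
    using assms(2) by (simp add: braiding_ee0 hw_1[unfolded One_nat_def])
  ultimately have "braiding m t - t = sc (- c) * hw m 1"
    by (simp add: t braiding_simps braiding_act sc_minus right_diff_distrib[symmetric])
  thus ?thesis by blast
qed

text \<open>For \<open>m \<le> 2\<close> the only odd \<open>j\<close> is \<open>1\<close>, so the exterior square is the simple module \<open>V\<^bsub>2m-2\<^esub>\<close>. The
  polynomial in the braiding with roots \<open>1\<close> and the eigenvalue for \<open>j = 2\<close> maps the tensor square into
  this module and is a nonzero scalar on the exterior square.\<close>

lemma ext_square_small:
  assumes "1 \<le> m" "m \<le> 2" "subsp K" "\<And>N. desc m 1 N \<in> K"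
  shows "ext_square m \<subseteq> K"
proof -
  let ?F = "\<lambda>N. (act m UF ^^ N)"
  have linF: "lin (?F N)" for N
    by (induction N) (simp_all add: lin_def act_simps)
  have T2F: "t \<in> tdeg m 2 \<Longrightarrow> ?F N t \<in> tdeg m 2" for t N
    by (induction N) (simp_all add: act_T2)
  have kill: "sym_killer m 2 (?F N t) = ?F N (sym_killer m 2 t)" if "t \<in> tdeg m 2" for t N
    by (induction N) (simp_all add: sym_killer_act T2F that)
  define D where "D = {t. \<forall>N. ?F N (sym_killer m 2 t) \<in> K}"
  have D: "subsp D"
    using assms(3) by (auto simp: D_def subsp_def lin_simps[OF linF] sym_killer_simps)
  have hw: "?F N (sc c * act m UF (hw m 1)) \<in> K" "?F N (sc c * hw m 1) \<in> K" for N c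
    using assms(4)[of "Suc N"] assms(4)[of N] subspD(3)[OF assms(3)]
    by (simp_all add: lin_sc[OF linF] desc_def funpow_swap1)
  have k2: "sym_killer m 2 t = (braiding m (braiding m t - sc (braid_eigenvalue m 2) * t)) - (braiding m t - sc (braid_eigenvalue m 2) * t)" for t
    by (simp add: numeral_2_eq_2)
  have gen: "ee m 0 (int n) \<in> D" for n
  proof -
    consider "n = 0" | "n = 1" | "n = 2" | "n > 2" by linarith
    thus ?thesis
    proof cases
      case 1
      have "braiding m (ee m 0 0) = ee m 0 0" using braiding_ee0[of m 0] by simp
      hence "sym_killer m 2 (ee m 0 0) = 0" by (simp add: k2 braiding_simps)
      thus ?thesis using 1 subspD(1)[OF assms(3)] by (simp add: D_def lin_simps[OF linF])
    next
      case 2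
      have e: "ee m 0 1 \<in> tw m 2 1" by (rule ee_tw) simp
      have "braiding m (ee m 0 1) - sc (braid_eigenvalue m 2) * ee m 0 1 \<in> tw m 2 1"
        by (intro subspD[OF subsp_tw] braiding_tw2 e)
      from braiding_weight_1[OF this assms(1)] obtain c where "sym_killer m 2 (ee m 0 1) = sc c * hw m 1"
        unfolding k2 by blast
      thus ?thesis using 2 hw(2) by (simp add: D_def)
    next
      case 3
      obtain s where s: "s \<in> tw m 2 1" "braiding m (ee m 0 2) = act m UF s + sc (braid_eigenvalue m 2) * ee m 0 2"
        using braiding_ee0_reduce[of 2 m] by (auto simp: numeral_2_eq_2)
      have s2: "s \<in> tdeg m 2" using s tw_tdeg by blast
      obtain c where c: "braiding m s - s = sc c * hw m 1" using braiding_weight_1[OF s(1) assms(1)] by blast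
      have "sym_killer m 2 (ee m 0 2) = act m UF (braiding m s - s)"
        by (simp add: k2 s(2) braiding_act[OF s2] act_simps)
      also have "\<dots> = sc c * act m UF (hw m 1)" by (simp only: c act_simps)
      finally show ?thesis using 3 hw(1) by (simp add: D_def)
    next
      case 4
      hence "ee m 0 (int n) = 0" using assms(2) by (simp add: ee_out)
      thus ?thesis using subspD(1)[OF D] by simp
    qed
  qed
  have FD: "act m UF t \<in> D" if "t \<in> D" "t \<in> tdeg m 2" for t
    unfolding D_def
  proof (intro CollectI allI)
    fix N
    have "?F N (sym_killer m 2 (act m UF t)) = ?F (Suc N) (sym_killer m 2 t)"
      using sym_killer_act[OF that(2), of 2 UF] by (simp add: funpow_swap1)
    moreover have "?F (Suc N) (sym_killer m 2 t) \<in> K" using that(1) unfolding D_def by blast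
    ultimately show "?F N (sym_killer m 2 (act m UF t)) \<in> K" by (simp only:)
  qed
  have tw: "t \<in> tw m 2 n \<Longrightarrow> t \<in> D" for t n
  proof (induction n arbitrary: t)
    case 0
    thus ?case
    proof (induction rule: tw2_induct)
      case (ee i j)
      hence "i = 0" "j = 0" by linarith+
      thus ?case using gen[of 0] by simp
    qed (simp_all add: subspD[OF D])
  next
    case (Suc n)
    then obtain s c where "s \<in> tw m 2 n" "t = act m UF s + sc c * ee m 0 (int (Suc n))"
      using tw2_reduce by blast
    thus ?case using Suc.IH[of s] FD[of s] gen[of "Suc n"] tw_tdeg subspD(2,3)[OF D] by (metis subsetD)
  qed
  have all: "t \<in> D" if "t \<in> tdeg m 2" for t
    using that
  proof (induction rule: T2_induct)
    case (ee i j)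
    thus ?case using ee_tw[of i j "nat (i + j)" m] tw by simp
  qed (simp_all add: subspD[OF D])
  show ?thesis
  proof (rule ext_square_subset[OF assms(3)])
    fix t r assume t: "t \<in> tdeg m 2" "braiding m t = - (sc (qq powi r) * t)"
    have "?F 0 (sym_killer m 2 t) \<in> K" using all[OF t(1)] unfolding D_def by blast
    with sym_killer_eigen[OF t(2), of 2] show "t \<in> K"
      using subsp_scD[OF assms(3)] by (metis funpow_0)
  qed
qed

lemma desc_small:
  "desc 1 1 (Suc N) = 0"
  "desc 2 1 1 = sc (qi 2) * ee 2 0 2 + sc (1 - qq^2) * ee 2 1 1 - sc (qi 2) * ee 2 2 0"
  "desc 2 1 2 = sc (qi 2) * (ee 2 1 2 - sc (qq^2) * ee 2 2 1)"
  "desc 2 1 (Suc (Suc (Suc N))) = 0"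
proof -
  have "desc 1 1 1 = 0"
    using hw_1[of 1] by (simp add: act_simps act_ee ee_out sc_assoc)
  moreover have "desc 1 1 (Suc N) = (act 1 UF ^^ N) (desc 1 1 1)" by (simp add: desc_def funpow_swap1)
  moreover have z: "(act m UF ^^ N) 0 = 0" for m by (induction N) (simp_all add: act_simps)
  ultimately show "desc 1 1 (Suc N) = 0" by simp
  show d1: "desc 2 1 1 = sc (qi 2) * ee 2 0 2 + sc (1 - qq^2) * ee 2 1 1 - sc (qi 2) * ee 2 2 0"
  proof -
    have "desc 2 1 1 = act 2 UF (hw 2 1)" by (simp add: desc_def)
    also have "\<dots> = act 2 UF (ee 2 0 1 - sc (qq powi int 2) * ee 2 1 0)"
      by (subst hw_1) simp_all
    also have "\<dots> = sc (qi 2) * ee 2 0 2 + sc (1 - qq^2) * ee 2 1 1 - sc (qi 2) * ee 2 2 0"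
      by (simp add: act_simps act_ee sc_assoc sc_diff distrib_left left_diff_distrib power_int_minus
        mult.left_commute[of "qq^2"])
    finally show ?thesis .
  qed
  have "desc 2 1 2 = act 2 UF (desc 2 1 1)" by (simp add: numeral_2_eq_2)
  also have "\<dots> = sc (qi 2) * (ee 2 1 2 - sc (qq^2) * ee 2 2 1)"
    unfolding d1 by (simp add: act_simps act_ee ee_out sc_assoc sc_diff distrib_left left_diff_distrib right_diff_distrib
      algebra_simps)
  finally show d2: "desc 2 1 2 = sc (qi 2) * (ee 2 1 2 - sc (qq^2) * ee 2 2 1)" .
  have "desc 2 1 3 = act 2 UF (desc 2 1 2)" by (simp add: numeral_3_eq_3 numeral_2_eq_2)
  also have "\<dots> = 0"
    unfolding d2 by (simp add: act_simps act_ee ee_out sc_assoc mult.commute)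
  finally have "desc 2 1 3 = 0" .
  moreover have "desc 2 1 (Suc (Suc (Suc N))) = (act 2 UF ^^ N) (desc 2 1 3)"
    by (simp add: desc_def funpow_swap1 numeral_3_eq_3)
  ultimately show "desc 2 1 (Suc (Suc (Suc N))) = 0" by (simp add: z)
qed

text \<open>The vectors \<open>F\<^sup>N w\<close> for the highest weight vector \<open>w\<close> vanish for \<open>N > 2n - 2\<close>.\<close>

lemma ext_square_1_2:
  assumes n: "n \<in> {1, 2}" and K: "subsp K" and h: "hw n 1 \<in> K"
    and d: "n = 2 \<Longrightarrow> desc 2 1 1 \<in> K" "n = 2 \<Longrightarrow> desc 2 1 2 \<in> K"
  shows "ext_square n \<subseteq> K"
proof (rule ext_square_small[OF _ _ K])
  fix N
  show "desc n 1 N \<in> K"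
  proof (cases "n = 1")
    case True
    show ?thesis by (cases N) (use h True desc_small(1) subspD(1)[OF K] in simp_all)
  next
    case False
    with n have n2: "n = 2" by simp
    consider "N = 0" | "N = 1" | "N = 2" | M where "N = Suc (Suc (Suc M))"
      by (metis One_nat_def Suc_1 not0_implies_Suc)
    thus ?thesis
      by cases (use h d n2 desc_small(4) subspD(1)[OF K] in \<open>simp_all del: desc_simps(2)\<close>)
  qed
qed (use n in auto)

type_synonym coeffs = "nat \<Rightarrow> nat \<Rightarrow> nat \<Rightarrow> kq"

text \<open>A quantum integer that is not symmetrized.\<close>

definition geo :: "kq \<Rightarrow> nat \<Rightarrow> kq" where
  "geo x n = (\<Sum>k<n. x ^ k)"

lemma geo_Suc: "geo x (Suc n) = geo x n + x ^ n" and geo_0 [simp]: "geo x 0 = 0"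
  by (simp_all add: geo_def)

lemma geo_neq_0:
  assumes "r \<noteq> 0" "n > 0"
  shows "geo (qq powi r) n \<noteq> 0"
proof
  assume "geo (qq powi r) n = 0"
  moreover have "(qq powi r - 1) * geo (qq powi r) n = (qq powi r) ^ n - 1"
    unfolding geo_def by (rule power_diff_1_eq[symmetric])
  moreover have "(qq powi r) ^ n = qq powi (r * int n)" by (simp add: power_int_mult)
  ultimately have "qq powi (r * int n) = 1" by simp
  with assms show False by simp
qed

definition gam :: "nat \<Rightarrow> kq" where
  "gam a = (1 - qq^2) / qi 2 * geo (qq powi (-4)) a"

text \<open>Left multiplication by the generators in terms of the coefficients of the ordered monomials
  \<open>x\<^sub>0\<^sup>a x\<^sub>1\<^sup>b x\<^sub>2\<^sup>c\<close>. It is the rewriting \<open>x\<^sub>1 x\<^sub>0\<^sup>a = q\<^bsup>-na\<^esup> x\<^sub>0\<^sup>a x\<^sub>1\<close>, \<open>x\<^sub>2 x\<^sub>1\<^sup>b = q\<^bsup>-2b\<^esup> x\<^sub>1\<^sup>b x\<^sub>2\<close>, \<open>x\<^sub>2 x\<^sub>0\<^sup>a = x\<^sub>0\<^sup>a x\<^sub>2 +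
  \<gamma>\<^sub>a x\<^sub>0\<^bsup>a-1\<^esup> x\<^sub>1\<^sup>2\<close>.\<close>

fun lmul :: "nat \<Rightarrow> nat \<Rightarrow> coeffs \<Rightarrow> coeffs" where
  "lmul n i f a b c =
    (if i = 0 then (if a = 0 then 0 else f (a - 1) b c)
     else if i = 1 then (if b = 0 then 0 else (qq powi (- int n)) ^ a * f a (b - 1) c)
     else (if c = 0 then 0 else (qq powi (-2)) ^ b * f a b (c - 1))
        + (if b < 2 then 0 else gam (Suc a) * f (Suc a) (b - 2) c))"

declare lmul.simps [simp del]
lemmas lmul_def = lmul.simps

text \<open>The tensor \<open>t\<close> acts on the element with coefficients \<open>f\<close> by left multiplication.\<close>

definition nf_from :: "nat \<Rightarrow> coeffs \<Rightarrow> tens \<Rightarrow> coeffs" where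
  "nf_from n f t a b c = wsum (\<lambda>w. foldr (lmul n) w f a b c) t"

lemma nf_from_linear:
  "nf_from n f (s + t) a b c = nf_from n f s a b c + nf_from n f t a b c"
  "nf_from n f (s - t) a b c = nf_from n f s a b c - nf_from n f t a b c"
  "nf_from n f (- t) a b c = - nf_from n f t a b c"
  "nf_from n f (sc x * t) a b c = x * nf_from n f t a b c"
  "nf_from n f 0 a b c = 0"
  by (simp_all add: nf_from_def wsum_linear)

lemma nf_from_mon [simp]: "nf_from n f (mon w) = foldr (lmul n) w f"
  by (simp add: nf_from_def fun_eq_iff)

lemma lmul_wsum: "lmul n i (\<lambda>a b c. wsum (\<lambda>w. f w a b c) t) = (\<lambda>a b c. wsum (\<lambda>w. lmul n i (f w) a b c) t)"
  by (simp add: fun_eq_iff lmul_def wsum_fun_add wsum_fmult)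

lemma foldr_lmul_wsum:
  "foldr (lmul n) u (\<lambda>a b c. wsum (\<lambda>w. f w a b c) t) = (\<lambda>a b c. wsum (\<lambda>w. foldr (lmul n) u (f w) a b c) t)"
proof (induction u)
  case (Cons i u)
  show ?case by (simp add: Cons lmul_wsum)
qed simp

lemma nf_from_mult: "nf_from n f (s * t) = nf_from n (nf_from n f t) s"
proof (intro ext)
  fix a b c
  have "nf_from n f t = (\<lambda>a b c. wsum (\<lambda>w. foldr (lmul n) w f a b c) t)"
    by (simp add: fun_eq_iff nf_from_def)
  thus "nf_from n f (s * t) a b c = nf_from n (nf_from n f t) s a b c"
    by (simp add: nf_from_def[of n _ s] nf_from_def[of n f "s * t"] wsum_mult foldr_lmul_wsum)
qed

lemma lmul_zero: "lmul n i (\<lambda>a b c. 0) = (\<lambda>a b c. 0)"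
  by (simp add: fun_eq_iff lmul_def)

lemma nf_from_zero: "nf_from n (\<lambda>a b c. 0) t = (\<lambda>a b c. 0)"
proof -
  have "foldr (lmul n) w (\<lambda>a b c. 0) = (\<lambda>a b c. 0)" for w
    by (induction w) (simp_all add: lmul_zero)
  thus ?thesis by (simp add: nf_from_def fun_eq_iff)
qed

lemma nf_from_ee:
  assumes "i \<le> m" "j \<le> m"
  shows "nf_from n f (ee m (int i) (int j)) = lmul n i (lmul n j f)"
  using assms by (simp add: ee_int)

text \<open>The operators of left multiplication satisfy the defining relations \<open>r1\<close>, \<open>r2\<close> and \<open>r3\<close>, so that
  they make the space of coefficients a module over the braided symmetric algebra. This is the
  confluence of the rewriting.\<close>

lemma nf_from_sym_ideal:
  assumes n: "n \<in> {1, 2}" and t: "t \<in> sym_ideal n"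
  shows "nf_from n f t = (\<lambda>a b c. 0)"
proof -
  define J where "J = {t. \<forall>f. nf_from n f t = (\<lambda>a b c. 0)}"
  have J: "subsp J"
    by (auto simp: J_def subsp_def nf_from_linear fun_eq_iff)
  have r1: "lmul n 0 (lmul n 1 f) a b c = qq powi int n * lmul n 1 (lmul n 0 f) a b c" for f a b c
  proof (cases a)
    case (Suc a')
    have "qq powi int n * (qq powi (- int n) * x) = x" for x
      by (simp add: power_int_minus)
    thus ?thesis using Suc by (simp add: lmul_def mult.assoc)
  qed (simp add: lmul_def)
  have r2: "lmul 2 1 (lmul 2 2 f) a b c = qq^2 * lmul 2 2 (lmul 2 1 f) a b c" for f a b c
  proof -
    define Q where "Q = qq powi (-2)"
    have Q1: "Q * qq^2 = 1" by (simp add: Q_def power_int_minus)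
    hence Q2: "Q^2 * qq^2 = Q" by (simp add: power2_eq_square mult.assoc)
    have Q: "qq^2 * (Q * x) = x" "Q * (y * (qq^2 * x)) = y * x" "Q * (y * (z * (qq^2 * x))) = y * (z * x)" for x y z
      by (simp_all add: Q_def power_int_minus)
    have L1: "lmul 2 1 f a b c = (if b = 0 then 0 else Q ^ a * f a (b - 1) c)"
      and L2: "lmul 2 2 f a b c = (if c = 0 then 0 else Q ^ b * f a b (c - 1))
        + (if b < 2 then 0 else gam (Suc a) * f (Suc a) (b - 2) c)" for f a b c
      by (simp_all add: lmul_def Q_def)
    consider "b = 0" | "b = 1" | "b = 2" | b' where "b = Suc (Suc (Suc b'))"
      by (metis One_nat_def Suc_1 not0_implies_Suc)
    thus ?thesis
      by cases (simp_all add: L1[unfolded One_nat_def] L2 distrib_left mult.left_commute[of "qq^2"] mult.assoc Q Q1 Q2)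
  qed
  have r3: "qi 2 * lmul 2 0 (lmul 2 2 f) a b c + (1 - qq^2) * lmul 2 1 (lmul 2 1 f) a b c
      - qi 2 * lmul 2 2 (lmul 2 0 f) a b c = 0" for f a b c
  proof -
    have g: "qi 2 * gam (Suc a) = qi 2 * gam a + (1 - qq^2) * (qq powi (-4)) ^ a" for a
      by (simp add: gam_def geo_Suc distrib_left)
    have p: "(qq powi (-2)) ^ a * ((qq powi (-2)) ^ a * x) = (qq powi (-4)) ^ a * x" for x a
    proof -
      have "qq powi (-2) * qq powi (-2) = qq powi (-4)" by (subst qq_powi_mult) simp
      thus ?thesis by (simp only: mult.assoc[symmetric] power_mult_distrib[symmetric])
    qed
    show ?thesis
    proof (cases "b < 2")
      case True
      thus ?thesis by (auto simp: lmul_def)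
    next
      case False
      then obtain b' where b: "b = Suc (Suc b')" by (metis add_2_eq_Suc le_Suc_ex not_less)
      have "qi 2 * lmul 2 0 (lmul 2 2 f) a b c + (1 - qq^2) * lmul 2 1 (lmul 2 1 f) a b c
      - qi 2 * lmul 2 2 (lmul 2 0 f) a b c
        = (qi 2 * gam a + (1 - qq^2) * (qq powi (-4)) ^ a - qi 2 * gam (Suc a)) * f a b' c"
      proof (cases a)
        case 0
        thus ?thesis by (simp add: b lmul_def gam_def algebra_simps)
      next
        case (Suc a')
        have "(qq powi (-2)) * (qq powi (-2) * ((qq powi (-2)) ^ a' * (qq powi (-2)) ^ a')) = qq powi (-4) * (qq powi (-4)) ^ a'"
          using p[of "Suc a'" 1] by (simp only: mult_1_right mult_1_left power_Suc mult_ac)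
        thus ?thesis using Suc by (simp add: b lmul_def p algebra_simps)
      qed
      thus ?thesis by (simp add: g)
    qed
  qed
  have e: "ee m 0 0 = ee m (int 0) (int 0)" "ee m 0 1 = ee m (int 0) (int 1)" "ee m 1 0 = ee m (int 1) (int 0)"
    "ee m 0 2 = ee m (int 0) (int 2)" "ee m 1 1 = ee m (int 1) (int 1)" "ee m 2 0 = ee m (int 2) (int 0)"
    "ee m 1 2 = ee m (int 1) (int 2)" "ee m 2 1 = ee m (int 2) (int 1)" for m by simp_all
  have "sym_ideal n \<subseteq> J"
  proof (rule sym_ideal_minimal[OF J])
    have ne: "nf_from n f (ee n (int i) (int j)) a b c = lmul n i (lmul n j f) a b c"
      if "i \<le> n" "j \<le> n" for f i j a b c
      using that by (simp only: nf_from_ee)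
    have n1: "1 \<le> n" using n by auto
    show "ext_square n \<subseteq> J"
    proof (rule ext_square_1_2[OF n J])
      have "nf_from n f (hw n 1) a b c = 0" for f a b c
        unfolding hw_1[OF n1] e nf_from_linear using ne[of 0 1 f] ne[of 1 0 f] n1 r1[of f] by simp
      thus "hw n 1 \<in> J" by (simp add: J_def fun_eq_iff)
    next
      assume n2: "n = 2"
      have "nf_from 2 f (desc 2 1 1) a b c = 0" for f a b c
        unfolding desc_small(2) e nf_from_linear
        using ne[of 0 2 f] ne[of 1 1 f] ne[of 2 0 f] r3[of f] n2 by simp
      thus "desc 2 1 1 \<in> J" using n2 by (simp add: J_def fun_eq_iff del: desc_simps)
    next
      assume n2: "n = 2"
      have "nf_from 2 f (desc 2 1 2) a b c = 0" for f a b c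
        unfolding desc_small(3) e nf_from_linear
        using ne[of 1 2 f] ne[of 2 1 f] r2[of f] n2 by simp
      thus "desc 2 1 2 \<in> J" using n2 by (simp add: J_def fun_eq_iff)
    qed
  qed (auto simp: J_def nf_from_mult nf_from_zero)
  with t show ?thesis by (auto simp: J_def)
qed

subsection \<open>Ordered monomials span\<close>

definition std :: "nat \<Rightarrow> nat \<Rightarrow> nat \<Rightarrow> nat list" where
  "std a b c = replicate a 0 @ replicate b 1 @ replicate c 2"

definition ordered :: "nat \<Rightarrow> tens set" where
  "ordered n = {t. \<forall>w\<in>Poly_Mapping.keys t. set (letters w) \<subseteq> {..n} \<and> (\<exists>a b c. letters w = std a b c)}"

lemma subsp_ordered: "subsp (ordered n)"
  unfolding ordered_def by (rule subsp_words)

lemma ordered_mon: "mon (std a b c) \<in> ordered n \<longleftrightarrow> set (std a b c) \<subseteq> {..n}"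
  by (auto simp: ordered_def)

lemma ordered_induct [consumes 1, case_names zero add scale mon]:
  assumes "t \<in> ordered n"
    and "S 0" "\<And>x y. S x \<Longrightarrow> S y \<Longrightarrow> S (x + y)" "\<And>c x. S x \<Longrightarrow> S (sc c * x)"
    and "\<And>a b c. set (std a b c) \<subseteq> {..n} \<Longrightarrow> S (mon (std a b c))"
  shows "S t"
  by (rule tens_induct_keys[of t "\<lambda>w. set w \<subseteq> {..n} \<and> (\<exists>a b c. w = std a b c)"])
     (use assms in \<open>auto simp: ordered_def\<close>)

definition straight :: "nat \<Rightarrow> tens set" where
  "straight n = {t. \<exists>y\<in>ordered n. t - y \<in> sym_ideal n}"

lemma subsp_straight: "subsp (straight n)"
  unfolding subsp_def
proof (intro conjI ballI allI)
  show "0 \<in> straight n"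
    using subspD(1)[OF subsp_ordered] subspD(1)[OF subsp_sym_ideal] by (auto simp: straight_def intro!: bexI[of _ 0])
  fix x assume "x \<in> straight n"
  then obtain x' where x: "x' \<in> ordered n" "x - x' \<in> sym_ideal n" by (auto simp: straight_def)
  show "sc c * x \<in> straight n" for c
    using subspD(3)[OF subsp_ordered x(1), of c] subspD(3)[OF subsp_sym_ideal x(2), of c]
    by (auto simp: straight_def right_diff_distrib)
  fix y assume "y \<in> straight n"
  then obtain y' where y: "y' \<in> ordered n" "y - y' \<in> sym_ideal n" by (auto simp: straight_def)
  have "(x + y) - (x' + y') \<in> sym_ideal n"
    using subspD(2)[OF subsp_sym_ideal x(2) y(2)] by (simp only: add_diff_add)
  thus "x + y \<in> straight n"
    unfolding straight_def using subspD(2)[OF subsp_ordered x(1) y(1)]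
    by (intro CollectI bexI[of _ "x' + y'"])
qed

lemma ordered_straight: "ordered n \<subseteq> straight n"
proof
  fix x assume "x \<in> ordered n"
  thus "x \<in> straight n"
    using subspD(1)[OF subsp_sym_ideal, of n] by (auto simp: straight_def intro: bexI[of _ x])
qed

lemma sym_ideal_straight: "sym_ideal n \<subseteq> straight n"
  using subspD(1)[OF subsp_ordered] by (auto simp: straight_def intro!: bexI[of _ 0])

lemma straight_cong: "x - y \<in> sym_ideal n \<Longrightarrow> y \<in> straight n \<Longrightarrow> x \<in> straight n"
  using subspD(2)[OF subsp_straight, of "x - y" n y] sym_ideal_straight by auto

lemma straight_mult:
  assumes "i \<le> n" "\<And>a b c. set (std a b c) \<subseteq> {..n} \<Longrightarrow> mon [i] * mon (std a b c) \<in> straight n" "x \<in> straight n"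
  shows "mon [i] * x \<in> straight n"
proof -
  obtain y where y: "y \<in> ordered n" "x - y \<in> sym_ideal n" using assms(3) by (auto simp: straight_def)
  have "mon [i] * y \<in> straight n"
    using y(1)
    by (induction rule: ordered_induct) (simp_all add: assms(2) subspD[OF subsp_straight] distrib_left sc_left_commute)
  moreover have "mon [i] * x - mon [i] * y \<in> sym_ideal n"
    using sym_ideal_mult(1)[OF y(2), of "mon [i]"] assms(1) by (simp add: right_diff_distrib)
  ultimately show ?thesis by (rule straight_cong[rotated])
qed

text \<open>The generators are moved past ordered monomials one at a time: \<open>x\<^sub>0\<close> is already in place, \<open>x\<^sub>1\<close>
  passes the powers of \<open>x\<^sub>0\<close>, and \<open>x\<^sub>2\<close> first passes the powers of \<open>x\<^sub>1\<close> and then those of \<open>x\<^sub>0\<close>, which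
  creates terms that begin with \<open>x\<^sub>1\<close>.\<close>

lemma straighten:
  assumes n: "n \<in> {1, 2}" and t: "t \<in> TT n"
  shows "t \<in> straight n"
proof -
  have n1: "1 \<le> n" using n by auto
  have h: "desc n 1 N \<in> sym_ideal n" for N
    using desc_ext_square[of 1 n N] n1 ext_square_sym_ideal by auto
  have s0: "mon [0] * x \<in> straight n" if "x \<in> straight n" for x
  proof (rule straight_mult[OF _ _ that])
    fix a b c assume "set (std a b c) \<subseteq> {..n}"
    hence "mon (std (Suc a) b c) \<in> ordered n" unfolding ordered_mon by (auto simp: std_def)
    moreover have "mon (std (Suc a) b c) = mon [0] * mon (std a b c)" by (simp add: std_def mon_append[symmetric])
    ultimately show "mon [0] * mon (std a b c) \<in> straight n" using ordered_straight by auto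
  qed simp
  have s1: "mon [1] * x \<in> straight n" if "x \<in> straight n" for x
  proof (rule straight_mult[OF n1 _ that])
    fix a b c assume "set (std a b c) \<subseteq> {..n}"
    thus "mon [1] * mon (std a b c) \<in> straight n"
    proof (induction a)
      case 0
      have "mon (std 0 (Suc b) c) = mon [1] * mon (std 0 b c)" by (simp add: std_def mon_append[symmetric])
      moreover have "mon (std 0 (Suc b) c) \<in> ordered n" using 0 n1 unfolding ordered_mon by (auto simp: std_def)
      ultimately show ?case using ordered_straight by auto
    next
      case (Suc a)
      let ?X = "mon (std a b c)"
      have X: "set (std a b c) \<subseteq> {..n}" using Suc.prems by (auto simp: std_def)
      have "hw n 1 = mon [0] * mon [1] - sc (qq powi int n) * (mon [1] * mon [0])"
        using n1 by (simp add: hw_1[unfolded One_nat_def] ee_def vv_def)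
      hence "(mon [0] * mon [1] - sc (qq powi int n) * (mon [1] * mon [0])) * ?X \<in> sym_ideal n"
        using sym_ideal_mult(2)[OF h[of 0], of ?X] X by simp
      from subspD(3)[OF subsp_sym_ideal this, of "- (qq powi (- int n))"]
      have "mon [1] * (mon [0] * ?X) - sc (qq powi (- int n)) * (mon [0] * (mon [1] * ?X)) \<in> sym_ideal n"
        by (simp add: left_diff_distrib right_diff_distrib sc_assoc mult.assoc sc_minus power_int_minus)
      moreover have "sc (qq powi (- int n)) * (mon [0] * (mon [1] * ?X)) \<in> straight n"
        by (intro subspD(3)[OF subsp_straight] s0 Suc.IH X)
      moreover have "mon (std (Suc a) b c) = mon [0] * ?X" by (simp add: std_def mon_append[symmetric])
      ultimately show ?case using straight_cong by simp
    qed
  qed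
  have s2: "mon [2] * x \<in> straight n" if "x \<in> straight n" "n = 2" for x
  proof (rule straight_mult[OF _ _ that(1)])
    show "2 \<le> n" using that by simp
    fix a b c assume "set (std a b c) \<subseteq> {..n}"
    thus "mon [2] * mon (std a b c) \<in> straight n"
    proof (induction a)
      case 0
      thus ?case
      proof (induction b)
        case 0
        have "mon (std 0 0 (Suc c)) = mon [2] * mon (std 0 0 c)" by (simp add: std_def mon_append[symmetric])
        moreover have "mon (std 0 0 (Suc c)) \<in> ordered n" using that unfolding ordered_mon by (auto simp: std_def)
        ultimately show ?case using ordered_straight by auto
      next
        case (Suc b)
        let ?X = "mon (std 0 b c)"
        have X: "set (std 0 b c) \<subseteq> {..n}" using Suc.prems by (auto simp: std_def)
        have "desc 2 1 2 = sc (qi 2) * (mon [1] * mon [2] - sc (qq^2) * (mon [2] * mon [1]))"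
          unfolding desc_small(3) by (simp add: ee_def vv_def)
        hence "sc (qi 2) * (mon [1] * mon [2] - sc (qq^2) * (mon [2] * mon [1])) * ?X \<in> sym_ideal n"
          using sym_ideal_mult(2)[OF h[of 2], of ?X] X that(2) by simp
        from subspD(3)[OF subsp_sym_ideal this, of "- (1 / (qi 2 * qq^2))"]
        have "mon [2] * (mon [1] * ?X) - sc (1 / qq^2) * (mon [1] * (mon [2] * ?X)) \<in> sym_ideal n"
          by (simp add: left_diff_distrib right_diff_distrib sc_assoc mult.assoc sc_minus)
        moreover have "sc (1 / qq^2) * (mon [1] * (mon [2] * ?X)) \<in> straight n"
          by (intro subspD(3)[OF subsp_straight] s1 Suc.IH X)
        moreover have "mon (std 0 (Suc b) c) = mon [1] * ?X" by (simp add: std_def mon_append[symmetric])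
        ultimately show ?case using straight_cong by simp
      qed
    next
      case (Suc a)
      let ?X = "mon (std a b c)"
      have X: "set (std a b c) \<subseteq> {..n}" using Suc.prems by (auto simp: std_def)
      have "desc 2 1 1 = sc (qi 2) * (mon [0] * mon [2]) + sc (1 - qq^2) * (mon [1] * mon [1]) - sc (qi 2) * (mon [2] * mon [0])"
        unfolding desc_small(2) by (simp add: ee_def vv_def)
      hence "(sc (qi 2) * (mon [0] * mon [2]) + sc (1 - qq^2) * (mon [1] * mon [1]) - sc (qi 2) * (mon [2] * mon [0])) * ?X \<in> sym_ideal n"
        using sym_ideal_mult(2)[OF h[of 1], of ?X] X that(2) by (simp del: desc_simps)
      from subspD(3)[OF subsp_sym_ideal this, of "- (1 / qi 2)"]
      have "mon [2] * (mon [0] * ?X) - (mon [0] * (mon [2] * ?X) + sc ((1 - qq^2) / qi 2) * (mon [1] * (mon [1] * ?X))) \<in> sym_ideal n"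
        by (simp add: left_diff_distrib right_diff_distrib distrib_left distrib_right sc_assoc mult.assoc sc_minus diff_divide_distrib algebra_simps)
      moreover have "mon [0] * (mon [2] * ?X) + sc ((1 - qq^2) / qi 2) * (mon [1] * (mon [1] * ?X)) \<in> straight n"
        using subsetD[OF ordered_straight iffD2[OF ordered_mon X]]
        by (intro subspD(2,3)[OF subsp_straight] s0 s1 Suc.IH X)
      moreover have "mon (std (Suc a) b c) = mon [0] * ?X" by (simp add: std_def mon_append[symmetric])
      ultimately show ?case using straight_cong by simp
    qed
  qed
  have "mon w \<in> straight n" if "set w \<subseteq> {..n}" for w
    using that
  proof (induction w)
    case Nil
    have "mon (std 0 0 0) \<in> ordered n" unfolding ordered_mon by (simp add: std_def)
    thus ?case using ordered_straight by (auto simp: std_def)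
  next
    case (Cons i w)
    hence w: "mon w \<in> straight n" by simp
    consider "i = 0" | "i = 1" | "i = 2" "n = 2" using Cons.prems n by fastforce
    hence "mon [i] * mon w \<in> straight n" by cases (use s0 s1 s2 w in blast)+
    thus ?case by (simp add: mon_append[symmetric])
  qed
  with t show ?thesis
    by (induction rule: TT_induct) (simp_all add: subspD[OF subsp_straight])
qed

definition unit_coeffs :: "nat \<Rightarrow> nat \<Rightarrow> nat \<Rightarrow> coeffs" where
  "unit_coeffs A B C = (\<lambda>a b c. if a = A \<and> b = B \<and> c = C then 1 else 0)"

definition nf :: "nat \<Rightarrow> tens \<Rightarrow> coeffs" where
  "nf n t = nf_from n (unit_coeffs 0 0 0) t"

lemmas nf_linear = nf_from_linear[of n "unit_coeffs 0 0 0" for n, folded nf_def]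

lemma nf_std: "nf n (mon (std A B C)) = unit_coeffs A B C"
proof -
  have "lmul n 2 (unit_coeffs 0 0 c) = unit_coeffs 0 0 (Suc c)" for c
    by (auto simp: lmul_def unit_coeffs_def fun_eq_iff)
  hence 1: "foldr (lmul n) (replicate C 2) (unit_coeffs 0 0 0) = unit_coeffs 0 0 C" by (induction C) simp_all
  have "lmul n 1 (unit_coeffs 0 b C) = unit_coeffs 0 (Suc b) C" for b
    by (auto simp: lmul_def unit_coeffs_def fun_eq_iff)
  hence 2: "foldr (lmul n) (replicate B 1) (unit_coeffs 0 0 C) = unit_coeffs 0 B C" by (induction B) simp_all
  have "lmul n 0 (unit_coeffs a B C) = unit_coeffs (Suc a) B C" for a
    by (auto simp: lmul_def unit_coeffs_def fun_eq_iff)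
  hence 3: "foldr (lmul n) (replicate A 0) (unit_coeffs 0 B C) = unit_coeffs A B C" by (induction A) simp_all
  from 1 2 3 show ?thesis by (simp add: nf_def std_def)
qed

lemma std_inj: "std a b c = std a' b' c' \<longleftrightarrow> a = a' \<and> b = b' \<and> c = c'"
proof
  assume e: "std a b c = std a' b' c'"
  have "length (filter (\<lambda>x. x = i) (std a b c)) = length (filter (\<lambda>x. x = i) (std a' b' c'))" for i
    using e by simp
  from this[of 0] this[of 1] this[of 2] show "a = a' \<and> b = b' \<and> c = c'"
    by (simp add: std_def filter_replicate)
qed simp

lemma nf_ordered: "y \<in> ordered n \<Longrightarrow> nf n y a b c = Poly_Mapping.lookup y (TWord (std a b c))"
  by (induction rule: ordered_induct)
     (auto simp: nf_linear lookup_add nf_std lookup_mon std_inj unit_coeffs_def)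

text \<open>A tensor can be straightened to an ordered one modulo the ideal, and on ordered tensors the
  normal form just reads off the coefficients. Hence the ordered monomials are a basis.\<close>

lemma nf_eq_0_iff:
  assumes n: "n \<in> {1, 2}" and t: "t \<in> TT n"
  shows "(\<forall>a b c. nf n t a b c = 0) \<longleftrightarrow> t \<in> sym_ideal n"
proof
  assume "t \<in> sym_ideal n"
  thus "\<forall>a b c. nf n t a b c = 0" using nf_from_sym_ideal[OF n] by (simp add: nf_def)
next
  assume z: "\<forall>a b c. nf n t a b c = 0"
  obtain y where y: "y \<in> ordered n" "t - y \<in> sym_ideal n"
    using straighten[OF n t] by (auto simp: straight_def)
  have "nf n y a b c = Poly_Mapping.lookup y (TWord (std a b c))" for a b c
    by (rule nf_ordered[OF y(1)])
  moreover have "nf n y a b c = 0" for a b c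
  proof -
    have "nf n (t - y) a b c = 0" using nf_from_sym_ideal[OF n y(2)] by (simp add: nf_def)
    with z show ?thesis by (simp add: nf_linear)
  qed
  ultimately have l0: "Poly_Mapping.lookup y (TWord (std a b c)) = 0" for a b c by simp
  have "y = 0"
  proof (rule ccontr)
    assume "y \<noteq> 0"
    then obtain w where w: "w \<in> Poly_Mapping.keys y" using keys_eq_empty[of y] by blast
    with y(1) obtain a b c where "letters w = std a b c" by (auto simp: ordered_def)
    with w l0[of a b c] show False by (cases w) (simp add: in_keys_iff)
  qed
  with y(2) show "t \<in> sym_ideal n" by simp
qed

text \<open>Coefficients of an element of degree \<open>d\<close> and of weight \<open>nd - 2s\<close>.\<close>

definition supported :: "nat \<Rightarrow> nat \<Rightarrow> coeffs \<Rightarrow> bool" where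
  "supported d s f \<longleftrightarrow> (\<forall>a b c. f a b c \<noteq> 0 \<longrightarrow> a + b + c = d \<and> b + 2 * c = s)"

lemma supported_lmul:
  assumes f: "supported d s f" and i: "i \<le> 2"
  shows "supported (Suc d) (i + s) (lmul n i f)"
  unfolding supported_def
proof (intro allI impI)
  fix a b c assume nz: "lmul n i f a b c \<noteq> 0"
  have z: "f a b c \<noteq> 0 \<Longrightarrow> a + b + c = d \<and> b + 2 * c = s" for a b c
    using f by (auto simp: supported_def)
  consider "i = 0" | "i = 1" | "i = 2" using i by linarith
  thus "a + b + c = Suc d \<and> b + 2 * c = i + s"
  proof cases
    case 1
    with nz have "a \<noteq> 0" "f (a - 1) b c \<noteq> 0" by (auto simp: lmul_def split: if_splits)
    with z[of "a - 1" b c] 1 show ?thesis by (cases a) auto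
  next
    case 2
    with nz have "b \<noteq> 0" "f a (b - 1) c \<noteq> 0" by (auto simp: lmul_def split: if_splits)
    with z[of a "b - 1" c] 2 show ?thesis by (cases b) auto
  next
    case 3
    with nz have "(c \<noteq> 0 \<and> f a b (c - 1) \<noteq> 0) \<or> (b \<ge> 2 \<and> f (Suc a) (b - 2) c \<noteq> 0)"
      by (auto simp: lmul_def split: if_splits)
    with z[of a b "c - 1"] z[of "Suc a" "b - 2" c] 3 show ?thesis by auto
  qed
qed

lemma supported_nf:
  assumes "t \<in> tw n d s" "n \<le> 2"
  shows "supported d s (nf n t)"
proof -
  have w: "supported (length w) (sum_list w) (foldr (lmul n) w (unit_coeffs 0 0 0))" if "set w \<subseteq> {..2}" for w
    using that by (induction w) (auto simp: supported_lmul, auto simp: supported_def unit_coeffs_def)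
  have "nf n t a b c = 0" if "\<not> (a + b + c = d \<and> b + 2 * c = s)" for a b c
  proof -
    have "nf n t a b c = wsum (\<lambda>w. 0) t"
      unfolding nf_def nf_from_def
    proof (rule wsum_cong)
      fix u assume "u \<in> Poly_Mapping.keys t"
      hence "length (letters u) = d" "set (letters u) \<subseteq> {..2}" "sum_list (letters u) = s"
        using assms subset_trans[of _ "{..n}" "{..2}"] by (auto simp: tw_def simp del: subset_iff)
      with w[of "letters u"] that show "foldr (lmul n) (letters u) (unit_coeffs 0 0 0) a b c = 0"
        by (auto simp: supported_def)
    qed
    thus ?thesis by simp
  qed
  thus ?thesis unfolding supported_def by blast
qed

subsection \<open>The action of E on normal forms\<close>

text \<open>In terms of ordered monomials \<open>E(x\<^sub>0\<^sup>a x\<^sub>1\<^sup>b x\<^sub>2\<^sup>c) = \<alpha>\<^bsub>a,b\<^esub> x\<^sub>0\<^bsup>a+1\<^esup> x\<^sub>1\<^bsup>b-1\<^esup> x\<^sub>2\<^sup>c + \<beta>\<^bsub>a,c\<^esub> x\<^sub>0\<^sup>a x\<^sub>1\<^bsup>b+1\<^esup> x\<^sub>2\<^bsup>c-1\<^esup>\<close>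
  with the following scalars; \<open>Enf\<close> is the effect on coefficients.\<close>

definition Ealpha :: "nat \<Rightarrow> nat \<Rightarrow> nat \<Rightarrow> kq" where
  "Ealpha n a b = (qq ^ n) ^ a * qi (int n) * geo (qq powi (-2)) b"

definition Ebeta :: "nat \<Rightarrow> nat \<Rightarrow> nat \<Rightarrow> kq" where
  "Ebeta n a c = (qq ^ n) ^ a * qi (int n - 1) * geo (qq powi (-4)) c"

definition Enf :: "nat \<Rightarrow> coeffs \<Rightarrow> coeffs" where
  "Enf n f a b c = (if a = 0 then 0 else Ealpha n (a - 1) (b + 1) * f (a - 1) (b + 1) c)
     + (if b = 0 then 0 else Ebeta n a (c + 1) * f a (b - 1) (c + 1))"

lemma geo_Suc_left: "geo x (Suc n) = 1 + x * geo x n"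
proof (induction n)
  case (Suc n)
  have "geo x (Suc (Suc n)) = 1 + x * geo x n + x ^ Suc n" by (simp only: geo_Suc[of x "Suc n"] Suc)
  also have "\<dots> = 1 + x * (geo x n + x ^ n)" by (simp add: distrib_left)
  finally show ?case by (simp only: geo_Suc[of x n])
qed (simp add: geo_Suc)

lemma geo_mult: "(1 - x) * geo x n = 1 - x ^ n"
  using power_diff_1_eq[of x n] by (simp add: geo_def algebra_simps)

lemma Enf_lmul_0:
  assumes "n \<in> {1, 2}"
  shows "Enf n (lmul n 0 f) a b c = qq ^ n * lmul n 0 (Enf n f) a b c"
proof -
  have b: "Ebeta n (Suc a) c = qq ^ n * Ebeta n a c" "Ealpha n (Suc a) c = qq ^ n * Ealpha n a c" for a c
    by (simp_all add: Ebeta_def Ealpha_def)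
  show ?thesis
  proof (cases a)
    case (Suc a')
    show ?thesis
      by (cases a') (simp_all add: Suc Enf_def lmul_def b distrib_left mult.assoc)
  qed (simp add: Enf_def lmul_def)
qed

lemma Enf_lmul_1:
  assumes "n \<in> {1, 2}"
  shows "Enf n (lmul n 1 f) a b c = qi (int n) * lmul n 0 f a b c + qq powi (int n - 2) * lmul n 1 (Enf n f) a b c"
proof -
  define p where "p = qq powi (- int n)"
  have p: "qq ^ n * p = 1" by (simp add: p_def power_int_minus)
  hence pp: "(qq ^ n) ^ a * p ^ a = 1" for a by (simp add: power_mult_distrib[symmetric])
  have L1: "lmul n 1 f a b c = (if b = 0 then 0 else p ^ a * f a (b - 1) c)" for f a b c
    by (simp add: lmul_def p_def)
  have L0: "lmul n 0 f a b c = (if a = 0 then 0 else f (a - 1) b c)" for f a b c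
    by (simp add: lmul_def)
  have beta: "qq powi (int n - 2) * (p ^ a * (Ebeta n a c * x)) = Ebeta n a c * (p ^ a * x)" for a c x
    using assms by (auto simp: Ebeta_def)
  have Q: "qq powi (int n - 2) * p = qq powi (-2)" by (simp add: p_def qq_powi_mult)
  have alpha: "Ealpha n a (Suc b) * (p ^ a * x) = qi (int n) * x + qq powi (int n - 2) * (p ^ Suc a * (Ealpha n a b * x))"
    for a b x
  proof -
    have "Ealpha n a (Suc b) * (p ^ a * x) = ((qq ^ n) ^ a * p ^ a) * (qi (int n) * geo (qq powi (-2)) (Suc b) * x)"
      by (simp only: Ealpha_def mult_ac)
    also have "\<dots> = qi (int n) * x + qq powi (-2) * (qi (int n) * geo (qq powi (-2)) b * x)"
      unfolding pp geo_Suc_left by (simp add: algebra_simps)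
    also have "qq powi (-2) * (qi (int n) * geo (qq powi (-2)) b * x)
       = (qq powi (int n - 2) * p) * ((qq ^ n) ^ a * p ^ a) * (qi (int n) * geo (qq powi (-2)) b * x)"
      unfolding pp Q by simp
    also have "\<dots> = qq powi (int n - 2) * (p ^ Suc a * (Ealpha n a b * x))"
      by (simp only: Ealpha_def mult_ac power_Suc)
    finally show ?thesis .
  qed
  have a0: "Ealpha n a 0 = 0" for a by (simp add: Ealpha_def)
  consider "b = 0" | b' where "b = Suc b'" by (cases b) auto
  thus ?thesis
  proof cases
    case 1
    thus ?thesis
      by (cases a) (use alpha[of _ 0] in \<open>simp_all add: Enf_def L0 L1[unfolded One_nat_def] a0\<close>)
  next
    case 2
    show ?thesis
      by (cases a; cases b') (simp_all add: 2 Enf_def L0 L1[unfolded One_nat_def] alpha beta beta[of 0, simplified] distrib_left del: power_Suc)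
  qed
qed

lemma Enf_lmul_2: "Enf 2 (lmul 2 2 f) a b c = lmul 2 1 f a b c + qq powi (-2) * lmul 2 2 (Enf 2 f) a b c"
proof -
  define Q R where "Q = qq powi (-2)" and "R = qq powi (-4)"
  have QR: "R = Q^2" "qq^2 * Q = 1"
    unfolding Q_def R_def by (subst power2_eq_square, subst qq_powi_mult, simp) (simp add: power_int_minus)
  have L1: "lmul 2 1 f a b c = (if b = 0 then 0 else Q ^ a * f a (b - 1) c)"
    and L2: "lmul 2 2 f a b c = (if c = 0 then 0 else Q ^ b * f a b (c - 1))
        + (if b < 2 then 0 else gam (Suc a) * f (Suc a) (b - 2) c)" for f a b c
    by (simp_all add: lmul_def Q_def)
  have al: "Ealpha 2 a b = (qq^2) ^ a * qi 2 * geo Q b" and be: "Ebeta 2 a c = (qq^2) ^ a * geo R c"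
    and ga: "gam a = (1 - qq^2) / qi 2 * geo R a" for a b c
    by (simp_all add: Ealpha_def Ebeta_def gam_def Q_def R_def)
  \<comment> \<open>The comparison of the coefficients with which \<open>x\<^sub>0\<^sup>a x\<^sub>1\<^sup>b x\<^sub>2\<^sup>c\<close> contributes to \<open>x\<^sub>0\<^sup>a x\<^sub>1\<^bsup>b+1\<^esup> x\<^sub>2\<^sup>c\<close>;
    the geometric sums are eliminated by means of \<open>eG\<close> and \<open>eg\<close>.\<close>
  have main: "(if a = 0 then 0 else Ealpha 2 (a - 1) (Suc (Suc b)) * gam a) + Ebeta 2 a (Suc c) * Q ^ b
      = Q ^ a + Q * (Q ^ Suc b * Ebeta 2 a c + gam (Suc a) * Ealpha 2 a b)" for a b c
  proof -
    define X Y Z G g where "X = (qq^2) ^ a" and "Y = Q ^ a" and "Z = Q ^ b" and "G = geo Q b" and "g = geo R a"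
    have XY: "X * Y = 1" by (simp add: X_def Y_def power_mult_distrib[symmetric] QR)
    have RY: "R ^ a = Y^2" by (simp add: QR Y_def flip: power_mult) (simp add: mult.commute)
    have eG: "(1 - Q) * G = 1 - Z" unfolding G_def Z_def by (rule geo_mult)
    have eg: "(1 - R) * g = 1 - Y^2" unfolding g_def RY[symmetric] by (rule geo_mult)
    have 1: "(if a = 0 then 0 else Ealpha 2 (a - 1) (Suc (Suc b)) * gam a) = Q * X * (1 - qq^2) * g * (G + Z + Z * Q)"
    proof (cases a)
      case (Suc a')
      have "X = qq^2 * (qq^2) ^ a'" by (simp add: X_def Suc)
      hence "Q * X = (qq^2) ^ a'" using QR(2) by (simp add: mult.assoc[symmetric] mult.commute[of Q])
      thus ?thesis by (simp add: Suc al ga geo_Suc G_def Z_def g_def)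
    qed (simp add: g_def)
    have 2: "gam (Suc a) * Ealpha 2 a b = (1 - qq^2) * (g + Y^2) * X * G"
      by (simp add: al ga geo_Suc RY g_def X_def G_def)
    have 3: "Ebeta 2 a (Suc c) = X * (1 + R * geo R c)" by (simp add: be geo_Suc_left X_def)
    have Q1: "Q * (1 - qq^2) = Q - 1" using QR(2) by (simp add: algebra_simps)
    have "Q * X * (1 - qq^2) * g * (G + Z + Z * Q) + X * (1 + R * geo R c) * Z
       = (Q * (1 - qq^2)) * X * g * (G + Z + Z * Q) + X * Z + X * R * geo R c * Z"
      by (simp add: algebra_simps)
    also have "\<dots> = (Q - 1) * X * g * G + X * Z * (1 - (1 - R) * g) + X * R * geo R c * Z"
      unfolding Q1 QR(1) by (simp add: algebra_simps power2_eq_square)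
    also have "\<dots> = (Q - 1) * X * g * G + Y * Z * (X * Y) + X * R * geo R c * Z"
      unfolding eg by (simp add: algebra_simps power2_eq_square)
    also have "\<dots> = (Q - 1) * X * g * G + Y * (1 - (1 - Q) * G) + X * R * geo R c * Z"
      unfolding XY eG by simp
    also have "\<dots> = Y + (Q - 1) * X * g * G + (Q - 1) * (X * Y) * Y * G + X * Q^2 * geo R c * Z"
      unfolding XY QR(1) by (simp add: algebra_simps)
    also have "\<dots> = Y + (Q * (1 - qq^2)) * (g + Y^2) * X * G + X * Q^2 * geo R c * Z"
      unfolding Q1 by (simp add: algebra_simps power2_eq_square)
    also have "\<dots> = Y + Q * (Q * Z * (X * geo R c) + (1 - qq^2) * (g + Y^2) * X * G)"
      by (simp add: algebra_simps power2_eq_square)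
    finally show ?thesis
      unfolding 1 2 3 Y_def[symmetric] Z_def[symmetric] power_Suc be X_def[symmetric]
      by (simp add: geo_Suc_left)
  qed
  have gb: "gam (Suc a) * Ebeta 2 a c = Q * (gam (Suc a) * Ebeta 2 (Suc a) c)" for a c
    using QR(2) by (simp add: be mult_ac)
  have "Enf 2 (lmul 2 2 f) a b c = lmul 2 1 f a b c + Q * lmul 2 2 (Enf 2 f) a b c"
  proof (cases b)
    case 0
    thus ?thesis by (cases a; cases c) (simp_all add: Enf_def L1[unfolded One_nat_def] L2)
  next
    case (Suc b0)
    define x U V W where "x = f a b0 c"
      and "U = (if a = 0 \<or> c = 0 then 0 else Ealpha 2 (a - 1) (Suc b) * Q ^ Suc b * f (a - 1) (Suc b) (c - 1))"
      and "V = (if a = 0 then 0 else Ealpha 2 (a - 1) (Suc (Suc b0)) * gam a) + Ebeta 2 a (Suc c) * Q ^ b0"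
      and "W = (if b0 < 2 then 0 else gam (Suc a) * Ebeta 2 a (Suc c) * f (Suc a) (b0 - 2) (Suc c))"
    have lhs: "Enf 2 (lmul 2 2 f) a b c = U + V * x + W"
      by (cases a; cases c) (simp_all add: Suc Enf_def L2 U_def V_def W_def x_def algebra_simps)
    have z: "Ebeta 2 a 0 = 0" "Ealpha 2 a 0 = 0" for a by (simp_all add: al be)
    have W: "W = Q * (if b0 < 2 then 0 else gam (Suc a) * Ebeta 2 (Suc a) (Suc c) * f (Suc a) (b0 - 2) (Suc c))"
      by (simp add: W_def gb mult.assoc)
    have b2: "Suc b0 < 2 \<longleftrightarrow> b0 = 0" by auto
    have E1: "Enf 2 f a b (c - 1) = (if a = 0 then 0 else Ealpha 2 (a - 1) (Suc b) * f (a - 1) (Suc b) (c - 1)) + Ebeta 2 a c * x"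
      if "c \<noteq> 0" using that by (simp add: Enf_def Suc x_def)
    have E2: "Enf 2 f (Suc a) (b - 2) c = Ealpha 2 a b0 * x + (if b0 < 2 then 0 else Ebeta 2 (Suc a) (Suc c) * f (Suc a) (b0 - 2) (Suc c))"
      if "b0 \<noteq> 0"
    proof -
      have "b - 2 = b0 - 1" "b - 2 = 0 \<longleftrightarrow> b0 < 2" "b - 2 + 1 = b0" "b - 2 - 1 = b0 - 2"
        using that Suc by auto
      thus ?thesis by (simp add: Enf_def x_def)
    qed
    have l22: "lmul 2 2 (Enf 2 f) a b c = (if c = 0 then 0 else Q ^ b * Enf 2 f a b (c - 1))
      + (if b0 = 0 then 0 else gam (Suc a) * Enf 2 f (Suc a) (b - 2) c)"
      unfolding L2[of "Enf 2 f"] using b2 Suc by simp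
    have l1: "lmul 2 1 f a b c = Q ^ a * x" unfolding L1 x_def by (simp add: Suc)
    define w where "w = (if b0 < 2 then 0 else Ebeta 2 (Suc a) (Suc c) * f (Suc a) (b0 - 2) (Suc c))"
    have W': "W = Q * (gam (Suc a) * w)" by (simp add: W w_def mult.assoc)
    have w0: "w = 0" if "b0 = 0" using that by (simp add: w_def)
    have T2: "(if b0 = 0 then 0 else gam (Suc a) * Enf 2 f (Suc a) (b - 2) c) = gam (Suc a) * (Ealpha 2 a b0 * x + w)"
    proof (cases "b0 = 0")
      case True
      thus ?thesis by (simp add: w0 z)
    next
      case False
      thus ?thesis using E2[OF False] by (simp only: w_def if_False)
    qed
    have T1: "Q * (if c = 0 then 0 else Q ^ b * Enf 2 f a b (c - 1)) = U + Q * (Q ^ b * (Ebeta 2 a c * x))"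
    proof (cases "c = 0")
      case True
      thus ?thesis by (simp add: U_def z)
    next
      case False
      have "U = Q * (Q ^ b * (if a = 0 then 0 else Ealpha 2 (a - 1) (Suc b) * f (a - 1) (Suc b) (c - 1)))"
        using False by (simp add: U_def)
      thus ?thesis using False E1[OF False] by (simp only: if_False distrib_left)
    qed
    have rhs: "lmul 2 1 f a b c + Q * lmul 2 2 (Enf 2 f) a b c
        = U + (Q ^ a + Q * (Q ^ Suc b0 * Ebeta 2 a c + gam (Suc a) * Ealpha 2 a b0)) * x + W"
      unfolding l1 l22 T2 distrib_left[of Q] T1 W' by (simp add: Suc algebra_simps)
    show ?thesis
      unfolding lhs rhs V_def main by simp
  qed
  thus ?thesis by (simp only: Q_def)
qed

text \<open>By the coproduct of \<open>E\<close>, the commutation of \<open>Enf\<close> with the three multiplication operators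
  suffices.\<close>

lemma nf_act_E:
  assumes n: "n \<in> {1, 2}" and t: "t \<in> TT n"
  shows "nf n (act n UE t) a b c = Enf n (nf n t) a b c"
  using t
proof (induction arbitrary: a b c rule: TT_induct)
  case (mon w)
  thus ?case
  proof (induction w arbitrary: a b c)
    case Nil
    have "act n UE 1 = 0" using act_sc[of n UE 1] by simp
    thus ?case by (simp add: nf_linear) (simp add: nf_def Enf_def nf_from_mon[of _ _ "[]", simplified] unit_coeffs_def)
  next
    case (Cons i w)
    let ?f = "nf n (mon w)"
    have IH: "nf_from n (unit_coeffs 0 0 0) (act n UE (mon w)) = Enf n ?f"
      using Cons by (simp add: fun_eq_iff nf_def)
    have i: "i \<le> n" using Cons.prems by simp
    have e: "act n UE (mon [i]) = (if i = 0 then 0 else sc (qi (int n + 1 - int i)) * mon [i - 1])"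
      "act n UK (mon [i]) = sc (qq powi (int n - 2 * int i)) * mon [i]"
      using i by (simp_all add: act_mon qint_qi of_nat_diff add.commute)
    have "nf n (act n UE (mon (i # w))) a b c
       = (if i = 0 then 0 else qi (int n + 1 - int i) * lmul n (i - 1) ?f a b c) + qq powi (int n - 2 * int i) * lmul n i (Enf n ?f) a b c"
      unfolding mon_Cons[of i w] act_E_mult e
      by (simp add: nf_linear mult.assoc) (simp add: nf_def nf_from_mult IH)
    also have "\<dots> = Enf n (lmul n i ?f) a b c"
    proof -
      consider "i = 0" | "i = 1" | "i = 2" "n = 2" using i n by fastforce
      thus ?thesis
      proof cases
        case 1
        thus ?thesis using Enf_lmul_0[OF n] by simp
      next
        case 2
        thus ?thesis using Enf_lmul_1[OF n, unfolded One_nat_def] by simp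
      next
        case 3
        thus ?thesis using Enf_lmul_2[of ?f a b c] by simp
      qed
    qed
    also have "lmul n i ?f = nf n (mon (i # w))" by (simp add: nf_def)
    finally show ?case .
  qed
next
  case zero
  show ?case by (simp add: act_simps nf_linear Enf_def)
next
  case (add x y)
  thus ?case by (simp add: act_simps nf_linear Enf_def distrib_left)
next
  case (scale d x)
  thus ?case by (simp add: act_simps nf_linear Enf_def algebra_simps)
qed

text \<open>There are no highest weight vectors of weight \<open>nd - 2s\<close> with \<open>s\<close> odd: a monomial of such a
  weight contains \<open>x\<^sub>1\<close> to an odd, hence positive, power \<open>b\<close>, and the coefficient with which \<open>E\<close> replaces
  one \<open>x\<^sub>1\<close> by \<open>x\<^sub>0\<close> is nonzero. Induction on \<open>b\<close> removes the other term of \<open>E\<close>.\<close>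

lemma E_injective_odd:
  assumes n: "n \<in> {1, 2}" and t: "t \<in> tw n d s" "odd s" and E: "act n UE t \<in> sym_ideal n"
  shows "t \<in> sym_ideal n"
proof -
  have T: "t \<in> TT n" using t tw_tdeg tdeg_TT by blast
  have sup: "supported d s (nf n t)" using supported_nf[OF t(1)] n by auto
  have E0: "Enf n (nf n t) a b c = 0" for a b c
    using nf_act_E[OF n T, of a b c] nf_from_sym_ideal[OF n E] by (simp add: nf_def)
  have "nf n t a b c = 0" for a b c
  proof (induction b arbitrary: a c rule: less_induct)
    case (less b)
    show ?case
    proof (cases "odd b")
      case False
      thus ?thesis using sup t(2) unfolding supported_def by (metis even_add even_mult_iff dvd_refl)
    next
      case True
      then obtain b' where b': "b = Suc b'" by (cases b) auto
      have "b' \<noteq> 0 \<Longrightarrow> nf n t (Suc a) (b' - 1) (c + 1) = 0"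
        using less.IH[of "b' - 1"] b' by auto
      hence "Ealpha n a b * nf n t a b c = 0"
        using E0[of "Suc a" b' c] b' by (cases "b' = 0") (simp_all add: Enf_def)
      moreover have "Ealpha n a b \<noteq> 0"
        using geo_neq_0[of "-2" b] b' n by (auto simp: Ealpha_def)
      ultimately show ?thesis by simp
    qed
  qed
  thus ?thesis using nf_eq_0_iff[OF n T] by blast
qed

section \<open>Embeddings of the module into a quantum Veronese algebra\<close>

subsection \<open>Complements on the action\<close>

lemma letter_act_TT: "i \<le> m \<Longrightarrow> letter_act m g i \<in> tdeg m 1"
  by (cases g) (auto intro!: subspD[OF subsp_tdeg])

lemma word_act_tdeg: "set w \<subseteq> {..m} \<Longrightarrow> word_act m g w \<in> tdeg m (length w)"
proof (induction w arbitrary: g)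
  case Nil
  have "sc c * mon [] \<in> tdeg m 0" for c
    by (rule subspD(3)[OF subsp_tdeg]) (simp only: mon_tdeg, simp)
  thus ?case by simp
next
  case (Cons i w)
  have "letter_act m g1 i * word_act m g2 w \<in> tdeg m (1 + length w)" for g1 g2
    using Cons by (intro tdeg_mult letter_act_TT) auto
  thus ?case by (cases g) (simp_all del: letter_act.simps add: subspD(2)[OF subsp_tdeg])
qed

lemma act_tdeg: "t \<in> tdeg m d \<Longrightarrow> act m g t \<in> tdeg m d"
  by (induction rule: tdeg_induct)
     (auto simp: act_simps subspD[OF subsp_tdeg] act_mon word_act_tdeg)

lemma act_TT: "t \<in> TT m \<Longrightarrow> act m g t \<in> TT m"
proof (induction rule: TT_induct)
  case (mon w)
  thus ?case using subsetD[OF tdeg_TT word_act_tdeg] by (simp add: act_mon)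
qed (simp_all add: act_simps subspD[OF subsp_TT])

lemma word_act_Kinv: "set w \<subseteq> {..m} \<Longrightarrow> word_act m UKinv w = sc (qq powi (2 * int (sum_list w) - int m * int (length w))) * mon w"
proof (induction w)
  case (Cons i w)
  have "word_act m UKinv (i # w) = sc (qq powi (2 * int i - int m)) * (mon [i] * (sc (qq powi (2 * int (sum_list w) - int m * int (length w))) * mon w))"
    using Cons by (simp add: mult.assoc)
  also have "\<dots> = sc (qq powi (2 * int i - int m) * qq powi (2 * int (sum_list w) - int m * int (length w))) * mon (i # w)"
    by (simp only: sc_left_commute[of "mon [i]"] sc_assoc mon_Cons[of i w])
  finally show ?case by (simp add: qq_powi_mult algebra_simps)
qed simp

lemma word_act_K: "set w \<subseteq> {..m} \<Longrightarrow> word_act m UK w = sc (qq powi (int m * int (length w) - 2 * int (sum_list w))) * mon w"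
proof (induction w)
  case (Cons i w)
  have "word_act m UK (i # w) = sc (qq powi (int m - 2 * int i)) * (mon [i] * (sc (qq powi (int m * int (length w) - 2 * int (sum_list w))) * mon w))"
    using Cons by (simp add: mult.assoc)
  also have "\<dots> = sc (qq powi (int m - 2 * int i) * qq powi (int m * int (length w) - 2 * int (sum_list w))) * mon (i # w)"
    by (simp only: sc_left_commute[of "mon [i]"] sc_assoc mon_Cons[of i w])
  finally show ?case by (simp add: qq_powi_mult algebra_simps)
qed simp

lemma word_act_F_tw: "set w \<subseteq> {..m} \<Longrightarrow> word_act m UF w \<in> tw m (length w) (Suc (sum_list w))"
proof (induction w)
  case Nil
  show ?case by (simp add: subspD[OF subsp_tw])
next
  case (Cons i w)
  have "letter_act m UF i * word_act m UKinv w \<in> tw m (1 + length w) (Suc i + sum_list w)"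
    using Cons by (intro tw_mult) (auto simp: word_act_Kinv intro!: subspD[OF subsp_tw])
  moreover have "mon [i] * word_act m UF w \<in> tw m (1 + length w) (i + Suc (sum_list w))"
    using Cons by (intro tw_mult) auto
  ultimately show ?case by (simp del: letter_act.simps(3) add: subspD(2)[OF subsp_tw])
qed

lemma act_F_tw: "t \<in> tw m d s \<Longrightarrow> act m UF t \<in> tw m d (Suc s)"
  by (induction rule: tw_induct)
     (auto simp: act_simps subspD[OF subsp_tw] act_mon word_act_F_tw)

lemma sym_ideal_act:
  assumes "t \<in> sym_ideal m"
  shows "act m g t \<in> sym_ideal m"
proof -
  have "sym_ideal m \<subseteq> {t. \<forall>g. act m g t \<in> sym_ideal m}"
  proof (rule sym_ideal_minimal)
    show "subsp {t. \<forall>g. act m g t \<in> sym_ideal m}"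
      by (auto simp: subsp_def act_simps subspD[OF subsp_sym_ideal])
    show "ext_square m \<subseteq> {t. \<forall>g. act m g t \<in> sym_ideal m}"
      using ext_square_act ext_square_sym_ideal by blast
    fix x t assume x: "x \<in> {t. \<forall>g. act m g t \<in> sym_ideal m}" and t: "t \<in> TT m"
    have "act m g1 t * act m g2 x \<in> sym_ideal m" "act m g1 x * act m g2 t \<in> sym_ideal m" for g1 g2
      using x act_TT[OF t] sym_ideal_mult by auto
    hence "act m g (t * x) \<in> sym_ideal m" "act m g (x * t) \<in> sym_ideal m" for g
      by (cases g; simp add: act_mult del: act_U1; intro subspD(2)[OF subsp_sym_ideal]; simp del: act_U1)+
    thus "t * x \<in> {t. \<forall>g. act m g t \<in> sym_ideal m} \<and> x * t \<in> {t. \<forall>g. act m g t \<in> sym_ideal m}"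
      by blast
  qed
  with assms show ?thesis by blast
qed

lemma nf_act_K:
  assumes "t \<in> tdeg n d" "n \<le> 2"
  shows "nf n (act n UK t) a b c = qq powi (int n * int d - 2 * int (b + 2 * c)) * nf n t a b c"
  using assms(1)
proof (induction rule: tdeg_induct)
  case (mon w)
  have "supported d (sum_list w) (nf n (mon w))"
    by (rule supported_nf) (use mon assms(2) in auto)
  hence "nf n (mon w) a b c \<noteq> 0 \<Longrightarrow> b + 2 * c = sum_list w" by (auto simp: supported_def)
  moreover have "nf n (act n UK (mon w)) a b c = qq powi (int n * int d - 2 * int (sum_list w)) * nf n (mon w) a b c"
    using mon by (simp add: act_mon word_act_K nf_linear)
  ultimately show ?case by (cases "nf n (mon w) a b c = 0") auto
qed (simp_all only: act_simps nf_linear distrib_left mult_zero_right mult.left_commute)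

text \<open>Normal forms are graded by the weight, so an eigenvector of \<open>K\<close> only involves ordered
  monomials of its own weight. This is used for the two extremal weights, where there is one such
  monomial.\<close>

lemma weight_class:
  assumes n: "n \<in> {1, 2}" and t: "t \<in> tdeg n d"
    and K: "act n UK t - sc (qq powi (int n * int d - 2 * int s)) * t \<in> sym_ideal n"
    and std: "\<And>a b c. a + b + c = d \<Longrightarrow> b + 2 * c = s \<Longrightarrow> set (std a b c) \<subseteq> {..n} \<Longrightarrow> std a b c = u"
  shows "\<exists>x. t - sc x * mon u \<in> sym_ideal n"
proof -
  have n2: "n \<le> 2" using n by auto
  have T: "t \<in> TT n" using t tdeg_TT by blast
  obtain y where y: "y \<in> ordered n" "t - y \<in> sym_ideal n"
    using straighten[OF n T] by (auto simp: straight_def)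
  have ny: "nf n y a b c = Poly_Mapping.lookup y (TWord (std a b c))" for a b c
    by (rule nf_ordered[OF y(1)])
  have tyn: "nf n t a b c = nf n y a b c" for a b c
    using nf_from_sym_ideal[OF n y(2)] nf_linear(2)[of n t y a b c] by (simp add: nf_def)
  have deg: "nf n t a b c \<noteq> 0 \<Longrightarrow> a + b + c = d" for a b c
    using t
  proof (induction rule: tdeg_induct)
    case (mon w)
    have "supported d (sum_list w) (nf n (mon w))"
      by (rule supported_nf) (use mon n2 in auto)
    thus ?case using mon by (auto simp: supported_def)
  next
    case (add x y)
    thus ?case by (cases "nf n x a b c = 0") (auto simp: nf_linear)
  qed (auto simp: nf_linear)
  have wt: "b + 2 * c = s" if "nf n t a b c \<noteq> 0" for a b c
  proof -
    have "nf n (act n UK t) a b c = qq powi (int n * int d - 2 * int s) * nf n t a b c"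
      using nf_from_sym_ideal[OF n K] nf_linear(2,4)[of n] by (simp add: nf_def fun_eq_iff nf_from_linear)
    with nf_act_K[OF t n2, of a b c] that have "qq powi (int n * int d - 2 * int (b + 2 * c)) = qq powi (int n * int d - 2 * int s)"
      by simp
    thus ?thesis by (simp del: of_nat_add of_nat_mult)
  qed
  have keys: "Poly_Mapping.keys y \<subseteq> {TWord u}"
  proof
    fix w assume w: "w \<in> Poly_Mapping.keys y"
    with y(1) obtain a b c where abc: "letters w = std a b c" "set (std a b c) \<subseteq> {..n}"
      by (auto simp: ordered_def)
    have "nf n t a b c \<noteq> 0" using w abc(1) by (cases w) (simp add: tyn ny in_keys_iff)
    with deg wt std abc have "letters w = u" by metis
    thus "w \<in> {TWord u}" by (cases w) simp
  qed
  have "y = sc (Poly_Mapping.lookup y (TWord u)) * mon u"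
  proof (rule poly_mapping_eqI)
    fix w
    show "Poly_Mapping.lookup y w = Poly_Mapping.lookup (sc (Poly_Mapping.lookup y (TWord u)) * mon u) w"
      using keys by (cases w) (auto simp: lookup_mon in_keys_iff)
  qed
  with y(2) show ?thesis by metis
qed

subsection \<open>Lifting the embedding to tensor algebras\<close>

locale veronese_embedding =
  fixes l n d :: nat and \<phi> :: "tens \<Rightarrow> tens set"
  assumes l1: "l \<ge> 1" and n12: "n \<in> {1, 2}" and nd: "n * d = l"
    and emb: "module_embedding l n d \<phi>"
begin

lemma veronese_simps:
  "monoid.mult (veronese n d) = monoid.mult (sym_alg n)" "add (veronese n d) = add (sym_alg n)"
  "one (veronese n d) = one (sym_alg n)" "zero (veronese n d) = zero (sym_alg n)"
  "scal (veronese n d) = scal (sym_alg n)" "hcomp (veronese n d) 1 = cls n ` tdeg n d"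
  by (simp_all add: veronese_def sym_alg_simps)

lemma phi_hom: "\<phi> \<in> ring_hom (tensor_alg l) (veronese n d)"
  using emb by (simp add: module_embedding_def)

lemma phi_mult: "s \<in> TT l \<Longrightarrow> t \<in> TT l \<Longrightarrow> \<phi> (s * t) = \<phi> s \<otimes>\<^bsub>sym_alg n\<^esub> \<phi> t"
  using ring_hom_mult[OF phi_hom] by (simp add: veronese_simps)

lemma phi_add: "s \<in> TT l \<Longrightarrow> t \<in> TT l \<Longrightarrow> \<phi> (s + t) = \<phi> s \<oplus>\<^bsub>sym_alg n\<^esub> \<phi> t"
  using ring_hom_add[OF phi_hom] by (simp add: veronese_simps)

lemma phi_sc: "\<phi> (sc c) = cls n (sc c)"
  using emb by (simp add: module_embedding_def veronese_simps sym_alg_simps)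

lemma phi_Vmod:
  assumes "v \<in> Vmod l"
  shows "\<exists>t\<in>tdeg n d. \<phi> v = cls n t"
proof -
  have "\<phi> ` Vmod l \<subseteq> hcomp (veronese n d) 1"
    using emb by (simp only: module_embedding_def)
  with assms have "\<phi> v \<in> cls n ` tdeg n d" unfolding veronese_simps(6) by blast
  thus ?thesis by blast
qed

lemma phi_scale:
  assumes "v \<in> TT l" "\<phi> v = cls n t" "t \<in> TT n"
  shows "\<phi> (sc c * v) = cls n (sc c * t)"
  using phi_mult[OF sc_TT assms(1), of c] cls_mult[OF sc_TT assms(3), of c] by (simp only: phi_sc assms(2))

lemma phi_act:
  assumes v: "v \<in> Vmod l" and t: "t \<in> TT n" "\<phi> v = cls n t"
  shows "\<phi> (act l g v) = cls n (act n g t)"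
proof -
  obtain u where u: "u \<in> tdeg n d" "\<phi> (act l g v) = cls n u"
    using phi_Vmod[OF act_tdeg[OF v]] by blast
  have "\<phi> (act l g v) = sym_act n g (\<phi> v)"
    using emb v by (simp add: module_embedding_def)
  moreover have "t \<in> cls n t" using t by (simp add: mem_cls_iff subspD[OF subsp_sym_ideal])
  moreover have "act n g t \<in> cls n (act n g t)"
    using act_TT[OF t(1)] by (simp add: mem_cls_iff subspD[OF subsp_sym_ideal])
  ultimately have "act n g t \<in> cls n u"
    using u(2) t(2) unfolding sym_act_def by blast
  moreover have U: "u \<in> TT n" using u(1) tdeg_TT by blast
  ultimately have "act n g t - u \<in> sym_ideal n" by (simp add: mem_cls_iff)
  with u(2) show ?thesis using cls_eq_iff[OF act_TT[OF t(1), of g] U] by simp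
qed

lemma phi_inj: "v \<in> Vmod l \<Longrightarrow> \<phi> v = cls n t \<Longrightarrow> t \<in> sym_ideal n \<Longrightarrow> v = 0"
proof -
  assume v: "v \<in> Vmod l" "\<phi> v = cls n t" "t \<in> sym_ideal n"
  have "cls n t = cls n (sc 0)"
    using v sym_ideal_TT by (subst cls_eq_iff) (auto simp: subspD[OF subsp_TT])
  hence "\<phi> v = \<phi> 0" using phi_sc[of 0] v by simp
  moreover have "inj_on \<phi> (Vmod l)" using emb by (simp add: module_embedding_def)
  ultimately show "v = 0" using v(1) subspD(1)[OF subsp_tdeg, of l 1] by (auto dest: inj_onD)
qed

text \<open>The map \<open>\<phi>\<close> is injective on \<open>V\<^sub>l\<close> and preserves weights.\<close>

lemma phi_extremal:
  assumes "i \<le> l"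
    and "\<And>a b c. a + b + c = d \<Longrightarrow> b + 2 * c = i \<Longrightarrow> set (std a b c) \<subseteq> {..n} \<Longrightarrow> std a b c = u"
    and "set u \<subseteq> {..n}"
  shows "\<exists>x. x \<noteq> 0 \<and> \<phi> (mon [i]) = cls n (sc x * mon u)"
proof -
  have v: "mon [i] \<in> Vmod l" using assms by simp
  obtain t where t: "t \<in> tdeg n d" "\<phi> (mon [i]) = cls n t" using phi_Vmod[OF v] by blast
  have T: "t \<in> TT n" using t tdeg_TT by blast
  have "cls n (act n UK t) = \<phi> (act l UK (mon [i]))" by (rule phi_act[OF v T t(2), symmetric])
  also have "\<dots> = \<phi> (sc (qq powi (int n * int d - 2 * int i)) * mon [i])"
    by (simp add: act_mon nd[symmetric])
  also have "\<dots> = cls n (sc (qq powi (int n * int d - 2 * int i)) * t)"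
    using v tdeg_TT by (intro phi_scale[OF _ t(2) T]) auto
  finally have "act n UK t - sc (qq powi (int n * int d - 2 * int i)) * t \<in> sym_ideal n"
    using T act_TT[OF T] by (simp add: cls_eq_iff subspD[OF subsp_TT])
  from weight_class[OF n12 t(1) this assms(2)]
  obtain x where x: "t - sc x * mon u \<in> sym_ideal n" by blast
  have c: "\<phi> (mon [i]) = cls n (sc x * mon u)"
    unfolding t(2) using T x assms(3) by (subst cls_eq_iff) (auto intro: subspD(3)[OF subsp_TT])
  have "x \<noteq> 0"
  proof
    assume "x = 0"
    with phi_inj[OF v c] have "mon [i] = 0" by (simp add: subspD[OF subsp_sym_ideal])
    hence "Poly_Mapping.keys (mon [i]) = {}" by simp
    thus False by simp
  qed
  with c show ?thesis by blast
qed

definition lead :: kq where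
  "lead = (SOME x. x \<noteq> 0 \<and> \<phi> (mon [0]) = cls n (sc x * mon (replicate d 0)))"

lemma lead: "lead \<noteq> 0" "\<phi> (mon [0]) = cls n (sc lead * mon (replicate d 0))"
proof -
  have "std a b c = replicate d 0" if "a + b + c = d" "b + 2 * c = 0" for a b c
    using that by (simp add: std_def)
  hence "\<exists>x. x \<noteq> 0 \<and> \<phi> (mon [0]) = cls n (sc x * mon (replicate d 0))"
    by (intro phi_extremal) auto
  hence "lead \<noteq> 0 \<and> \<phi> (mon [0]) = cls n (sc lead * mon (replicate d 0))"
    unfolding lead_def by (rule someI_ex)
  thus "lead \<noteq> 0" "\<phi> (mon [0]) = cls n (sc lead * mon (replicate d 0))" by blast+
qed

text \<open>Representatives of the images of the \<open>v\<^sub>i\<close> in the tensor algebra of \<open>V\<^sub>n\<close>, obtained from that of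
  \<open>v\<^sub>0\<close> by means of \<open>v\<^sub>i = F\<^sup>i v\<^sub>0 / [i]!\<close>. They are homogeneous in degree and weight, which makes the
  lifted homomorphism so, too.\<close>

fun lift :: "nat \<Rightarrow> tens" where
  "lift 0 = sc lead * mon (replicate d 0)"
| "lift (Suc i) = sc (1 / qi (int i + 1)) * act n UF (lift i)"

lemma lift_tw: "lift i \<in> tw n d i"
proof (induction i)
  case 0
  have "mon (replicate d 0) \<in> tw n d 0" by (auto simp: sum_list_replicate)
  thus ?case unfolding lift.simps by (rule subspD(3)[OF subsp_tw])
next
  case (Suc i)
  thus ?case unfolding lift.simps by (intro subspD(3)[OF subsp_tw] act_F_tw)
qed

lemma lift_tdeg: "lift i \<in> tdeg n d"
  using lift_tw tw_tdeg by blast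

lemma lift_TT: "lift i \<in> TT n"
  using lift_tdeg tdeg_TT by blast

lemma phi_lift: "i \<le> l \<Longrightarrow> \<phi> (mon [i]) = cls n (lift i)"
proof (induction i)
  case 0
  show ?case using lead by simp
next
  case (Suc i)
  have v: "mon [i] \<in> Vmod l" "mon [Suc i] \<in> TT l" "mon [i] \<in> TT l" using Suc by auto
  have "\<phi> (act l UF (mon [i])) = cls n (act n UF (lift i))"
    using Suc by (intro phi_act[OF v(1) lift_TT]) auto
  moreover have a: "act l UF (mon [i]) = sc (qi (int i + 1)) * mon [Suc i]"
    using Suc.prems by (simp add: act_mon qint_qi add.commute)
  ultimately have "\<phi> (sc (1 / qi (int i + 1)) * (sc (qi (int i + 1)) * mon [Suc i])) = cls n (lift (Suc i))"
    using v act_TT[OF lift_TT] by (subst phi_scale) (auto intro: subspD(3)[OF subsp_TT])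
  thus ?case by (simp add: sc_assoc)
qed

definition Lift :: "tens \<Rightarrow> tens" where
  "Lift = lin_ext (\<lambda>w. prod_list (map lift w))"

lemma lin_Lift [simp]: "lin Lift"
  by (simp add: Lift_def)

lemmas Lift_simps = lin_simps[OF lin_Lift]

lemma Lift_mon: "Lift (mon w) = prod_list (map lift w)"
  by (simp add: Lift_def)

lemma Lift_mult: "Lift (s * t) = Lift s * Lift t"
proof (induction s rule: tens_induct)
  case (mon u)
  show ?case
  proof (induction t rule: tens_induct)
    case (mon v)
    show ?case by (simp add: mon_append[symmetric] Lift_mon)
  next
    case (scale c x)
    thus ?case by (simp only: sc_left_commute Lift_simps)
  qed (simp_all add: Lift_simps distrib_left)
next
  case (scale c x)
  thus ?case by (simp only: mult.assoc Lift_simps)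
qed (simp_all add: Lift_simps distrib_right)

lemma prod_lift_tdeg: "prod_list (map lift w) \<in> tw n (d * length w) (sum_list w)"
proof (induction w)
  case (Cons i w)
  thus ?case using tw_mult[OF lift_tw[of i] Cons.IH] by (simp add: algebra_simps)
next
  case Nil
  show ?case using mon_tw[of "[]" n 0 0] by simp
qed

lemma Lift_TT: "Lift t \<in> TT n"
proof (induction t rule: tens_induct)
  case (mon w)
  show ?case using subsetD[OF tdeg_TT subsetD[OF tw_tdeg prod_lift_tdeg[of w]]] by (simp only: Lift_mon)
qed (simp_all add: Lift_simps subspD[OF subsp_TT])

lemma Lift_tw: "t \<in> tw l k s \<Longrightarrow> Lift t \<in> tw n (d * k) s"
proof (induction rule: tw_induct)
  case (mon w)
  thus ?case using prod_lift_tdeg[of w] by (simp add: Lift_mon)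
qed (simp_all add: Lift_simps subspD[OF subsp_tw])

lemma phi_Lift:
  assumes "t \<in> TT l"
  shows "\<phi> t = cls n (Lift t)"
proof -
  have "\<phi> t = cls n (Lift t) \<and> t \<in> TT l"
    using assms
  proof (induction rule: TT_induct)
    case zero
    show ?case using phi_sc[of 0] by (simp add: Lift_simps subspD[OF subsp_TT])
  next
    case (add x y)
    thus ?case by (simp add: phi_add cls_add Lift_TT Lift_simps subspD[OF subsp_TT])
  next
    case (scale c x)
    thus ?case by (simp add: phi_scale Lift_TT Lift_simps subspD[OF subsp_TT])
  next
    case (mon w)
    thus ?case
    proof (induction w)
      case Nil
      show ?case using phi_sc[of 1] Lift_mon[of "[]"] by simp
    next
      case (Cons i w)
      have "\<phi> (mon [i] * mon w) = cls n (lift i) \<otimes>\<^bsub>sym_alg n\<^esub> cls n (Lift (mon w))"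
        using Cons by (subst phi_mult) (simp_all add: phi_lift)
      also have "\<dots> = cls n (lift i * Lift (mon w))" by (rule cls_mult[OF lift_TT Lift_TT])
      finally show ?case using Cons.prems by (simp add: mon_append[symmetric] Lift_mon)
    qed
  qed
  thus "\<phi> t = cls n (Lift t)" by simp
qed

lemma kernel_phi: "a_kernel (tensor_alg l) (veronese n d) \<phi> = {t \<in> TT l. Lift t \<in> sym_ideal n}"
  unfolding a_kernel_def' using phi_Lift cls_eq_zero_iff[OF Lift_TT] by (auto simp only: veronese_simps tensor_alg_simps)

text \<open>The lifted homomorphism need not be equivariant, but it is modulo the ideal, since it is so
  on \<open>V\<^sub>l\<close>.\<close>

lemma Lift_act:
  assumes "t \<in> tdeg l 2"
  shows "Lift (act l g t) - act n g (Lift t) \<in> sym_ideal n"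
proof -
  have V: "Lift (act l g (mon [i])) - act n g (lift i) \<in> sym_ideal n" if "i \<le> l" for i g
  proof -
    have v: "mon [i] \<in> Vmod l" using that by simp
    have "cls n (Lift (act l g (mon [i]))) = \<phi> (act l g (mon [i]))"
      using phi_Lift[OF subsetD[OF tdeg_TT act_tdeg[OF v]]] by simp
    also have "\<dots> = cls n (act n g (lift i))"
      by (rule phi_act[OF v lift_TT phi_lift[OF that]])
    finally show ?thesis using Lift_TT act_TT[OF lift_TT] by (simp add: cls_eq_iff)
  qed
  show ?thesis
    using assms
  proof (induction rule: tdeg_induct)
    case zero
    show ?case by (simp add: Lift_simps act_simps subspD[OF subsp_sym_ideal])
  next
    case (add x y)
    have "Lift (act l g (x + y)) - act n g (Lift (x + y))
        = (Lift (act l g x) - act n g (Lift x)) + (Lift (act l g y) - act n g (Lift y))"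
      by (simp add: Lift_simps act_simps)
    with add show ?case by (simp only: subspD(2)[OF subsp_sym_ideal])
  next
    case (scale c x)
    have "Lift (act l g (sc c * x)) - act n g (Lift (sc c * x)) = sc c * (Lift (act l g x) - act n g (Lift x))"
      by (simp add: Lift_simps act_simps right_diff_distrib)
    with scale show ?case by (simp only: subspD(3)[OF subsp_sym_ideal])
  next
    case (mon w)
    then obtain i j where w: "w = [i, j]" and ij: "i \<le> l" "j \<le> l"
      by (auto simp: numeral_2_eq_2 length_Suc_conv)
    have e: "mon w = mon [i] * mon [j]" by (simp add: w mon_append[symmetric])
    have p: "Lift (act l g1 (mon [i])) * Lift (act l g2 (mon [j])) - act n g1 (lift i) * act n g2 (lift j) \<in> sym_ideal n"
      for g1 g2
    proof -
      have "(Lift (act l g1 (mon [i])) - act n g1 (lift i)) * Lift (act l g2 (mon [j]))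
          + act n g1 (lift i) * (Lift (act l g2 (mon [j])) - act n g2 (lift j)) \<in> sym_ideal n"
        by (intro subspD(2)[OF subsp_sym_ideal] sym_ideal_mult V ij Lift_TT act_TT lift_TT)
      thus ?thesis by (simp add: left_diff_distrib right_diff_distrib)
    qed
    have q: "(A + C) - (B + D) \<in> sym_ideal n" if "A - B \<in> sym_ideal n" "C - D \<in> sym_ideal n" for A B C D
      using subspD(2)[OF subsp_sym_ideal that] by (simp only: add_diff_add)
    have L: "Lift (mon [i] * mon [j]) = lift i * lift j" by (simp add: Lift_mult Lift_mon)
    show ?case
      unfolding e L
      by (cases g) (simp_all add: act_mult Lift_simps Lift_mult p q del: act_U1)
  qed
qed

text \<open>The kernel of \<open>T(V\<^sub>l) \<rightarrow> S\<^sub>\<sigma>(V\<^sub>n)\<close> is stable under \<open>F\<close>. A tensor of odd weight index that \<open>E\<close> maps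
  into the kernel has an image annihilated by \<open>E\<close>, which is zero. By the criterion for submodules
  the kernel contains the exterior square.\<close>

lemma sym_ideal_kernel: "sym_ideal l \<subseteq> {t. Lift t \<in> sym_ideal n}"
proof (rule sym_ideal_minimal)
  show S: "subsp {t. Lift t \<in> sym_ideal n}"
    by (rule subsp_vimage[OF lin_Lift subsp_sym_ideal])
  show "ext_square l \<subseteq> {t. Lift t \<in> sym_ideal n}"
  proof (rule ext_square_subset_submodule[OF S])
    fix t assume t: "t \<in> tdeg l 2" "t \<in> {t. Lift t \<in> sym_ideal n}"
    have "act n UF (Lift t) \<in> sym_ideal n" using t by (simp add: sym_ideal_act)
    with Lift_act[OF t(1), of UF] show "act l UF t \<in> {t. Lift t \<in> sym_ideal n}"
      using subspD(2)[OF subsp_sym_ideal] by fastforce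
  next
    fix t k assume t: "t \<in> tw l 2 (Suc k)" "even k" "act l UE t \<in> {t. Lift t \<in> sym_ideal n}"
    have "t \<in> tdeg l 2" using t(1) tw_tdeg by blast
    from subspD(5)[OF subsp_sym_ideal _ Lift_act[OF this, of UE], of "Lift (act l UE t)"] t(3)
    have "act n UE (Lift t) \<in> sym_ideal n" by simp
    with E_injective_odd[OF n12 Lift_tw[OF t(1)]] t(2) show "t \<in> {t. Lift t \<in> sym_ideal n}" by simp
  qed
  fix x t assume "x \<in> {t. Lift t \<in> sym_ideal n}"
  thus "t * x \<in> {t. Lift t \<in> sym_ideal n} \<and> x * t \<in> {t. Lift t \<in> sym_ideal n}"
    by (simp add: Lift_mult sym_ideal_mult Lift_TT)
qed

end

section \<open>Chains induced from V1 and V2\<close>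

text \<open>The hypotheses are the values of \<open>u \<otimes> w\<close> on the defining relations of \<open>S\<^sub>\<sigma>(V\<^sub>1)\<close> and \<open>S\<^sub>\<sigma>(V\<^sub>2)\<close>.\<close>

lemma kills_small:
  assumes "n \<in> {1, 2}" "u 0 * w 1 = qq ^ n * (u 1 * w 0)"
    and "n = 2 \<Longrightarrow> qi 2 * (u 0 * w 2) + (1 - qq^2) * (u 1 * w 1) - qi 2 * (u 2 * w 0) = 0"
    and "n = 2 \<Longrightarrow> u 1 * w 2 = qq^2 * (u 2 * w 1)"
  shows "kills n u w"
proof -
  have K: "subsp {t. ev2 u w t = 0}" unfolding ev2_def by (rule subsp_wsum)
  have n: "1 \<le> n" using assms(1) by auto
  have "ext_square n \<subseteq> {t. ev2 u w t = 0}"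
  proof (rule ext_square_1_2[OF assms(1) K])
    show "hw n 1 \<in> {t. ev2 u w t = 0}"
      unfolding hw_1[OF n] using n assms(2) by (simp add: ev2_simps ev2_ee)
  next
    assume n2: "n = 2"
    show "desc 2 1 1 \<in> {t. ev2 u w t = 0}"
      unfolding desc_small(2) using assms(3)[OF n2] by (simp add: ev2_simps ev2_ee)
    show "desc 2 1 2 \<in> {t. ev2 u w t = 0}"
      unfolding desc_small(3) using assms(4)[OF n2] by (simp add: ev2_simps ev2_ee)
  qed
  thus ?thesis by (auto simp: kills_def)
qed

text \<open>The chains for \<open>V\<^sub>1\<close> and \<open>V\<^sub>2\<close> up to scalars. In the first one the coordinate \<open>x\<^sub>2\<close> is the solution
  of the relation of weight zero for given \<open>x\<^sub>1\<close>, so that the points move along a conic; the points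
  of the line \<open>x\<^sub>1 = 0\<close> and the last coordinate point stay fixed.\<close>

definition conic :: "nat \<Rightarrow> kq \<Rightarrow> nat \<Rightarrow> nat \<Rightarrow> kq" where
  "conic n \<alpha> s i = (if i = 0 then 1 else if i = 1 then \<alpha> * (qq ^ n) ^ s
     else \<alpha>^2 * ((qq^2 - 1) * qq^2 / (qi 2 * (qq^4 - 1))) * (qq^4) ^ s)"

definition line :: "kq \<Rightarrow> nat \<Rightarrow> nat \<Rightarrow> kq" where
  "line b s i = (if i = 0 then 1 else if i = 2 then b else 0)"

definition endpoint :: "nat \<Rightarrow> nat \<Rightarrow> nat \<Rightarrow> kq" where
  "endpoint n s i = (if i = n then 1 else 0)"

lemma chain_conic: "n \<in> {1, 2} \<Longrightarrow> chain n (conic n \<alpha>)"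
  unfolding chain_def
proof (intro allI kills_small)
  fix s
  assume n: "n \<in> {1, 2}"
  show "conic n \<alpha> s 0 * conic n \<alpha> (Suc s) 1 = qq ^ n * (conic n \<alpha> s 1 * conic n \<alpha> (Suc s) 0)"
    by (simp add: conic_def mult_ac)
  define c where "c = (qq^2 - 1) * qq^2 / (qi 2 * (qq^4 - 1))"
  define Z where "Z = (qq^4) ^ s"
  have Z: "((qq^2) ^ s) * ((qq^2) ^ s) = Z" by (simp add: Z_def flip: power_mult power_add)
  assume "n = 2"
  hence v: "conic n \<alpha> s 0 = 1" "conic n \<alpha> (Suc s) 0 = 1" "conic n \<alpha> s 1 = \<alpha> * (qq^2) ^ s"
    "conic n \<alpha> (Suc s) 1 = \<alpha> * (qq^2 * (qq^2) ^ s)"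
    "conic n \<alpha> s 2 = \<alpha>^2 * c * Z" "conic n \<alpha> (Suc s) 2 = \<alpha>^2 * c * (qq^4 * Z)"
    by (simp_all add: conic_def c_def Z_def)
  have c: "qi 2 * c * (qq^4 - 1) = (qq^2 - 1) * qq^2"
    using qq_power_eq_1_iff[of 4] by (simp add: c_def del: qq_power_eq_1_iff)
  have "qi 2 * (1 * (\<alpha>^2 * c * (qq^4 * Z))) + (1 - qq^2) * (\<alpha> * (qq^2) ^ s * (\<alpha> * (qq^2 * (qq^2) ^ s))) - qi 2 * (\<alpha>^2 * c * Z * 1)
    = \<alpha>^2 * Z * (qi 2 * c * (qq^4 - 1)) - \<alpha>^2 * (((qq^2) ^ s) * ((qq^2) ^ s)) * ((qq^2 - 1) * qq^2)"
    by (simp add: algebra_simps power2_eq_square)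
  also have "\<dots> = 0" unfolding c Z by simp
  finally show "qi 2 * (conic n \<alpha> s 0 * conic n \<alpha> (Suc s) 2) + (1 - qq^2) * (conic n \<alpha> s 1 * conic n \<alpha> (Suc s) 1)
      - qi 2 * (conic n \<alpha> s 2 * conic n \<alpha> (Suc s) 0) = 0"
    unfolding v .
  show "conic n \<alpha> s 1 * conic n \<alpha> (Suc s) 2 = qq^2 * (conic n \<alpha> s 2 * conic n \<alpha> (Suc s) 1)"
    unfolding v by (simp add: mult_ac)
qed

lemma chain_line: "chain 2 (line b)"
  unfolding chain_def by (intro allI kills_small) (simp_all add: line_def)

lemma chain_endpoint: "n \<in> {1, 2} \<Longrightarrow> chain n (endpoint n)"
  unfolding chain_def by (intro allI kills_small) (auto simp: endpoint_def)

lemma kills_scale: "kills l u w \<Longrightarrow> kills l (\<lambda>i. a * u i) (\<lambda>i. b * w i)"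
proof -
  have "ev2 (\<lambda>i. a * u i) (\<lambda>i. b * w i) h = (a * b) * ev2 u w h" for h
  proof -
    have "ev2 (\<lambda>i. a * u i) (\<lambda>i. b * w i) h = wsum (\<lambda>x. (a * b) * (u (x ! 0) * w (x ! 1))) h"
      unfolding ev2_def by (rule wsum_cong) (simp add: mult_ac)
    thus ?thesis by (simp add: wsum_fmult ev2_def)
  qed
  thus "kills l u w \<Longrightarrow> kills l (\<lambda>i. a * u i) (\<lambda>i. b * w i)" by (simp add: kills_def)
qed

lemma ev_scale:
  assumes "t \<in> tdeg l k" "\<And>s i. i \<le> l \<Longrightarrow> P s i = c s * Q s i"
  shows "ev P s t = (\<Prod>j<k. c (s + j)) * ev Q s t"
proof -
  have w: "set w \<subseteq> {..l} \<Longrightarrow> evw P s w = (\<Prod>j<length w. c (s + j)) * evw Q s w" for w s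
    by (induction w arbitrary: s)
       (simp_all add: assms(2) prod.lessThan_Suc_shift del: prod.lessThan_Suc)
  have "ev P s t = wsum (\<lambda>w. (\<Prod>j<k. c (s + j)) * evw Q s w) t"
    unfolding ev_def by (rule wsum_cong) (use assms(1) w in \<open>auto simp: tdeg_def\<close>)
  thus ?thesis by (simp add: wsum_fmult ev_def)
qed

lemma ev_1 [simp]: "ev P s 1 = 1"
  using ev_mon[of P s "[]"] by simp

text \<open>The sum over the \<open>k\<close> places where \<open>F\<close> can act is geometric, because the factor from \<open>K\<^sup>-\<^sup>1\<close> and the
  value of the form both change by a constant ratio from place to place.\<close>

lemma ev_conic_F:
  assumes "n \<ge> 1"
  shows "ev (conic n \<alpha>) s (act n UF (mon (replicate k 0))) =
    \<alpha> * (qq ^ n) ^ s * qq powi (int n - int n * int k) * geo (qq powi (2 * int n)) k"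
proof (induction k arbitrary: s)
  case 0
  show ?case by (simp add: act_sc[of n UF 1, simplified] ev_def)
next
  case (Suc k)
  have r: "evw (conic n \<alpha>) s (replicate k 0) = 1" for s k
    by (induction k arbitrary: s) (simp_all add: conic_def)
  have F0: "act n UF (mon [0]) = mon [1]" using assms by (simp add: act_mon qint_qi)
  have d1: "mon [i] \<in> tdeg 1 1" if "i \<le> 1" for i using that by simp
  have e: "mon (replicate (Suc k) 0) = mon [0] * mon (replicate k 0)" by (simp add: mon_append[symmetric])
  have K: "act n UKinv (mon (replicate k 0)) = sc (qq powi (- int n * int k)) * mon (replicate k 0)"
    by (subst act_mon, subst word_act_Kinv) (auto simp: sum_list_replicate)
  have "ev (conic n \<alpha>) s (act n UF (mon (replicate (Suc k) 0)))
      = \<alpha> * (qq ^ n) ^ s * qq powi (- int n * int k) + ev (conic n \<alpha>) (Suc s) (act n UF (mon (replicate k 0)))"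
    unfolding e act_F_mult K F0
    by (simp add: ev_simps ev_mult[OF d1] r sc_left_commute) (simp add: conic_def mult_ac)
  also have "\<dots> = \<alpha> * (qq ^ n) ^ s * (qq powi (- int n * int k) + qq ^ n * qq powi (int n - int n * int k) * geo (qq powi (2 * int n)) k)"
    unfolding Suc by (simp add: algebra_simps)
  also have "qq ^ n * qq powi (int n - int n * int k) = qq powi (- int n * int k) * qq powi (2 * int n)"
    using qq_powi_mult[of "int n" "int n - int n * int k"] by (simp add: qq_powi_mult algebra_simps)
  finally show ?case by (simp add: geo_Suc_left algebra_simps)
qed

lemma ev_line_FF:
  "ev (line b) s (act 2 UF (act 2 UF (mon (replicate k 0)))) = qi 2 * b * geo (qq powi (-4)) k"
proof (induction k arbitrary: s)
  case 0
  have "act 2 UF 1 = 0" using act_sc[of 2 UF 1] by simp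
  thus ?case by (simp add: act_simps ev_def)
next
  case (Suc k)
  have r: "evw (line b) s (replicate k 0) = 1" for s k
    by (induction k arbitrary: s) (simp_all add: line_def)
  have F0: "act 2 UF (mon [0]) = mon [1]" "act 2 UF (mon [1]) = sc (qi 2) * mon [2]"
    by (simp_all add: act_mon qint_qi numeral_2_eq_2)
  have d1: "mon [i] \<in> tdeg 2 1" if "i \<le> 2" for i using that by simp
  have e: "mon (replicate (Suc k) 0) = mon [0] * mon (replicate k 0)" by (simp add: mon_append[symmetric])
  have K: "act 2 UKinv (mon (replicate k 0)) = sc (qq powi (- 2 * int k)) * mon (replicate k 0)"
    by (subst act_mon, subst word_act_Kinv) (auto simp: sum_list_replicate)
  have "ev (line b) s (mon [1] * t) = 0" for t by (simp add: ev_mult[OF d1[of 1]] line_def del: One_nat_def)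
  hence "ev (line b) s (act 2 UF (act 2 UF (mon (replicate (Suc k) 0))))
     = qi 2 * b * (qq powi (- 2 * int k) * qq powi (- 2 * int k)) + ev (line b) (Suc s) (act 2 UF (act 2 UF (mon (replicate k 0))))"
    unfolding e act_F_mult K F0 act_simps
    by (simp add: ev_simps ev_mult[OF d1] r sc_left_commute[of "mon [i]" for i] act_F_mult F0 act_simps K mult.assoc)
       (simp add: line_def mult_ac)
  also have "qq powi (- 2 * int k) * qq powi (- 2 * int k) = (qq powi (-4)) ^ k"
    unfolding qq_powi_mult by (simp add: power_int_mult[symmetric] flip: power_int_of_nat)
  finally show ?case unfolding Suc by (simp add: geo_Suc algebra_simps)
qed

context veronese_embedding
begin

lemma d1: "d \<ge> 1"
  using nd l1 by (cases d) auto

text \<open>The form on \<open>V\<^sub>l\<close> obtained by evaluating \<open>d\<close> consecutive forms of a chain for \<open>V\<^sub>n\<close> on the image of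
  \<open>V\<^sub>l\<close> in degree \<open>d\<close>.\<close>

definition induced :: "(nat \<Rightarrow> nat \<Rightarrow> kq) \<Rightarrow> nat \<Rightarrow> nat \<Rightarrow> kq" where
  "induced P s i = ev P (s * d) (lift i)"

lemma ev_Lift: "ev P (s * d) (Lift t) = ev (induced P) s t"
proof (induction t rule: tens_induct)
  case (mon w)
  show ?case
  proof (induction w arbitrary: s)
    case Nil
    show ?case using Lift_mon[of "[]"] by simp
  next
    case (Cons i w)
    have "ev P (s * d) (Lift (mon (i # w))) = ev P (s * d) (lift i) * ev P (Suc s * d) (Lift (mon w))"
      by (simp add: Lift_mon ev_mult[OF lift_tdeg] add.commute)
    thus ?case by (simp add: Cons.IH induced_def[symmetric] del: mult_Suc)
  qed
qed (simp_all add: Lift_simps ev_simps)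

lemma ev_induced_kernel:
  assumes "chain n P" "Lift t \<in> sym_ideal n"
  shows "ev (induced P) s t = 0"
  using ev_sym_ideal[OF assms] ev_Lift by metis

lemma chain_induced: "chain n P \<Longrightarrow> chain l (induced P)"
  unfolding chain_def[of l] kills_def
proof (intro allI ballI)
  fix s h assume P: "chain n P" and h: "h \<in> ext_square l"
  have "Lift h \<in> sym_ideal n" using h ext_square_sym_ideal sym_ideal_kernel by blast
  from ev_induced_kernel[OF P this] show "ev2 (induced P s) (induced P (Suc s)) h = 0"
    using ev_ev2[OF subsetD[OF ext_square_T2 h]] by metis
qed

lemma induced_0: "(\<And>s. P s 0 = 1) \<Longrightarrow> induced P s 0 = lead"
proof -
  assume "\<And>s. P s 0 = 1"
  hence "evw P s (replicate k 0) = 1" for s k by (induction k arbitrary: s) simp_all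
  thus ?thesis by (simp add: induced_def ev_simps)
qed

lemma induced_conic_1: "induced (conic n \<alpha>) 0 1 = lead * (\<alpha> * (qq powi (int n - int n * int d) * geo (qq powi (2 * int n)) d))"
  using ev_conic_F[of n \<alpha> 0 d] n12 by (auto simp: induced_def ev_simps act_simps mult.assoc)

lemma induced_line:
  assumes "n = 2"
  shows "induced (line b) 0 1 = 0" "induced (line b) 0 2 = lead * (b * geo (qq powi (-4)) d)"
proof -
  have "ev (line b) 0 t = 0" if "t \<in> tw n d 1" for t
    using that
  proof (induction rule: tw_induct)
    case (mon w)
    hence "1 \<in> set w"
    proof (induction w arbitrary: d)
      case (Cons i w)
      thus ?case by (cases i) auto
    qed simp
    hence "evw (line b) s w = 0" for s
      by (induction w arbitrary: s) (auto simp: line_def)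
    thus ?case by simp
  qed (simp_all add: ev_simps)
  thus "induced (line b) 0 1 = 0" using lift_tw[of 1] by (simp add: induced_def del: lift.simps)
  have FF: "ev (line b) 0 (act n UF (act n UF (mon (replicate d 0)))) = qi 2 * b * geo (qq powi (-4)) d"
    unfolding assms by (rule ev_line_FF)
  have "lift 2 = sc (lead / qi 2) * act n UF (act n UF (mon (replicate d 0)))"
    by (simp add: numeral_2_eq_2 act_simps sc_assoc)
  thus "induced (line b) 0 2 = lead * (b * geo (qq powi (-4)) d)"
    using FF by (simp add: induced_def ev_simps)
qed

text \<open>The only word of length \<open>d\<close> on which the last coordinate point does not vanish is the power
  of the last generator, which represents the image of the lowest weight vector \<open>v\<^sub>l\<close>.\<close>

lemma induced_endpoint:
  "i < l \<Longrightarrow> induced (endpoint n) s i = 0" "induced (endpoint n) s l \<noteq> 0"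
proof -
  have w: "evw (endpoint n) s w = 0" if "set w \<subseteq> {..n}" "sum_list w < n * length w" for w s
    using that
  proof (induction w arbitrary: s)
    case (Cons i w)
    show ?case
    proof (cases "i = n")
      case True
      with Cons have "evw (endpoint n) (Suc s) w = 0" by simp
      thus ?thesis by simp
    qed (simp add: endpoint_def)
  qed simp
  have "ev (endpoint n) s t = 0" if "t \<in> tw n d i" "i < l" for t s
    using that by (induction rule: tw_induct) (use w nd in \<open>simp_all add: ev_simps\<close>)
  thus "i < l \<Longrightarrow> induced (endpoint n) s i = 0"
    using lift_tw[of i] by (simp add: induced_def)
  have "std a b c = replicate d n" if "a + b + c = d" "b + 2 * c = l" "set (std a b c) \<subseteq> {..n}" for a b c
  proof (cases "n = 1")
    case True
    hence "c = 0" using that by (auto simp: std_def split: if_splits)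
    thus ?thesis using that True nd by (auto simp: std_def)
  next
    case False
    hence "n = 2" using n12 by auto
    hence "a = 0 \<and> b = 0 \<and> c = d" using that nd by auto
    thus ?thesis using \<open>n = 2\<close> by (simp add: std_def)
  qed
  moreover have "set (replicate d n) \<subseteq> {..n}" by auto
  ultimately obtain x where x: "x \<noteq> 0" "\<phi> (mon [l]) = cls n (sc x * mon (replicate d n))"
    using phi_extremal[OF order_refl, of "replicate d n"] by blast
  have "sc x * mon (replicate d n) \<in> TT n" by (rule subspD(3)[OF subsp_TT]) auto
  hence "lift l - sc x * mon (replicate d n) \<in> sym_ideal n"
    using x(2) phi_lift[of l] cls_eq_iff[OF lift_TT] by simp
  from ev_sym_ideal[OF chain_endpoint[OF n12] this]
  have "induced (endpoint n) s l = x * evw (endpoint n) (s * d) (replicate d n)"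
    by (simp add: ev_simps induced_def)
  moreover have "evw (endpoint n) s (replicate k n) = 1" for s k
    by (induction k arbitrary: s) (simp_all add: endpoint_def)
  ultimately show "induced (endpoint n) s l \<noteq> 0" using x(1) by simp
qed

lemma kernel_if_proportional:
  assumes "chain n P" "\<And>s i. i \<le> l \<Longrightarrow> R s i = c s * induced P s i"
    and "t \<in> tdeg l k" "Lift t \<in> sym_ideal n"
  shows "ev R 0 t = 0"
  using ev_scale[OF assms(3,2)] ev_induced_kernel[OF assms(1,4)] by simp

lemma normalized_chain:
  assumes "chain l R"
  shows "chain l (\<lambda>s i. R s i / R s 0)"
  unfolding chain_def
proof
  fix s
  show "kills l (\<lambda>i. R s i / R s 0) (\<lambda>i. R (Suc s) i / R (Suc s) 0)"
    using kills_scale[of l "R s" "R (Suc s)" "1 / R s 0" "1 / R (Suc s) 0"] assms by (simp add: chain_def)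
qed

text \<open>By uniqueness of normalized chains, agreement with an induced chain at the indices one and
  two of the first place implies proportionality.\<close>

lemma kernel_if_match:
  assumes R: "chain l R" "\<And>s. R s 0 \<noteq> 0" and P: "chain n P" "\<And>s. P s 0 = 1"
    and "R 0 1 / R 0 0 = induced P 0 1 / lead" "2 \<le> l \<Longrightarrow> R 0 2 / R 0 0 = induced P 0 2 / lead"
    and "t \<in> tdeg l k" "Lift t \<in> sym_ideal n"
  shows "ev R 0 t = 0"
proof (rule kernel_if_proportional[OF P(1) _ assms(7,8)])
  fix s i assume i: "i \<le> l"
  have "R s i / R s 0 = induced P s i / induced P s 0"
    by (rule chain_unique[OF normalized_chain[OF R(1)] _ normalized_chain[OF chain_induced[OF P(1)]] _ _ _ i])
       (use R lead induced_0[of P, OF P(2)] assms(5,6) in auto)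
  thus "R s i = (R s 0 / lead) * induced P s i"
    using R(2)[of s] lead induced_0[of P, OF P(2)] by (simp add: field_simps)
qed

text \<open>Every chain for \<open>V\<^sub>l\<close> is proportional to an induced one. It is induced from the last
  coordinate point if the coordinate of index zero vanishes, from a point of the conic if the
  coordinate of index one does not vanish, and otherwise from a point of the line \<open>x\<^sub>1 = 0\<close> for \<open>n = 2\<close>
  and from the first coordinate point for \<open>n = 1\<close>.\<close>

lemma chain_kernel:
  assumes par: "odd l \<or> n = 2" and R: "chain l R" "\<And>s. \<exists>i\<le>l. R s i \<noteq> 0"
    and t: "t \<in> tdeg l k" "Lift t \<in> sym_ideal n"
  shows "ev R 0 t = 0"
proof -
  have k: "kills l (R s) (R (Suc s))" for s using R by (simp add: chain_def)
  note low = kills_low[OF k l1 R(2) R(2)]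
  show ?thesis
  proof (cases "R 0 0 = 0")
    case True
    have "\<forall>i<l. R s i = 0" for s
    proof (induction s)
      case 0
      show ?case using low[of 0] True by auto
    next
      case (Suc s)
      show ?case using low[of s] Suc l1 by auto
    qed
    hence z: "R s i = 0" if "i < l" for s i using that by blast
    show ?thesis
    proof (rule kernel_if_proportional[OF chain_endpoint[OF n12] _ t])
      fix s i assume "i \<le> l"
      thus "R s i = (R s l / induced (endpoint n) s l) * induced (endpoint n) s i"
        using z induced_endpoint(1)[of i s] by (cases "i = l") (auto simp: induced_endpoint(2))
    qed
  next
    case False
    have R0: "R s 0 \<noteq> 0" for s
    proof (induction s)
      case (Suc s)
      thus ?case using low[of s] l1 by auto
    qed (rule False)
    let ?R = "\<lambda>s i. R s i / R s 0"
    have nR: "chain l ?R" by (rule normalized_chain[OF R(1)])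
    let ?C = "\<lambda>\<alpha>. conic n \<alpha>"
    have C: "chain n (?C \<alpha>)" "\<And>s. ?C \<alpha> s 0 = 1" for \<alpha> using chain_conic[OF n12] by (simp_all add: conic_def)
    define \<kappa> where "\<kappa> = qq powi (int n - int n * int d) * geo (qq powi (2 * int n)) d"
    have kap: "\<kappa> \<noteq> 0" using geo_neq_0[of "2 * int n" d] d1 n12 by (auto simp: \<kappa>_def)
    define \<alpha> where "\<alpha> = R 0 1 / R 0 0 / \<kappa>"
    have m1: "R 0 1 / R 0 0 = induced (?C \<alpha>) 0 1 / lead"
      using kap lead unfolding induced_conic_1 \<kappa>_def[symmetric] by (simp add: \<alpha>_def)
    note iC = induced_0[of "?C \<alpha>", OF C(2)]
    show ?thesis
    proof (cases "R 0 1 = 0")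
      case nz: False
      have inz: "induced (?C \<alpha>) 0 1 \<noteq> 0" using m1 nz R0[of 0] by auto
      have "R 0 2 / R 0 0 = induced (?C \<alpha>) 0 2 / lead" if "2 \<le> l"
        using chain_second_coordinate[OF nR _ normalized_chain[OF chain_induced[OF C(1)[of \<alpha>]]] _ _ _ that] R0 m1 inz lead iC
        by simp
      from kernel_if_match[OF R(1) R0 C m1 this t] show ?thesis by simp
    next
      case R1: True
      show ?thesis
      proof (cases "n = 2")
        case True
        have g: "geo (qq powi (-4)) d \<noteq> 0" using geo_neq_0[of "-4" d] d1 by simp
        define b where "b = R 0 2 / R 0 0 / geo (qq powi (-4)) d"
        have L: "chain n (line b)" "\<And>s. line b s 0 = 1" using chain_line True by (simp_all add: line_def)
        have "R 0 1 / R 0 0 = induced (line b) 0 1 / lead" "R 0 2 / R 0 0 = induced (line b) 0 2 / lead"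
          using R1 g lead unfolding induced_line[OF True] by (simp_all add: b_def)
        from kernel_if_match[OF R(1) R0 L this t] show ?thesis .
      next
        case False
        hence od: "odd l" using par by simp
        \<comment> \<open>For odd \<open>l\<close> the last coordinate has odd index and vanishes, so that all coordinates of positive index do.
          The criterion for the upper ends of the supports needs forms that are cut off at \<open>l\<close>.\<close>
        have z: "Q 0 2 = 0" if Q: "chain l Q" "\<And>s. Q s 0 = 1" "Q 0 1 = 0" "2 \<le> l" for Q
        proof -
          let ?Q = "\<lambda>s i. if i \<le> l then Q s i else 0"
          have kQ: "kills l (?Q s) (?Q (Suc s))" for s
          proof -
            have "ev2 (?Q s) (?Q (Suc s)) h = ev2 (Q s) (Q (Suc s)) h" if "h \<in> tdeg l 2" for h
              using that by (induction rule: T2_induct) (auto simp: ev2_simps ev2_ee)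
            thus ?thesis using Q(1) ext_square_T2 unfolding chain_def kills_def by fastforce
          qed
          have "Q 0 l = 0" by (rule chain_odd_zero[OF Q(1-3) od order_refl])
          moreover have "\<exists>i\<le>l. ?Q s i \<noteq> 0" for s using Q(2)[of s] by (intro exI[of _ 0]) simp
          ultimately have all: "\<forall>i>0. ?Q 0 i = 0"
            using kills_high[OF kQ[of 0] l1] by auto
          have "?Q 0 2 = 0" by (rule all[rule_format]) simp
          thus ?thesis using Q(4) by simp
        qed
        have "R 0 2 / R 0 0 = induced (?C \<alpha>) 0 2 / lead" if "2 \<le> l"
        proof -
          have "R 0 2 / R 0 0 = 0" using z[OF nR _ _ that] R0 R1 by simp
          moreover have "induced (?C \<alpha>) 0 2 / induced (?C \<alpha>) 0 0 = 0"
            using z[OF normalized_chain[OF chain_induced[OF C(1)[of \<alpha>]]] _ _ that] iC lead m1 R1 by simp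
          ultimately show ?thesis using iC lead R0[of 0] by simp
        qed
        from kernel_if_match[OF R(1) R0 C m1 this t] show ?thesis by simp
      qed
    qed
  qed
qed

end

section \<open>Points in coordinates\<close>

(* The degree 1 in tdeg l 1 is kept as it stands, so that facts about homogeneous components keep matching. *)
declare One_nat_def [simp del]

lemma Vmod_mon: "i \<le> l \<Longrightarrow> mon [i] \<in> Vmod l"
  by simp

locale pairing =
  fixes l :: nat and \<beta> :: "tens \<Rightarrow> tens \<Rightarrow> kq"
  assumes dual: "dual_pairing l \<beta>"
begin

lemma beta_add: "x \<in> Vmod l \<Longrightarrow> y \<in> Vmod l \<Longrightarrow> z \<in> Vmod l \<Longrightarrow> \<beta> (x + y) z = \<beta> x z + \<beta> y z"
  "x \<in> Vmod l \<Longrightarrow> y \<in> Vmod l \<Longrightarrow> z \<in> Vmod l \<Longrightarrow> \<beta> x (y + z) = \<beta> x y + \<beta> x z"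
  and beta_sc: "x \<in> Vmod l \<Longrightarrow> z \<in> Vmod l \<Longrightarrow> \<beta> (sc c * x) z = c * \<beta> x z"
  "x \<in> Vmod l \<Longrightarrow> z \<in> Vmod l \<Longrightarrow> \<beta> x (sc c * z) = c * \<beta> x z"
  using dual unfolding dual_pairing_def by blast+

lemma V0: "0 \<in> Vmod l"
  by (rule subspD(1)[OF subsp_tdeg])

lemma beta_0: "z \<in> Vmod l \<Longrightarrow> \<beta> 0 z = 0" "x \<in> Vmod l \<Longrightarrow> \<beta> x 0 = 0"
  using beta_sc(1)[OF V0, of z 0] beta_sc(2)[OF _ V0, of x 0] by auto

lemma nondeg: "x \<in> Vmod l \<Longrightarrow> x \<noteq> 0 \<Longrightarrow> \<exists>y\<in>Vmod l. \<beta> x y \<noteq> 0"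
  "y \<in> Vmod l \<Longrightarrow> y \<noteq> 0 \<Longrightarrow> \<exists>x\<in>Vmod l. \<beta> x y \<noteq> 0"
  using dual unfolding dual_pairing_def by blast+

text \<open>The vector \<open>u\<close> is regarded as the linear form \<open>\<beta>(-, u)\<close>, given by its values on the basis.\<close>

definition coord :: "tens \<Rightarrow> nat \<Rightarrow> kq" where
  "coord u i = \<beta> (mon [i]) u"

lemma beta_zero_if:
  assumes "x \<in> Vmod l" "u \<in> Vmod l" "\<And>i. i \<le> l \<Longrightarrow> coord u i = 0"
  shows "\<beta> x u = 0"
proof -
  have "\<beta> x u = 0 \<and> x \<in> Vmod l"
    using assms(1)
  proof (induction rule: tdeg_induct)
    case (mon w)
    then obtain i where "w = [i]" "i \<le> l" by (auto simp: One_nat_def length_Suc_conv)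
    thus ?case using assms(3) by (simp add: coord_def)
  qed (use assms(2) in \<open>auto simp: beta_0 beta_add beta_sc subspD[OF subsp_tdeg]\<close>)
  thus ?thesis ..
qed

text \<open>Invariance under \<open>K\<close> makes weight spaces orthogonal unless their weights add up to zero.\<close>

lemma beta_weight:
  assumes "i \<le> l" "j \<le> l" "i + j \<noteq> l"
  shows "\<beta> (mon [i]) (mon [j]) = 0"
proof -
  have V: "mon [i] \<in> Vmod l" "mon [j] \<in> Vmod l" using assms by simp_all
  have "(\<Sum>(g1, g2) \<leftarrow> copr UK. \<beta> (act l g1 (mon [i])) (act l g2 (mon [j]))) = counit UK * \<beta> (mon [i]) (mon [j])"
    using dual V unfolding dual_pairing_def by blast
  hence "\<beta> (sc (qq powi (int l - 2 * int i)) * mon [i]) (sc (qq powi (int l - 2 * int j)) * mon [j]) = \<beta> (mon [i]) (mon [j])"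
    by (simp add: act_mon)
  hence "(qq powi (int l - 2 * int i) * qq powi (int l - 2 * int j)) * \<beta> (mon [i]) (mon [j]) = \<beta> (mon [i]) (mon [j])"
    using V by (simp add: beta_sc subspD(3)[OF subsp_tdeg] mult_ac)
  moreover have "qq powi (int l - 2 * int i) * qq powi (int l - 2 * int j) \<noteq> 1"
    unfolding qq_powi_mult using assms(3) by simp
  ultimately show ?thesis by simp
qed

lemma beta_corner: "i \<le> l \<Longrightarrow> \<beta> (mon [i]) (mon [l - i]) \<noteq> 0"
proof
  assume i: "i \<le> l" and z: "\<beta> (mon [i]) (mon [l - i]) = 0"
  have "mon [i] \<noteq> 0" using keys_mon[of "[i]"] by force
  then obtain y where y: "y \<in> Vmod l" "\<beta> (mon [i]) y \<noteq> 0" using nondeg(1)[OF Vmod_mon[OF i]] by blast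
  have "\<beta> (mon [i]) y = 0 \<and> y \<in> Vmod l"
    using y(1)
  proof (induction rule: tdeg_induct)
    case (mon w)
    then obtain j where "w = [j]" "j \<le> l" by (auto simp: One_nat_def length_Suc_conv)
    thus ?case using z beta_weight[OF i, of j] by (cases "j = l - i") auto
  qed (use i in \<open>auto simp: beta_0 beta_add beta_sc subspD[OF subsp_tdeg]\<close>)
  with y(2) show False by simp
qed

text \<open>The vector that represents the linear form with values \<open>f\<close>: up to scalars, \<open>v\<^bsub>l-j\<^esub>\<close> is dual to
  \<open>v\<^sub>j\<close>.\<close>

definition point_of :: "(nat \<Rightarrow> kq) \<Rightarrow> tens" where
  "point_of f = (\<Sum>j\<le>l. sc (f j / \<beta> (mon [j]) (mon [l - j])) * mon [l - j])"

lemma point_of_V: "point_of f \<in> Vmod l"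
  unfolding point_of_def by (intro subsp_sum[OF subsp_tdeg] subspD(3)[OF subsp_tdeg]) simp

lemma beta_sum:
  assumes "x \<in> Vmod l" "\<And>j. j \<in> A \<Longrightarrow> g j \<in> Vmod l"
  shows "\<beta> x (sum g A) = (\<Sum>j\<in>A. \<beta> x (g j))"
  using assms(2)
proof (induction A rule: infinite_finite_induct)
  case (insert a A)
  thus ?case using assms(1) by (simp add: beta_add subsp_sum[OF subsp_tdeg])
qed (simp_all add: beta_0 assms(1))

lemma coord_point_of: "i \<le> l \<Longrightarrow> coord (point_of f) i = f i"
proof -
  assume i: "i \<le> l"
  have "coord (point_of f) i = (\<Sum>j\<le>l. f j / \<beta> (mon [j]) (mon [l - j]) * \<beta> (mon [i]) (mon [l - j]))"
    unfolding coord_def point_of_def using i by (subst beta_sum) (auto simp: beta_sc subspD(3)[OF subsp_tdeg])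
  also have "\<dots> = (\<Sum>j\<le>l. if j = i then f i else 0)"
    using i beta_weight[of i "l - j" for j] beta_corner[OF i] by (intro sum.cong) auto
  finally show ?thesis using i by simp
qed

lemma coord_linear: "u \<in> Vmod l \<Longrightarrow> v \<in> Vmod l \<Longrightarrow> i \<le> l \<Longrightarrow> coord (u - v) i = coord u i - coord v i"
  "u \<in> Vmod l \<Longrightarrow> i \<le> l \<Longrightarrow> coord (sc c * u) i = c * coord u i"
proof -
  show s: "u \<in> Vmod l \<Longrightarrow> i \<le> l \<Longrightarrow> coord (sc c * u) i = c * coord u i" for u c i by (simp add: coord_def beta_sc)
  show "u \<in> Vmod l \<Longrightarrow> v \<in> Vmod l \<Longrightarrow> i \<le> l \<Longrightarrow> coord (u - v) i = coord u i - coord v i"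
    using beta_add(2)[of "mon [i]" u "- v"] s[of v i "-1"]
    by (simp add: coord_def sc_minus subspD[OF subsp_tdeg])
qed

lemma coord_inj: "u \<in> Vmod l \<Longrightarrow> v \<in> Vmod l \<Longrightarrow> (\<And>i. i \<le> l \<Longrightarrow> coord u i = coord v i) \<Longrightarrow> u = v"
proof (rule ccontr)
  assume uv: "u \<in> Vmod l" "v \<in> Vmod l" "\<And>i. i \<le> l \<Longrightarrow> coord u i = coord v i" "u \<noteq> v"
  hence "u - v \<in> Vmod l" "u - v \<noteq> 0" by (simp_all add: subspD[OF subsp_tdeg])
  then obtain x where "x \<in> Vmod l" "\<beta> x (u - v) \<noteq> 0" using nondeg(2) by blast
  moreover have "\<beta> x (u - v) = 0" if "x \<in> Vmod l" for x
    by (rule beta_zero_if[OF that \<open>u - v \<in> Vmod l\<close>]) (simp add: coord_linear uv)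
  ultimately show False by simp
qed

text \<open>The line of vectors that represent multiples of \<open>f\<close>.\<close>

definition line_of :: "(nat \<Rightarrow> kq) \<Rightarrow> tens set" where
  "line_of f = {u \<in> Vmod l. \<exists>c. \<forall>j\<le>l. coord u j = c * f j}"

lemma line_of_eq: "line_of f = {sc c * point_of f | c. True}"
proof
  show "line_of f \<subseteq> {sc c * point_of f | c. True}"
  proof
    fix u assume "u \<in> line_of f"
    then obtain c where u: "u \<in> Vmod l" and c: "\<forall>j\<le>l. coord u j = c * f j" by (auto simp: line_of_def)
    have "u = sc c * point_of f"
      by (rule coord_inj[OF u]) (simp_all add: c coord_linear coord_point_of point_of_V subspD[OF subsp_tdeg])
    thus "u \<in> {sc c * point_of f | c. True}" by blast
  qed
  show "{sc c * point_of f | c. True} \<subseteq> line_of f"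
    by (auto simp: line_of_def coord_linear coord_point_of point_of_V subspD[OF subsp_tdeg] intro!: exI)
qed

lemma point_of_eq_0: "point_of f = 0 \<longleftrightarrow> (\<forall>i\<le>l. f i = 0)"
proof
  assume "point_of f = 0"
  thus "\<forall>i\<le>l. f i = 0" using coord_point_of[of _ f] beta_0(2) by (auto simp: coord_def)
next
  assume "\<forall>i\<le>l. f i = 0"
  thus "point_of f = 0" by (simp add: point_of_def)
qed

lemma proj_space_line_of: "proj_space l = {line_of f | f. \<exists>i\<le>l. f i \<noteq> 0}"
proof
  show "{line_of f | f. \<exists>i\<le>l. f i \<noteq> 0} \<subseteq> proj_space l"
    unfolding proj_space_def line_of_eq using point_of_V point_of_eq_0 by fastforce
  show "proj_space l \<subseteq> {line_of f | f. \<exists>i\<le>l. f i \<noteq> 0}"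
  proof
    fix L assume "L \<in> proj_space l"
    then obtain u where u: "u \<in> Vmod l" "u \<noteq> 0" "L = {sc c * u | c. True}" by (auto simp: proj_space_def)
    have p: "point_of (coord u) = u" by (rule coord_inj) (simp_all add: point_of_V u coord_point_of)
    hence "L = line_of (coord u)" "\<exists>i\<le>l. coord u i \<noteq> 0" using u point_of_eq_0[of "coord u"] by (auto simp: line_of_eq)
    thus "L \<in> {line_of f | f. \<exists>i\<le>l. f i \<noteq> 0}" by blast
  qed
qed

lemma line_of_eq_iff:
  assumes "\<exists>i\<le>l. g i \<noteq> 0"
  shows "line_of f = line_of g \<Longrightarrow> \<exists>c. c \<noteq> 0 \<and> (\<forall>i\<le>l. g i = c * f i)"
proof -
  assume "line_of f = line_of g"
  moreover have "point_of g \<in> line_of g" unfolding line_of_eq using exI[of "\<lambda>c. point_of g = sc c * point_of g" 1] by simp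
  ultimately have "point_of g \<in> line_of f" by simp
  then obtain c where c: "\<forall>j\<le>l. coord (point_of g) j = c * f j" unfolding line_of_def by blast
  hence "\<forall>j\<le>l. g j = c * f j" by (simp add: coord_point_of)
  moreover have "c \<noteq> 0" using calculation assms by auto
  ultimately show ?thesis by blast
qed

text \<open>On points given by forms \<open>R\<^sub>k\<close> a tensor, regarded as a multilinear form, takes the value of \<open>R\<^sub>0
  \<otimes> R\<^sub>1 \<otimes> \<dots>\<close> on it, up to the scalars by which the chosen vectors differ from the representing ones.\<close>

lemma form_eval_ev:
  assumes "t \<in> tdeg l d" "length us = d" "\<And>k. k < d \<Longrightarrow> us ! k \<in> line_of (R k)"
  shows "\<exists>c. form_eval \<beta> t us = c * ev R 0 t"
    and "(\<And>k. k < d \<Longrightarrow> us ! k = point_of (R k)) \<Longrightarrow> form_eval \<beta> t us = ev R 0 t"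
proof -
  define Q where "Q k i = coord (us ! k) i" for k i
  have fe: "form_eval \<beta> t us = ev Q 0 t"
    unfolding form_eval_def ev_def wsum_def
    by (rule sum.cong) (use assms(1,2) in \<open>auto simp: evw_prod tdeg_def Q_def coord_def intro!: prod.cong\<close>)
  have "\<forall>k. \<exists>c. k < d \<longrightarrow> (\<forall>j\<le>l. Q k j = c * R k j)"
    using assms(3) by (auto simp: line_of_def Q_def)
  then obtain c where c: "\<And>k j. k < d \<Longrightarrow> j \<le> l \<Longrightarrow> Q k j = c k * R k j" by metis
  define Q' where "Q' k i = c k * R k i" for k i
  have evc: "ev Q 0 t = ev Q' 0 t" if "\<And>k j. k < d \<Longrightarrow> j \<le> l \<Longrightarrow> Q k j = Q' k j" for Q Q'
    unfolding ev_def
  proof (rule wsum_cong)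
    fix w assume "w \<in> Poly_Mapping.keys t"
    hence w: "length (letters w) = d" "set (letters w) \<subseteq> {..l}" using assms(1) by (auto simp: tdeg_def)
    show "evw Q 0 (letters w) = evw Q' 0 (letters w)"
      unfolding evw_prod
    proof (intro prod.cong refl)
      fix k assume "k \<in> {..<length (letters w)}"
      hence k: "k < d" "letters w ! k \<in> set (letters w)" using w by simp_all
      with w(2) have "letters w ! k \<le> l" by blast
      with that[of k] k show "Q (0 + k) (letters w ! k) = Q' (0 + k) (letters w ! k)" by simp
    qed
  qed
  have "ev Q 0 t = ev Q' 0 t" by (rule evc) (simp add: c Q'_def)
  also have "\<dots> = (\<Prod>j<d. c (0 + j)) * ev R 0 t"
    by (rule ev_scale[OF assms(1)]) (simp add: Q'_def)
  finally have "form_eval \<beta> t us = (\<Prod>j<d. c (0 + j)) * ev R 0 t" unfolding fe .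
  thus "\<exists>c. form_eval \<beta> t us = c * ev R 0 t" by (rule exI)
  assume "\<And>k. k < d \<Longrightarrow> us ! k = point_of (R k)"
  thus "form_eval \<beta> t us = ev R 0 t"
    unfolding fe by (intro evc) (simp add: Q_def coord_point_of)
qed

definition nonzero_rows :: "(nat \<Rightarrow> nat \<Rightarrow> kq) \<Rightarrow> bool" where
  "nonzero_rows R \<longleftrightarrow> (\<forall>s. \<exists>i\<le>l. R s i \<noteq> 0)"

lemma inv_limit_line_of:
  assumes R: "nonzero_rows R"
  shows "(\<lambda>k. line_of (R k)) \<in> inv_limit l \<beta> I \<longleftrightarrow> (\<forall>d. \<forall>t\<in>I \<inter> tdeg l d. ev R 0 t = 0)"
proof
  assume L: "(\<lambda>k. line_of (R k)) \<in> inv_limit l \<beta> I"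
  show "\<forall>d. \<forall>t\<in>I \<inter> tdeg l d. ev R 0 t = 0"
  proof (intro allI ballI)
    fix d t assume t: "t \<in> I \<inter> tdeg l d"
    let ?us = "map (\<lambda>k. point_of (R k)) [0..<d]"
    have us: "?us ! k \<in> line_of (R k)" if "k < d" for k
      using that exI[of "\<lambda>c. point_of (R k) = sc c * point_of (R k)" 1] by (simp add: line_of_eq)
    have "map (\<lambda>k. line_of (R k)) [0..<d] \<in> zero_locus l \<beta> I d" using L by (simp add: inv_limit_def)
    hence "form_eval \<beta> t ?us = 0"
      using t us unfolding zero_locus_def by fastforce
    thus "ev R 0 t = 0" using form_eval_ev(2)[of t d ?us R] t us by simp
  qed
next
  assume z: "\<forall>d. \<forall>t\<in>I \<inter> tdeg l d. ev R 0 t = 0"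
  show "(\<lambda>k. line_of (R k)) \<in> inv_limit l \<beta> I"
    unfolding inv_limit_def zero_locus_def
  proof (intro CollectI allI conjI ballI impI)
    fix d
    show "length (map (\<lambda>k. line_of (R k)) [0..<d]) = d" by simp
    show "set (map (\<lambda>k. line_of (R k)) [0..<d]) \<subseteq> proj_space l"
      using R unfolding proj_space_line_of nonzero_rows_def by fastforce
    fix t us assume t: "t \<in> I \<inter> tdeg l d" and us: "length us = d" "\<forall>k<d. us ! k \<in> map (\<lambda>k. line_of (R k)) [0..<d] ! k"
    have "us ! k \<in> line_of (R k)" if "k < d" for k using us that by simp
    with form_eval_ev(1)[of t d us R] t us z show "form_eval \<beta> t us = 0" by auto
  qed
qed

lemma inv_limit_obtain:
  assumes "p \<in> inv_limit l \<beta> I"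
  obtains R where "nonzero_rows R" "p = (\<lambda>k. line_of (R k))"
proof -
  have "p k \<in> proj_space l" for k
  proof -
    have "map p [0..<Suc k] \<in> zero_locus l \<beta> I (Suc k)" using assms by (simp only: inv_limit_def mem_Collect_eq)
    hence "set (map p [0..<Suc k]) \<subseteq> proj_space l" by (simp only: zero_locus_def mem_Collect_eq)
    thus ?thesis by simp
  qed
  hence "\<forall>k. \<exists>f. p k = line_of f \<and> (\<exists>i\<le>l. f i \<noteq> 0)" unfolding proj_space_line_of by blast
  then obtain R where "\<forall>k. p k = line_of (R k) \<and> (\<exists>i\<le>l. R k i \<noteq> 0)" by metis
  thus ?thesis using that[of R] by (auto simp: nonzero_rows_def)
qed

text \<open>Vanishing of the evaluation from place zero on implies vanishing at every place \<open>s\<close>, as one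
  may multiply a relation by a word of length \<open>s\<close> on which the first \<open>s\<close> forms do not vanish.\<close>

lemma chain_iff_ideal:
  assumes R: "nonzero_rows R"
  shows "chain l R \<longleftrightarrow> (\<forall>d. \<forall>t\<in>sym_ideal l \<inter> tdeg l d. ev R 0 t = 0)"
proof
  assume "chain l R"
  thus "\<forall>d. \<forall>t\<in>sym_ideal l \<inter> tdeg l d. ev R 0 t = 0" using ev_sym_ideal by blast
next
  assume z: "\<forall>d. \<forall>t\<in>sym_ideal l \<inter> tdeg l d. ev R 0 t = 0"
  show "chain l R"
    unfolding chain_def kills_def
  proof (intro allI ballI)
    fix s h assume h: "h \<in> ext_square l"
    have h2: "h \<in> tdeg l 2" using h ext_square_T2 by blast
    have "\<exists>w. length w = s \<and> set w \<subseteq> {..l} \<and> evw R 0 w \<noteq> 0"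
    proof (induction s)
      case (Suc s)
      then obtain w where w: "length w = s" "set w \<subseteq> {..l}" "evw R 0 w \<noteq> 0" by blast
      obtain i where i: "i \<le> l" "R s i \<noteq> 0" using R by (auto simp: nonzero_rows_def)
      show ?case by (rule exI[of _ "w @ [i]"]) (use w i in \<open>simp add: evw_append\<close>)
    qed simp
    then obtain w where w: "length w = s" "set w \<subseteq> {..l}" "evw R 0 w \<noteq> 0" by blast
    have "mon w * h \<in> sym_ideal l"
      using h ext_square_sym_ideal w(2) by (intro sym_ideal_mult) auto
    moreover have m: "mon w \<in> tdeg l s" using w by simp
    ultimately have "ev R 0 (mon w * h) = 0" using z tdeg_mult[OF m h2] by blast
    hence "ev R s h = 0" using w(3) by (simp add: ev_mult[OF m])
    thus "ev2 (R s) (R (Suc s)) h = 0" by (simp add: ev_ev2[OF h2])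
  qed
qed

lemma inv_limit_sym_ideal: "inv_limit l \<beta> (sym_ideal l) = {\<lambda>k. line_of (R k) | R. nonzero_rows R \<and> chain l R}"
proof (intro equalityI subsetI)
  fix p assume p: "p \<in> inv_limit l \<beta> (sym_ideal l)"
  obtain R where R: "nonzero_rows R" "p = (\<lambda>k. line_of (R k))" by (rule inv_limit_obtain[OF p])
  with p have "chain l R" using inv_limit_line_of chain_iff_ideal by simp
  with R show "p \<in> {\<lambda>k. line_of (R k) | R. nonzero_rows R \<and> chain l R}" by blast
next
  fix p assume "p \<in> {\<lambda>k. line_of (R k) | R. nonzero_rows R \<and> chain l R}"
  thus "p \<in> inv_limit l \<beta> (sym_ideal l)" using inv_limit_line_of chain_iff_ideal by auto
qed

text \<open>More relations have fewer zeros, which is one inclusion; the other one is the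
  classification of chains.\<close>

lemma geometric_object_eq:
  assumes "module_embedding l n d \<phi>" "n \<in> {1, 2}" "n * d = l" "l \<ge> 1" "odd l \<or> n = 2"
  shows "geometric_object l \<beta> (veronese n d) \<phi> = inv_limit l \<beta> (sym_ideal l)"
proof -
  interpret veronese_embedding l n d \<phi> by standard (use assms in auto)
  show ?thesis
    unfolding geometric_object_def kernel_phi
  proof (intro equalityI subsetI)
    fix p assume p: "p \<in> inv_limit l \<beta> {t \<in> TT l. Lift t \<in> sym_ideal n}"
    obtain R where R: "nonzero_rows R" "p = (\<lambda>k. line_of (R k))" by (rule inv_limit_obtain[OF p])
    have "sym_ideal l \<subseteq> {t \<in> TT l. Lift t \<in> sym_ideal n}"
      using sym_ideal_kernel sym_ideal_TT by blast
    moreover have "\<forall>d. \<forall>t\<in>{t \<in> TT l. Lift t \<in> sym_ideal n} \<inter> tdeg l d. ev R 0 t = 0"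
      using p unfolding R(2) inv_limit_line_of[OF R(1)] .
    ultimately show "p \<in> inv_limit l \<beta> (sym_ideal l)"
      unfolding R(2) inv_limit_line_of[OF R(1)] by (meson IntD1 IntD2 IntI subsetD)
  next
    fix p assume "p \<in> inv_limit l \<beta> (sym_ideal l)"
    then obtain R where R: "nonzero_rows R" "chain l R" "p = (\<lambda>k. line_of (R k))" by (auto simp: inv_limit_sym_ideal)
    have "ev R 0 t = 0" if "t \<in> {t \<in> TT l. Lift t \<in> sym_ideal n} \<inter> tdeg l k" for t k
      using chain_kernel[OF assms(5) R(2), of t k] R(1) that by (auto simp: nonzero_rows_def)
    thus "p \<in> inv_limit l \<beta> {t \<in> TT l. Lift t \<in> sym_ideal n}"
      unfolding R(3) inv_limit_line_of[OF R(1)] by blast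
  qed
qed

end

section \<open>The module of a chain\<close>

text \<open>Coordinates of the elements of a point module with respect to bases of its homogeneous
  components, and the action on them that a sequence of forms defines: a word of length \<open>d\<close> moves
  the coordinate of degree \<open>n - d\<close> to degree \<open>n\<close> and multiplies it by the value of \<open>P\<^bsub>n-d\<^esub> \<otimes> \<dots> \<otimes> P\<^bsub>n-1\<^esub>\<close>.\<close>

definition fin_supp :: "(nat \<Rightarrow> kq) set" where
  "fin_supp = {c. finite {i. c i \<noteq> 0}}"

definition unit_fn :: "nat \<Rightarrow> kq \<Rightarrow> nat \<Rightarrow> kq" where
  "unit_fn i a j = (if j = i then a else 0)"

definition fun_add :: "(nat \<Rightarrow> kq) \<Rightarrow> (nat \<Rightarrow> kq) \<Rightarrow> nat \<Rightarrow> kq" where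
  "fun_add c d j = c j + d j"

definition fun_scale :: "kq \<Rightarrow> (nat \<Rightarrow> kq) \<Rightarrow> nat \<Rightarrow> kq" where
  "fun_scale a c j = a * c j"

lemma fin_supp_zero: "(\<lambda>j. 0) \<in> fin_supp" and fin_supp_unit: "unit_fn i a \<in> fin_supp"
  and fin_supp_add: "c \<in> fin_supp \<Longrightarrow> d \<in> fin_supp \<Longrightarrow> fun_add c d \<in> fin_supp" and fin_supp_sm: "c \<in> fin_supp \<Longrightarrow> fun_scale a c \<in> fin_supp"
proof -
  show "c \<in> fin_supp \<Longrightarrow> d \<in> fin_supp \<Longrightarrow> fun_add c d \<in> fin_supp"
    unfolding fin_supp_def fun_add_def
    by (rule CollectI, rule finite_subset[of _ "{i. c i \<noteq> 0} \<union> {i. d i \<noteq> 0}"]) auto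
qed (auto simp: fin_supp_def unit_fn_def fun_scale_def intro: finite_subset[of _ "{i}"])

lemma fun_add_simps: "fun_add (\<lambda>j. 0) c = c" "fun_add c (\<lambda>j. 0) = c" "fun_add (fun_add c d) e = fun_add c (fun_add d e)"
  "fun_add c d = fun_add d c" "fun_add (fun_scale (-1) c) c = (\<lambda>j. 0)"
  by (auto simp: fun_add_def fun_scale_def fun_eq_iff)

lemma fin_supp_induct [consumes 1, case_names zero add]:
  assumes "c \<in> fin_supp" "Q (\<lambda>j. 0)" "\<And>c i a. c \<in> fin_supp \<Longrightarrow> c i = 0 \<Longrightarrow> a \<noteq> 0 \<Longrightarrow> Q c \<Longrightarrow> Q (fun_add (unit_fn i a) c)"
  shows "Q c"
proof -
  have "finite A \<Longrightarrow> (\<And>c. {i. c i \<noteq> 0} = A \<Longrightarrow> Q c)" for A :: "nat set"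
  proof (induction A rule: finite_induct)
    case empty
    hence "c = (\<lambda>j. 0)" by auto
    thus ?case using assms(2) by simp
  next
    case (insert x A)
    let ?d = "\<lambda>j. if j = x then 0 else c j"
    have d: "{i. ?d i \<noteq> 0} = A" using insert by auto
    hence "?d \<in> fin_supp" using insert by (simp add: fin_supp_def)
    moreover have "c x \<noteq> 0" using insert by auto
    moreover have "c = fun_add (unit_fn x (c x)) ?d" by (auto simp: fun_add_def unit_fn_def)
    ultimately show ?case using assms(3)[of ?d x "c x"] insert.IH[OF d] by simp
  qed
  thus ?thesis using assms(1) by (auto simp: fin_supp_def)
qed

definition chain_act :: "(nat \<Rightarrow> nat \<Rightarrow> kq) \<Rightarrow> (nat \<Rightarrow> kq) \<Rightarrow> tens \<Rightarrow> nat \<Rightarrow> kq" where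
  "chain_act P c t n = wsum (\<lambda>w. if length w \<le> n then c (n - length w) * evw P (n - length w) w else 0) t"

lemma chain_act_linear:
  "chain_act P c (s + t) = fun_add (chain_act P c s) (chain_act P c t)" "chain_act P c (sc a * t) = fun_scale a (chain_act P c t)"
  "chain_act P c (s - t) n = chain_act P c s n - chain_act P c t n" "chain_act P c 0 = (\<lambda>j. 0)"
  by (simp_all add: chain_act_def fun_eq_iff wsum_linear fun_add_def fun_scale_def)

lemma chain_act_fun_add: "chain_act P (fun_add c d) t = fun_add (chain_act P c t) (chain_act P d t)"
proof
  fix n
  have "chain_act P (fun_add c d) t n = wsum (\<lambda>w. (if length w \<le> n then c (n - length w) * evw P (n - length w) w else 0)
     + (if length w \<le> n then d (n - length w) * evw P (n - length w) w else 0)) t"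
    unfolding chain_act_def by (rule wsum_cong) (simp add: fun_add_def distrib_right)
  thus "chain_act P (fun_add c d) t n = fun_add (chain_act P c t) (chain_act P d t) n"
    by (simp add: wsum_fun_add chain_act_def fun_add_def)
qed

lemma chain_act_zero: "chain_act P (\<lambda>j. 0) t = (\<lambda>j. 0)"
proof
  fix n
  have "chain_act P (\<lambda>j. 0) t n = wsum (\<lambda>w. 0) t" unfolding chain_act_def by (rule wsum_cong) simp
  thus "chain_act P (\<lambda>j. 0) t n = 0" by simp
qed

lemma chain_act_one: "chain_act P c 1 = c"
proof
  fix n
  have "chain_act P c (mon []) n = c n" unfolding chain_act_def wsum_mon by simp
  thus "chain_act P c 1 n = c n" by simp
qed

lemma chain_act_sc: "chain_act P c (sc a) = fun_scale a c"
  using chain_act_linear(2)[of P c a 1] by (simp add: chain_act_one)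

lemma wsum_swap: "wsum (\<lambda>u. wsum (\<lambda>v. f u v) t) s = wsum (\<lambda>v. wsum (\<lambda>u. f u v) s) t"
  unfolding wsum_def by (simp add: sum_distrib_left sum.swap[of _ "Poly_Mapping.keys t"] mult.left_commute)

lemma chain_act_mult: "chain_act P c (s * t) = chain_act P (chain_act P c s) t"
proof
  fix n
  define f where "f u v = (if length u + length v \<le> n
     then c (n - length u - length v) * evw P (n - length u - length v) (u @ v) else 0)" for u v
  have "chain_act P c (s * t) n = wsum (\<lambda>u. wsum (\<lambda>v. f u v) t) s"
    unfolding chain_act_def wsum_mult f_def by (simp add: diff_diff_left cong: if_cong)
  also have "\<dots> = wsum (\<lambda>v. wsum (\<lambda>u. f u v) s) t" by (rule wsum_swap)
  also have "\<dots> = chain_act P (chain_act P c s) t n"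
    unfolding chain_act_def[of P "chain_act P c s"]
  proof (rule wsum_cong)
    fix w
    let ?v = "letters w"
    show "wsum (\<lambda>u. f u ?v) s = (if length ?v \<le> n then chain_act P c s (n - length ?v) * evw P (n - length ?v) ?v else 0)"
    proof (cases "length ?v \<le> n")
      case True
      have "wsum (\<lambda>u. f u ?v) s = wsum (\<lambda>u. evw P (n - length ?v) ?v *
        (if length u \<le> n - length ?v then c (n - length ?v - length u) * evw P (n - length ?v - length u) u else 0)) s"
      proof (rule wsum_cong)
        fix x
        let ?u = "letters x"
        show "f ?u ?v = evw P (n - length ?v) ?v *
        (if length ?u \<le> n - length ?v then c (n - length ?v - length ?u) * evw P (n - length ?v - length ?u) ?u else 0)"
        proof (cases "length ?u + length ?v \<le> n")
          case t: True
          hence "n - length ?u - length ?v + length ?u = n - length ?v"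
            "n - length ?v - length ?u = n - length ?u - length ?v" by auto
          thus ?thesis using t True by (simp add: f_def evw_append)
        qed (use True in \<open>auto simp: f_def\<close>)
      qed
      thus ?thesis using True by (simp add: wsum_fmult chain_act_def mult.commute)
    next
      case False
      have "wsum (\<lambda>u. f u ?v) s = wsum (\<lambda>u. 0) s"
        by (rule wsum_cong) (use False in \<open>auto simp: f_def\<close>)
      thus ?thesis using False by simp
    qed
  qed
  finally show "chain_act P c (s * t) n = chain_act P (chain_act P c s) t n" .
qed

lemma chain_act_unit_mon: "chain_act P (unit_fn i a) (mon w) = unit_fn (i + length w) (a * evw P i w)"
  by (auto simp: chain_act_def fun_eq_iff unit_fn_def)

lemma chain_act_unit_tdeg: "t \<in> tdeg l d \<Longrightarrow> chain_act P (unit_fn i a) t = unit_fn (i + d) (a * ev P i t)"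
proof (induction rule: tdeg_induct)
  case (mon w)
  thus ?case by (simp add: chain_act_unit_mon)
qed (auto simp: chain_act_linear fun_add_def fun_scale_def unit_fn_def ev_simps fun_eq_iff algebra_simps)

lemma chain_act_fin_supp: "c \<in> fin_supp \<Longrightarrow> chain_act P c t \<in> fin_supp"
proof (induction rule: fin_supp_induct)
  case zero
  show ?case by (simp add: chain_act_zero fin_supp_zero)
next
  case (add c i a)
  have "chain_act P (unit_fn i a) t \<in> fin_supp"
    by (induction t rule: tens_induct) (simp_all add: chain_act_linear fin_supp_zero fin_supp_add fin_supp_sm chain_act_unit_mon fin_supp_unit)
  with add show ?case by (simp add: chain_act_fun_add fin_supp_add)
qed

text \<open>On a relation of degree two the action involves the value of \<open>P\<^bsub>n-2\<^esub> \<otimes> P\<^bsub>n-1\<^esub>\<close> only, and the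
  annihilator of all coordinates is an ideal.\<close>

lemma chain_act_sym_ideal:
  assumes P: "chain l P" and t: "t \<in> sym_ideal l"
  shows "chain_act P c t = (\<lambda>j. 0)"
proof -
  have "sym_ideal l \<subseteq> {t. \<forall>c. chain_act P c t = (\<lambda>j. 0)}"
  proof (rule sym_ideal_minimal)
    show "subsp {t. \<forall>c. chain_act P c t = (\<lambda>j. 0)}"
      by (auto simp: subsp_def chain_act_linear fun_add_def fun_scale_def fun_eq_iff)
    show "ext_square l \<subseteq> {t. \<forall>c. chain_act P c t = (\<lambda>j. 0)}"
    proof (intro subsetI CollectI allI ext)
      fix h c n assume h: "h \<in> ext_square l"
      hence h2: "h \<in> tdeg l 2" using ext_square_T2 by blast
      have "chain_act P c h n = wsum (\<lambda>w. (if 2 \<le> n then c (n - 2) else 0) * evw P (n - 2) w) h"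
        unfolding chain_act_def by (rule wsum_cong) (use h2 in \<open>auto simp: tdeg_def\<close>)
      also have "\<dots> = (if 2 \<le> n then c (n - 2) else 0) * ev P (n - 2) h"
        by (simp only: wsum_fmult ev_def)
      also have "ev P (n - 2) h = 0"
        using P h by (simp add: ev_ev2[OF h2] chain_def kills_def)
      finally show "chain_act P c h n = 0" by simp
    qed
    fix x t assume "x \<in> {t. \<forall>c. chain_act P c t = (\<lambda>j. 0)}"
    thus "t * x \<in> {t. \<forall>c. chain_act P c t = (\<lambda>j. 0)} \<and> x * t \<in> {t. \<forall>c. chain_act P c t = (\<lambda>j. 0)}"
      by (simp add: chain_act_mult chain_act_zero)
  qed
  with t show ?thesis by blast
qed

section \<open>Standard forms of point modules\<close>

text \<open>\<open>M\<close> is isomorphic, by means of \<open>\<Psi>\<close>, to the graded module of coordinates on which \<open>V\<^sub>l\<close> acts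
  through the forms \<open>P\<close>.\<close>

definition realizes :: "nat \<Rightarrow> (tens set, 'm) gmod \<Rightarrow> (nat \<Rightarrow> nat \<Rightarrow> kq) \<Rightarrow> ((nat \<Rightarrow> kq) \<Rightarrow> 'm) \<Rightarrow> bool" where
  "realizes l M P \<Psi> \<longleftrightarrow> bij_betw \<Psi> fin_supp (carrier M) \<and>
     (\<forall>c\<in>fin_supp. \<forall>d\<in>fin_supp. \<Psi> (fun_add c d) = \<Psi> c \<oplus>\<^bsub>M\<^esub> \<Psi> d) \<and>
     (\<forall>c\<in>fin_supp. \<forall>t\<in>TT l. ract M (\<Psi> c) (cls l t) = \<Psi> (chain_act P c t)) \<and>
     (\<forall>i. mcomp M i = \<Psi> ` range (unit_fn i))"

lemma realizesD:
  assumes "realizes l M P \<Psi>"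
  shows "bij_betw \<Psi> fin_supp (carrier M)" "inj_on \<Psi> fin_supp" "\<Psi> ` fin_supp = carrier M"
    "c \<in> fin_supp \<Longrightarrow> d \<in> fin_supp \<Longrightarrow> \<Psi> (fun_add c d) = \<Psi> c \<oplus>\<^bsub>M\<^esub> \<Psi> d"
    "c \<in> fin_supp \<Longrightarrow> t \<in> TT l \<Longrightarrow> ract M (\<Psi> c) (cls l t) = \<Psi> (chain_act P c t)"
    "mcomp M i = \<Psi> ` range (unit_fn i)"
proof -
  note r = assms[unfolded realizes_def]
  show b: "bij_betw \<Psi> fin_supp (carrier M)" by (rule conjunct1[OF r])
  show "inj_on \<Psi> fin_supp" "\<Psi> ` fin_supp = carrier M" using b by (simp_all add: bij_betw_def)
  show "c \<in> fin_supp \<Longrightarrow> d \<in> fin_supp \<Longrightarrow> \<Psi> (fun_add c d) = \<Psi> c \<oplus>\<^bsub>M\<^esub> \<Psi> d"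
    using r by simp
  show "c \<in> fin_supp \<Longrightarrow> t \<in> TT l \<Longrightarrow> ract M (\<Psi> c) (cls l t) = \<Psi> (chain_act P c t)"
    using r by simp
  show "mcomp M i = \<Psi> ` range (unit_fn i)"
    using r by simp
qed

lemma realizes_zero:
  assumes "realizes l M P \<Psi>" "abelian_group M"
  shows "\<Psi> (\<lambda>j. 0) = \<zero>\<^bsub>M\<^esub>"
proof -
  interpret abelian_group M by (rule assms(2))
  have c: "\<Psi> (\<lambda>j. 0) \<in> carrier M" using realizesD(3)[OF assms(1)] fin_supp_zero by blast
  have "\<Psi> (\<lambda>j. 0) \<oplus>\<^bsub>M\<^esub> \<Psi> (\<lambda>j. 0) = \<Psi> (\<lambda>j. 0)"
    using realizesD(4)[OF assms(1) fin_supp_zero fin_supp_zero] by (simp add: fun_add_simps)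
  thus ?thesis using c by (metis add.r_cancel_one')
qed

lemma realizes_iso:
  assumes M: "realizes l M P \<Psi>" and N: "realizes l N P \<Xi>"
  shows "gmod_iso (sym_alg l) M N"
proof -
  define h where "h = \<Xi> \<circ> inv_into fin_supp \<Psi>"
  have h: "h (\<Psi> c) = \<Xi> c" if "c \<in> fin_supp" for c
    using that realizesD(2)[OF M] by (simp add: h_def)
  have ex: "\<exists>c\<in>fin_supp. x = \<Psi> c" if "x \<in> carrier M" for x
    using that realizesD(3)[OF M] by blast
  show ?thesis
    unfolding gmod_iso_def
  proof (intro exI[of _ h] conjI ballI allI)
    show "bij_betw h (carrier M) (carrier N)"
      unfolding h_def by (rule bij_betw_trans[OF bij_betw_inv_into[OF realizesD(1)[OF M]] realizesD(1)[OF N]])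
    fix x assume x: "x \<in> carrier M"
    then obtain c where c: "c \<in> fin_supp" "x = \<Psi> c" using ex by blast
    show "h (x \<oplus>\<^bsub>M\<^esub> y) = h x \<oplus>\<^bsub>N\<^esub> h y" if y: "y \<in> carrier M" for y
    proof -
      obtain d where d: "d \<in> fin_supp" "y = \<Psi> d" using ex[OF y] by blast
      show ?thesis
        unfolding c(2) d(2) h[OF c(1)] h[OF d(1)] realizesD(4)[OF N c(1) d(1), symmetric]
          realizesD(4)[OF M c(1) d(1), symmetric] by (rule h[OF fin_supp_add[OF c(1) d(1)]])
    qed
    show "h (ract M x a) = ract N (h x) a" if a: "a \<in> carrier (sym_alg l)" for a
    proof -
      obtain t where t: "t \<in> TT l" "a = cls l t" using a by (auto simp: cls_carrier)
      show ?thesis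
        unfolding c(2) t(2) h[OF c(1)] realizesD(5)[OF M c(1) t(1)] realizesD(5)[OF N c(1) t(1)]
        by (rule h[OF chain_act_fin_supp[OF c(1)]])
    qed
  next
    fix i
    have "h ` mcomp M i = (\<lambda>a. h (\<Psi> (unit_fn i a))) ` UNIV"
      unfolding realizesD(6)[OF M] by (simp add: image_image)
    also have "\<dots> = mcomp N i"
      unfolding realizesD(6)[OF N] by (simp add: h fin_supp_unit image_image)
    finally show "h ` mcomp M i = mcomp N i" .
  qed
qed

lemma iso_realizes:
  assumes M: "realizes l M P \<Psi>" and iso: "gmod_iso (sym_alg l) M N"
  shows "\<exists>\<Xi>. realizes l N P \<Xi>"
proof -
  obtain h where h0: "bij_betw h (carrier M) (carrier N) \<and>
     (\<forall>x\<in>carrier M. \<forall>y\<in>carrier M. h (x \<oplus>\<^bsub>M\<^esub> y) = h x \<oplus>\<^bsub>N\<^esub> h y) \<and>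
     (\<forall>x\<in>carrier M. \<forall>a\<in>carrier (sym_alg l). h (ract M x a) = ract N (h x) a) \<and>
     (\<forall>i. h ` mcomp M i = mcomp N i)"
    using iso unfolding gmod_iso_def by (elim exE)
  hence h: "bij_betw h (carrier M) (carrier N)"
    "\<And>x y. x \<in> carrier M \<Longrightarrow> y \<in> carrier M \<Longrightarrow> h (x \<oplus>\<^bsub>M\<^esub> y) = h x \<oplus>\<^bsub>N\<^esub> h y"
    "\<And>x a. x \<in> carrier M \<Longrightarrow> a \<in> carrier (sym_alg l) \<Longrightarrow> h (ract M x a) = ract N (h x) a"
    "\<And>i. h ` mcomp M i = mcomp N i"
    by simp_all
  have Psi: "\<Psi> c \<in> carrier M" if "c \<in> fin_supp" for c using realizesD(3)[OF M] that by blast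
  have "realizes l N P (h \<circ> \<Psi>)"
    unfolding realizes_def
  proof (intro conjI ballI allI)
    show "bij_betw (h \<circ> \<Psi>) fin_supp (carrier N)" by (rule bij_betw_trans[OF realizesD(1)[OF M] h(1)])
    fix c assume c: "c \<in> fin_supp"
    show "(h \<circ> \<Psi>) (fun_add c d) = (h \<circ> \<Psi>) c \<oplus>\<^bsub>N\<^esub> (h \<circ> \<Psi>) d" if "d \<in> fin_supp" for d
      using realizesD(4)[OF M c that] h(2)[OF Psi[OF c] Psi[OF that]] by simp
    show "ract N ((h \<circ> \<Psi>) c) (cls l t) = (h \<circ> \<Psi>) (chain_act P c t)" if "t \<in> TT l" for t
      using realizesD(5)[OF M c that] h(3)[OF Psi[OF c] cls_in_carrier[OF that]] by simp
  next
    fix i show "mcomp N i = (h \<circ> \<Psi>) ` range (unit_fn i)"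
      unfolding h(4)[symmetric] realizesD(6)[OF M] by (rule image_comp)
  qed
  thus ?thesis by (rule exI[where x = "h \<circ> \<Psi>"])
qed

text \<open>Rescaling the forms by \<open>\<nu>\<close> corresponds to changing the bases of the homogeneous components by
  the partial products of \<open>1 / \<nu>\<close>.\<close>

lemma realizes_rescale:
  assumes M: "realizes l M P \<Psi>" and nz: "\<And>i. \<nu> i \<noteq> 0" and Q: "\<And>i j. j \<le> l \<Longrightarrow> Q i j = \<nu> i * P i j"
  shows "\<exists>\<Xi>. realizes l M Q \<Xi>"
proof -
  define \<mu> where "\<mu> k = (\<Prod>i<k. 1 / \<nu> i)" for k
  have mu: "\<mu> k \<noteq> 0" "\<mu> (Suc k) * \<nu> k = \<mu> k" for k using nz by (simp_all add: \<mu>_def)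
  define S where "S c = (\<lambda>k. \<mu> k * c k)" for c :: "nat \<Rightarrow> kq"
  define S' where "S' c = (\<lambda>k. c k / \<mu> k)" for c :: "nat \<Rightarrow> kq"
  have SFS: "S c \<in> fin_supp \<longleftrightarrow> c \<in> fin_supp" "S' c \<in> fin_supp \<longleftrightarrow> c \<in> fin_supp" for c
    using mu by (simp_all add: fin_supp_def S_def S'_def)
  have SS: "S (S' c) = c" "S' (S c) = c" for c using mu by (simp_all add: S_def S'_def fun_eq_iff)
  have bS: "bij_betw S fin_supp fin_supp"
    by (rule bij_betw_byWitness[of _ S']) (auto simp: SS SFS)
  have evw: "set w \<subseteq> {..l} \<Longrightarrow> \<mu> (s + length w) * evw Q s w = \<mu> s * evw P s w" for s w
  proof (induction w arbitrary: s)
    case (Cons i w)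
    have "\<mu> (s + length (i # w)) * evw Q s (i # w) = Q s i * (\<mu> (Suc s + length w) * evw Q (Suc s) w)"
      by simp
    also have "\<dots> = (\<nu> s * P s i) * (\<mu> (Suc s) * evw P (Suc s) w)"
      using Cons.IH[of "Suc s"] Cons.prems Q[of i s] by simp
    also have "\<dots> = (\<mu> (Suc s) * \<nu> s) * evw P s (i # w)" by simp
    finally show ?case by (simp only: mu)
  qed simp
  have act: "S (chain_act Q c t) = chain_act P (S c) t" if "t \<in> TT l" for c t
  proof
    fix n
    have "S (chain_act Q c t) n = wsum (\<lambda>w. \<mu> n * (if length w \<le> n then c (n - length w) * evw Q (n - length w) w else 0)) t"
      by (simp add: S_def chain_act_def wsum_fmult)
    also have "\<dots> = chain_act P (S c) t n"
      unfolding chain_act_def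
    proof (rule wsum_cong)
      fix w assume "w \<in> Poly_Mapping.keys t"
      hence w: "set (letters w) \<subseteq> {..l}" using that by (auto simp: TT_def)
      show "\<mu> n * (if length (letters w) \<le> n then c (n - length (letters w)) * evw Q (n - length (letters w)) (letters w) else 0)
        = (if length (letters w) \<le> n then S c (n - length (letters w)) * evw P (n - length (letters w)) (letters w) else 0)"
        using evw[OF w, of "n - length (letters w)"]
        by (cases "length (letters w) \<le> n") (simp_all add: S_def mult_ac)
    qed
    finally show "S (chain_act Q c t) n = chain_act P (S c) t n" .
  qed
  have "realizes l M Q (\<Psi> \<circ> S)"
    unfolding realizes_def
  proof (intro conjI ballI allI)
    show "bij_betw (\<Psi> \<circ> S) fin_supp (carrier M)" by (rule bij_betw_trans[OF bS realizesD(1)[OF M]])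
    fix c assume c: "c \<in> fin_supp"
    show "(\<Psi> \<circ> S) (fun_add c d) = (\<Psi> \<circ> S) c \<oplus>\<^bsub>M\<^esub> (\<Psi> \<circ> S) d" if "d \<in> fin_supp" for d
    proof -
      have "S (fun_add c d) = fun_add (S c) (S d)" by (simp add: S_def fun_add_def fun_eq_iff distrib_left)
      thus ?thesis using realizesD(4)[OF M, of "S c" "S d"] c that SFS by simp
    qed
    show "ract M ((\<Psi> \<circ> S) c) (cls l t) = (\<Psi> \<circ> S) (chain_act Q c t)" if "t \<in> TT l" for t
      using realizesD(5)[OF M _ that, of "S c"] c SFS act[OF that] by simp
  next
    fix i
    have "S ` range (unit_fn i) = range (unit_fn i)"
    proof (intro equalityI subsetI)
      fix x assume "x \<in> S ` range (unit_fn i)"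
      then obtain a where "x = S (unit_fn i a)" by auto
      hence "x = unit_fn i (\<mu> i * a)" by (auto simp: S_def unit_fn_def)
      thus "x \<in> range (unit_fn i)" by blast
    next
      fix x assume "x \<in> range (unit_fn i)"
      then obtain a where "x = unit_fn i a" by auto
      hence "x = S (unit_fn i (a / \<mu> i))" using mu by (auto simp: S_def unit_fn_def)
      thus "x \<in> S ` range (unit_fn i)" by blast
    qed
    thus "mcomp M i = (\<Psi> \<circ> S) ` range (unit_fn i)"
      unfolding realizesD(6)[OF M] by (simp only: image_comp[symmetric])
  qed
  thus ?thesis by (rule exI[where x = "\<Psi> \<circ> S"])
qed

text \<open>With \<open>b\<close> and \<open>b'\<close> multiples of the basis vectors of degrees \<open>i\<close> and \<open>i + 1\<close>, the condition on \<open>u\<close>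
  says that the form \<open>\<beta>(-, u)\<close> is a multiple of \<open>P\<^sub>i\<close>.\<close>

lemma (in pairing) module_points_line_of:
  assumes M: "realizes l M P \<Psi>" "abelian_group M"
  shows "module_points l \<beta> M i = line_of (P i)"
proof -
  have z: "\<Psi> (\<lambda>j. 0) = \<zero>\<^bsub>M\<^esub>" by (rule realizes_zero[OF M])
  have lhs: "ract M (\<Psi> (unit_fn i a)) (cls l x) = \<Psi> (unit_fn (i + 1) (a * ev P i x))" if "x \<in> Vmod l" for a x
    using realizesD(5)[OF M(1) fin_supp_unit, of x i a] that tdeg_TT chain_act_unit_tdeg[OF that] by auto
  have rhs: "ract M (\<Psi> (unit_fn k a)) (scal (sym_alg l) b) = \<Psi> (unit_fn k (b * a))" for k a b
  proof -
    have "fun_scale b (unit_fn k a) = unit_fn k (b * a)" by (auto simp: fun_scale_def unit_fn_def)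
    thus ?thesis using realizesD(5)[OF M(1) fin_supp_unit sc_TT, of k a b] by (simp add: chain_act_sc sym_alg_simps)
  qed
  have inj: "\<Psi> (unit_fn k a) = \<Psi> (unit_fn k b) \<longleftrightarrow> a = b" for k a b
  proof
    assume "\<Psi> (unit_fn k a) = \<Psi> (unit_fn k b)"
    hence "unit_fn k a = unit_fn k b" using realizesD(2)[OF M(1)] fin_supp_unit by (auto dest: inj_onD)
    hence "unit_fn k a k = unit_fn k b k" by simp
    thus "a = b" by (simp add: unit_fn_def)
  qed simp
  have nz: "\<Psi> (unit_fn k a) = \<zero>\<^bsub>M\<^esub> \<longleftrightarrow> a = 0" for k a
  proof -
    have "unit_fn k 0 = (\<lambda>j. 0)" by (auto simp: unit_fn_def)
    thus ?thesis using inj[of k a 0] z by simp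
  qed
  have ext: "(\<forall>x\<in>Vmod l. a * ev P i x = \<beta> x u * a') \<longleftrightarrow> (\<forall>j\<le>l. a * P i j = coord u j * a')" if u: "u \<in> Vmod l" for a a' u
  proof
    assume h: "\<forall>x\<in>Vmod l. a * ev P i x = \<beta> x u * a'"
    show "\<forall>j\<le>l. a * P i j = coord u j * a'"
    proof (intro allI impI)
      fix j assume "j \<le> l"
      thus "a * P i j = coord u j * a'" using h[rule_format, OF Vmod_mon] by (simp add: coord_def)
    qed
  next
    assume h: "\<forall>j\<le>l. a * P i j = coord u j * a'"
    show "\<forall>x\<in>Vmod l. a * ev P i x = \<beta> x u * a'"
    proof
      fix x assume "x \<in> Vmod l"
      hence "a * ev P i x = \<beta> x u * a' \<and> x \<in> Vmod l"
      proof (induction rule: tdeg_induct)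
        case (mon w)
        then obtain j where "w = [j]" "j \<le> l" by (auto simp: One_nat_def length_Suc_conv)
        thus ?case using h by (simp add: coord_def)
      next
        case (add x y)
        thus ?case using u by (simp add: ev_simps beta_add subspD[OF subsp_tdeg] distrib_left distrib_right)
      next
        case (scale c x)
        hence "a * ev P i (sc c * x) = c * (a * ev P i x)" by (simp add: ev_simps)
        also have "\<dots> = \<beta> (sc c * x) u * a'" using scale u by (simp add: beta_sc)
        finally show ?case using scale by (simp add: subspD[OF subsp_tdeg])
      qed (use u in \<open>simp_all add: beta_0 V0\<close>)
      thus "a * ev P i x = \<beta> x u * a'" ..
    qed
  qed
  show ?thesis
  proof (intro equalityI subsetI)
    fix u assume "u \<in> module_points l \<beta> M i"
    then obtain b b' where u: "u \<in> Vmod l" and b: "b \<in> mcomp M i" "b' \<in> mcomp M (i + 1)" "b' \<noteq> \<zero>\<^bsub>M\<^esub>"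
      and e: "\<forall>x\<in>Vmod l. ract M b (cls l x) = ract M b' (scal (sym_alg l) (\<beta> x u))"
      unfolding module_points_def by blast
    obtain a a' where a: "b = \<Psi> (unit_fn i a)" "b' = \<Psi> (unit_fn (i + 1) a')"
      using b(1,2) unfolding realizesD(6)[OF M(1)] by blast
    have a': "a' \<noteq> 0" using b(3) nz a(2) by simp
    have "\<forall>x\<in>Vmod l. a * ev P i x = \<beta> x u * a'"
      using e unfolding a rhs by (simp add: lhs inj)
    hence "\<forall>j\<le>l. a * P i j = coord u j * a'" using ext[OF u] by blast
    hence "\<forall>j\<le>l. coord u j = (a / a') * P i j" using a' by (simp add: field_simps)
    thus "u \<in> line_of (P i)" using u unfolding line_of_def by blast
  next
    fix u assume "u \<in> line_of (P i)"
    then obtain a where u: "u \<in> Vmod l" and a: "\<forall>j\<le>l. coord u j = a * P i j" by (auto simp: line_of_def)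
    hence "\<forall>x\<in>Vmod l. a * ev P i x = \<beta> x u * 1" using ext[OF u, of a 1] by simp
    hence e: "\<forall>x\<in>Vmod l. ract M (\<Psi> (unit_fn i a)) (cls l x) = ract M (\<Psi> (unit_fn (i + 1) 1)) (scal (sym_alg l) (\<beta> x u))"
      unfolding rhs by (simp add: lhs inj)
    have m: "\<Psi> (unit_fn k b) \<in> mcomp M k" for k b
      unfolding realizesD(6)[OF M(1)] by (rule imageI, rule rangeI)
    have n: "\<Psi> (unit_fn (i + 1) 1) \<noteq> \<zero>\<^bsub>M\<^esub>"
      unfolding nz by simp
    show "u \<in> module_points l \<beta> M i"
      unfolding module_points_def
      by (rule CollectI, rule conjI, rule u, rule bexI[OF _ m[of i a]], rule bexI[OF _ m[of "i + 1" 1]],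
          rule conjI, rule n, rule e)
  qed
qed

subsection \<open>Coordinates on a point module\<close>

locale sym_point_module =
  fixes l :: nat and M :: "(tens set, 'm) gmod" (structure)
  assumes pm: "point_module (sym_alg l) M"
begin

lemma graded: "graded_right_module (sym_alg l) M"
  using pm by (simp add: point_module_def)

lemma right: "right_module (sym_alg l) M"
  using graded by (simp add: graded_right_module_def)

sublocale abelian_group M
  using right by (simp add: right_module_def)

definition act_by :: "'m \<Rightarrow> tens \<Rightarrow> 'm" where
  "act_by x t = ract M x (cls l t)"

lemma act_by_closed [simp]: "x \<in> carrier M \<Longrightarrow> t \<in> TT l \<Longrightarrow> act_by x t \<in> carrier M"
  using right by (simp add: right_module_def act_by_def)

lemma act_by_add: "x \<in> carrier M \<Longrightarrow> y \<in> carrier M \<Longrightarrow> t \<in> TT l \<Longrightarrow> act_by (x \<oplus> y) t = act_by x t \<oplus> act_by y t"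
  using right by (simp add: right_module_def act_by_def)

lemma act_by_plus: "x \<in> carrier M \<Longrightarrow> s \<in> TT l \<Longrightarrow> t \<in> TT l \<Longrightarrow> act_by x (s + t) = act_by x s \<oplus> act_by x t"
  using right cls_add[of s l t] by (simp add: right_module_def act_by_def) (metis cls_in_carrier)

lemma act_by_mult: "x \<in> carrier M \<Longrightarrow> s \<in> TT l \<Longrightarrow> t \<in> TT l \<Longrightarrow> act_by x (s * t) = act_by (act_by x s) t"
  using right cls_mult[of s l t] by (simp add: right_module_def act_by_def) (metis cls_in_carrier)

lemma act_by_1: "x \<in> carrier M \<Longrightarrow> act_by x 1 = x"
  using right by (simp add: right_module_def act_by_def cls_one)

lemma act_by_0: "x \<in> carrier M \<Longrightarrow> act_by x 0 = \<zero>"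
  using act_by_plus[of x 0 0] act_by_closed[of x 0] subspD(1)[OF subsp_TT, of l] by (simp add: add.r_cancel_one')

lemma act_by_zero: "t \<in> TT l \<Longrightarrow> act_by \<zero> t = \<zero>"
  using act_by_add[of \<zero> \<zero> t] act_by_closed[of \<zero> t] by (simp add: add.r_cancel_one')

lemma act_by_sc_comm: "x \<in> carrier M \<Longrightarrow> t \<in> TT l \<Longrightarrow> act_by (act_by x (sc a)) t = act_by (act_by x t) (sc a)"
  using act_by_mult[of x "sc a" t] act_by_mult[of x t "sc a"] by (simp add: sc_commute[of t a])

lemma act_by_sc_sc: "x \<in> carrier M \<Longrightarrow> act_by (act_by x (sc a)) (sc b) = act_by x (sc (a * b))"
  by (simp add: sc_mult act_by_mult)

definition basis :: "nat \<Rightarrow> 'm" where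
  "basis = (SOME b. \<forall>i. b i \<in> mcomp M i \<and> b i \<noteq> \<zero> \<and> mcomp M i = {act_by (b i) (sc c) | c. True})"

lemma basis: "basis i \<in> mcomp M i" "basis i \<noteq> \<zero>" "mcomp M i = {act_by (basis i) (sc c) | c. True}"
proof -
  have "\<forall>i. \<exists>b. b \<in> mcomp M i \<and> b \<noteq> \<zero> \<and> mcomp M i = {act_by b (sc c) | c. True}"
    using pm by (auto simp: point_module_def sym_alg_simps act_by_def)
  hence "\<exists>b. \<forall>i. b i \<in> mcomp M i \<and> b i \<noteq> \<zero> \<and> mcomp M i = {act_by (b i) (sc c) | c. True}"
    by (rule choice)
  hence b: "\<forall>i. basis i \<in> mcomp M i \<and> basis i \<noteq> \<zero> \<and> mcomp M i = {act_by (basis i) (sc c) | c. True}"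
    unfolding basis_def by (rule someI_ex)
  show "basis i \<in> mcomp M i" "basis i \<noteq> \<zero>" "mcomp M i = {act_by (basis i) (sc c) | c. True}"
    by (rule conjunct1[OF b[rule_format]], rule conjunct1[OF conjunct2[OF b[rule_format]]],
        rule conjunct2[OF conjunct2[OF b[rule_format]]])
qed

lemma mcomp_carrier: "mcomp M i \<subseteq> carrier M"
  using graded by (simp add: graded_right_module_def additive_subgroup.a_subset)

lemma basis_carrier [simp]: "basis i \<in> carrier M"
  using basis(1) mcomp_carrier by blast

lemma act_by_grade: "x \<in> mcomp M i \<Longrightarrow> t \<in> tdeg l d \<Longrightarrow> act_by x t \<in> mcomp M (i + d)"
  using graded by (simp add: graded_right_module_def act_by_def sym_alg_simps)

lemma act_by_basis_eq_0: "act_by (basis i) (sc a) = \<zero> \<longleftrightarrow> a = 0"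
proof
  assume z: "act_by (basis i) (sc a) = \<zero>"
  show "a = 0"
  proof (rule ccontr)
    assume "a \<noteq> 0"
    hence "act_by (act_by (basis i) (sc a)) (sc (1 / a)) = basis i" by (simp add: act_by_sc_sc act_by_1)
    thus False unfolding z using basis(2)[of i] by (simp add: act_by_zero)
  qed
qed (simp add: act_by_0)

lemma act_by_basis_inj: "act_by (basis i) (sc a) = act_by (basis i) (sc b) \<Longrightarrow> a = b"
proof -
  assume e: "act_by (basis i) (sc a) = act_by (basis i) (sc b)"
  have "act_by (basis i) (sc (a - b) + sc b) = act_by (basis i) (sc (a - b)) \<oplus> act_by (basis i) (sc b)"
    by (simp add: act_by_plus)
  moreover have "sc (a - b) + sc b = sc a" by (simp add: sc_def single_add[symmetric])
  ultimately have "act_by (basis i) (sc (a - b)) \<oplus> act_by (basis i) (sc b) = act_by (basis i) (sc b)" using e by simp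
  hence "act_by (basis i) (sc (a - b)) = \<zero>" by (simp add: add.r_cancel_one')
  thus ?thesis by (simp add: act_by_basis_eq_0)
qed

text \<open>The structure constants of the module: \<open>M\<^sub>i \<times> V\<^sub>l \<rightarrow> M\<^bsub>i+1\<^esub>\<close> in terms of the chosen bases.\<close>

definition structure_const :: "nat \<Rightarrow> nat \<Rightarrow> kq" where
  "structure_const i j = (SOME p. act_by (basis i) (mon [j]) = act_by (basis (Suc i)) (sc p))"

lemma structure_const: "j \<le> l \<Longrightarrow> act_by (basis i) (mon [j]) = act_by (basis (Suc i)) (sc (structure_const i j))"
proof -
  assume "j \<le> l"
  hence "act_by (basis i) (mon [j]) \<in> mcomp M (i + 1)"
    by (intro act_by_grade[OF basis(1)]) (simp add: One_nat_def)
  hence "\<exists>p. act_by (basis i) (mon [j]) = act_by (basis (Suc i)) (sc p)"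
    using basis(3)[of "Suc i"] by (auto simp: One_nat_def)
  thus ?thesis unfolding structure_const_def by (rule someI_ex)
qed

lemma act_by_basis_word: "set w \<subseteq> {..l} \<Longrightarrow> act_by (basis i) (mon w) = act_by (basis (i + length w)) (sc (evw structure_const i w))"
proof (induction w arbitrary: i)
  case Nil
  thus ?case by (simp add: sc_def[of 1, symmetric] act_by_1)
next
  case (Cons j w)
  hence j: "j \<le> l" "mon [j] \<in> TT l" "mon w \<in> TT l" by auto
  have "act_by (basis i) (mon (j # w)) = act_by (act_by (basis i) (mon [j])) (mon w)"
    using j by (simp add: mon_Cons[of j w] act_by_mult)
  also have "\<dots> = act_by (act_by (basis (Suc i)) (mon w)) (sc (structure_const i j))"
    using j by (simp add: structure_const act_by_sc_comm)
  also have "act_by (basis (Suc i)) (mon w) = act_by (basis (Suc i + length w)) (sc (evw structure_const (Suc i) w))"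
    using Cons by simp
  finally show ?case by (simp add: act_by_sc_sc mult.commute)
qed

definition from_coords :: "(nat \<Rightarrow> kq) \<Rightarrow> 'm" where
  "from_coords c = finsum M (\<lambda>i. act_by (basis i) (sc (c i))) {i. c i \<noteq> 0}"

lemma from_coords_superset: "finite S \<Longrightarrow> {i. c i \<noteq> 0} \<subseteq> S \<Longrightarrow> from_coords c = finsum M (\<lambda>i. act_by (basis i) (sc (c i))) S"
  unfolding from_coords_def
  by (rule add.finprod_mono_neutral_cong_left) (auto simp: act_by_0)

lemma from_coords_closed [simp]: "from_coords c \<in> carrier M"
  unfolding from_coords_def by (rule finsum_closed) auto

lemma from_coords_zero: "from_coords (\<lambda>j. 0) = \<zero>"
  unfolding from_coords_def by simp

lemma from_coords_unit: "from_coords (unit_fn i a) = act_by (basis i) (sc a)"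
  by (subst from_coords_superset[of "{i}"]) (auto simp: unit_fn_def)

lemma from_coords_add:
  assumes "c \<in> fin_supp" "d \<in> fin_supp"
  shows "from_coords (fun_add c d) = from_coords c \<oplus> from_coords d"
proof -
  let ?S = "{i. c i \<noteq> 0} \<union> {i. d i \<noteq> 0}"
  have f: "finite ?S" using assms by (simp add: fin_supp_def)
  have e: "sc (c i + d i) = sc (c i) + sc (d i)" for i by (simp add: sc_def single_add)
  have "from_coords (fun_add c d) = finsum M (\<lambda>i. act_by (basis i) (sc (fun_add c d i))) ?S"
    by (rule from_coords_superset[OF f]) (auto simp: fun_add_def)
  also have "\<dots> = finsum M (\<lambda>i. act_by (basis i) (sc (c i)) \<oplus> act_by (basis i) (sc (d i))) ?S"
    by (simp add: fun_add_def e act_by_plus)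
  also have "\<dots> = finsum M (\<lambda>i. act_by (basis i) (sc (c i))) ?S \<oplus> finsum M (\<lambda>i. act_by (basis i) (sc (d i))) ?S"
    by (rule finsum_addf) auto
  also have "\<dots> = from_coords c \<oplus> from_coords d"
    by (subst (1 2) from_coords_superset[OF f]) auto
  finally show ?thesis .
qed

lemma from_coords_sm: "c \<in> fin_supp \<Longrightarrow> from_coords (fun_scale a c) = act_by (from_coords c) (sc a)"
proof (induction rule: fin_supp_induct)
  case zero
  have "fun_scale a (\<lambda>j. 0) = (\<lambda>j. 0)" by (simp add: fun_scale_def fun_eq_iff)
  thus ?case by (simp add: from_coords_zero act_by_zero)
next
  case (add c i b)
  have "fun_scale a (fun_add (unit_fn i b) c) = fun_add (unit_fn i (b * a)) (fun_scale a c)"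
    by (auto simp: fun_scale_def fun_add_def unit_fn_def fun_eq_iff algebra_simps)
  thus ?case using add by (simp add: from_coords_add fin_supp_unit fin_supp_sm from_coords_unit act_by_add act_by_sc_sc)
qed

lemma from_coords_word: "c \<in> fin_supp \<Longrightarrow> set w \<subseteq> {..l} \<Longrightarrow> act_by (from_coords c) (mon w) = from_coords (chain_act structure_const c (mon w))"
proof (induction rule: fin_supp_induct)
  case zero
  thus ?case by (simp add: from_coords_zero act_by_zero chain_act_zero)
next
  case (add c i a)
  have "act_by (from_coords (unit_fn i a)) (mon w) = act_by (act_by (basis i) (mon w)) (sc a)"
    using add by (simp add: from_coords_unit act_by_sc_comm)
  also have "\<dots> = from_coords (chain_act structure_const (unit_fn i a) (mon w))"
    using add by (simp add: act_by_basis_word act_by_sc_sc chain_act_unit_mon from_coords_unit mult.commute)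
  finally show ?case
    using add by (simp add: from_coords_add fin_supp_unit chain_act_fun_add chain_act_fin_supp act_by_add)
qed

lemma from_coords_act: "t \<in> TT l \<Longrightarrow> c \<in> fin_supp \<Longrightarrow> act_by (from_coords c) t = from_coords (chain_act structure_const c t)"
proof -
  assume "t \<in> TT l" and c: "c \<in> fin_supp"
  hence "t \<in> TT l \<and> act_by (from_coords c) t = from_coords (chain_act structure_const c t)"
  proof (induction rule: TT_induct)
    case zero
    show ?case by (simp add: act_by_0 chain_act_linear from_coords_zero subspD[OF subsp_TT])
  next
    case (add x y)
    thus ?case using c by (simp add: act_by_plus chain_act_linear from_coords_add chain_act_fin_supp subspD[OF subsp_TT])
  next
    case (scale a x)
    hence "act_by (from_coords c) (sc a * x) = act_by (act_by (from_coords c) x) (sc a)"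
      using act_by_mult[of "from_coords c" "sc a" x] by (simp add: act_by_sc_comm)
    thus ?case using scale c by (simp add: chain_act_linear from_coords_sm chain_act_fin_supp subspD[OF subsp_TT])
  qed (use from_coords_word[OF c] in auto)
  thus ?thesis by simp
qed

lemma ex1E': "\<exists>!f. Q f \<Longrightarrow> Q f \<Longrightarrow> Q g \<Longrightarrow> f = g"
  by blast

lemma decomp: "x \<in> carrier M \<Longrightarrow> \<exists>!f. (\<forall>i. f i \<in> mcomp M i) \<and> finite {i. f i \<noteq> \<zero>} \<and> x = finsum M f {i. f i \<noteq> \<zero>}"
  using graded by (simp add: graded_right_module_def)

text \<open>Both injectivity and surjectivity of the coordinates express that \<open>M\<close> is the direct sum of
  its components.\<close>

lemma from_coords_inj: "inj_on from_coords fin_supp"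
proof (rule inj_onI)
  fix c d assume c: "c \<in> fin_supp" and d: "d \<in> fin_supp" and e: "from_coords c = from_coords d"
  have D: "(\<forall>i. act_by (basis i) (sc (c i)) \<in> mcomp M i) \<and> finite {i. act_by (basis i) (sc (c i)) \<noteq> \<zero>}
      \<and> from_coords c = finsum M (\<lambda>i. act_by (basis i) (sc (c i))) {i. act_by (basis i) (sc (c i)) \<noteq> \<zero>}" if "c \<in> fin_supp" for c
    unfolding act_by_basis_eq_0 using that basis(3) by (auto simp: from_coords_def fin_supp_def)
  have "(\<lambda>i. act_by (basis i) (sc (c i))) = (\<lambda>i. act_by (basis i) (sc (d i)))"
    by (rule ex1E'[OF decomp[OF from_coords_closed[of c]]], rule D[OF c], rule D[OF d, folded e])
  thus "c = d" using act_by_basis_inj by (auto simp: fun_eq_iff)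
qed

lemma from_coords_surj: "from_coords ` fin_supp = carrier M"
proof (intro equalityI subsetI)
  fix x assume "x \<in> carrier M"
  then obtain f where f: "\<forall>i. f i \<in> mcomp M i" "finite {i. f i \<noteq> \<zero>}" "x = finsum M f {i. f i \<noteq> \<zero>}"
    by (rule ex1E[OF decomp]) blast
  have "\<forall>i. \<exists>c. f i = act_by (basis i) (sc c)" using f(1) basis(3) by auto
  hence "\<exists>c. \<forall>i. f i = act_by (basis i) (sc (c i))" by (rule choice)
  then obtain c where c: "\<forall>i. f i = act_by (basis i) (sc (c i))" ..
  hence "f = (\<lambda>i. act_by (basis i) (sc (c i)))" by auto
  with f have "x = from_coords c" "c \<in> fin_supp" by (simp_all add: from_coords_def fin_supp_def act_by_basis_eq_0)
  thus "x \<in> from_coords ` fin_supp" by blast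
qed auto

lemma realizes_from_coords: "realizes l M structure_const from_coords"
  unfolding realizes_def
proof (intro conjI ballI allI)
  show "bij_betw from_coords fin_supp (carrier M)" by (simp add: bij_betw_def from_coords_inj from_coords_surj)
  fix c t assume "c \<in> fin_supp" "t \<in> TT l"
  thus "ract M (from_coords c) (cls l t) = from_coords (chain_act structure_const c t)" using from_coords_act by (simp add: act_by_def)
next
  fix i show "mcomp M i = from_coords ` range (unit_fn i)"
    unfolding basis(3)[of i] image_image from_coords_unit by (simp add: full_SetCompr_eq)
qed (rule from_coords_add)

end

lemma (in abelian_group) additive_subgroup_if_closed:
  assumes "H \<subseteq> carrier G" "\<zero> \<in> H" "\<And>x y. x \<in> H \<Longrightarrow> y \<in> H \<Longrightarrow> x \<oplus> y \<in> H"
    and "\<And>x. x \<in> H \<Longrightarrow> \<exists>y\<in>H. y \<oplus> x = \<zero>"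
  shows "additive_subgroup H G"
proof (rule additive_subgroupI, rule group.subgroupI[OF a_group])
  fix x assume x: "x \<in> H"
  then obtain y where y: "y \<in> H" "y \<oplus> x = \<zero>" using assms(4) by blast
  hence "\<ominus> x = y" using minus_equality x assms(1) by blast
  thus "inv\<^bsub>add_monoid G\<^esub> x \<in> H" using y by (simp add: a_inv_def)
qed (use assms in auto)

lemma realizes_subgroup:
  assumes M: "realizes l M P \<Psi>" "abelian_group M"
    and S: "S \<subseteq> fin_supp" "(\<lambda>j. 0) \<in> S" "\<And>c d. c \<in> S \<Longrightarrow> d \<in> S \<Longrightarrow> fun_add c d \<in> S" "\<And>c. c \<in> S \<Longrightarrow> fun_scale (-1) c \<in> S"
  shows "additive_subgroup (\<Psi> ` S) M"
proof (rule abelian_group.additive_subgroup_if_closed[OF M(2)])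
  show "\<Psi> ` S \<subseteq> carrier M" using realizesD(3)[OF M(1)] S(1) by blast
  show "\<zero>\<^bsub>M\<^esub> \<in> \<Psi> ` S" using realizes_zero[OF M] S(2) by (metis imageI)
  have add: "\<Psi> c \<oplus>\<^bsub>M\<^esub> \<Psi> d = \<Psi> (fun_add c d)" if "c \<in> S" "d \<in> S" for c d
    using realizesD(4)[OF M(1)] that S(1) by (metis subsetD)
  show "x \<oplus>\<^bsub>M\<^esub> y \<in> \<Psi> ` S" if "x \<in> \<Psi> ` S" "y \<in> \<Psi> ` S" for x y
    using that add S(3) by (auto simp: image_iff)
  fix x assume "x \<in> \<Psi> ` S"
  then obtain c where c: "c \<in> S" "x = \<Psi> c" by blast
  have "\<Psi> (fun_scale (-1) c) \<oplus>\<^bsub>M\<^esub> x = \<zero>\<^bsub>M\<^esub>"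
    unfolding c(2) add[OF S(4)[OF c(1)] c(1)] fun_add_simps(5) by (rule realizes_zero[OF M])
  thus "\<exists>y\<in>\<Psi> ` S. y \<oplus>\<^bsub>M\<^esub> x = \<zero>\<^bsub>M\<^esub>" using S(4)[OF c(1)] by blast
qed

context sym_point_module
begin

text \<open>If all structure constants in degree \<open>i\<close> vanished, the elements of degree at most \<open>i\<close> would
  form a submodule that contains the component of degree zero, but not that of degree \<open>i + 1\<close>.\<close>

lemma structure_const_nonzero_rows: "\<exists>j\<le>l. structure_const i j \<noteq> 0"
proof (rule ccontr)
  assume "\<not> (\<exists>j\<le>l. structure_const i j \<noteq> 0)"
  hence z: "structure_const i j = 0" if "j \<le> l" for j using that by blast
  define S where "S = {c \<in> fin_supp. \<forall>n>i. c n = 0}"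
  have sub: "additive_subgroup (from_coords ` S) M"
    by (rule realizes_subgroup[OF realizes_from_coords abelian_group_axioms])
       (auto simp: S_def fin_supp_zero fin_supp_add fin_supp_sm fun_add_def fun_scale_def)
  have closed: "chain_act structure_const c t \<in> S" if c: "c \<in> S" and t: "t \<in> TT l" for c t
  proof -
    have "chain_act structure_const c t n = 0" if n: "i < n" for n
    proof -
      have "chain_act structure_const c t n = wsum (\<lambda>w. 0) t"
        unfolding chain_act_def
      proof (rule wsum_cong)
        fix w assume "w \<in> Poly_Mapping.keys t"
        hence w: "set (letters w) \<subseteq> {..l}" using t by (auto simp: TT_def)
        let ?d = "length (letters w)"
        have "c (n - ?d) * evw structure_const (n - ?d) (letters w) = 0" if d: "?d \<le> n"
        proof (cases "i < n - ?d")
          case False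
          define k where "k = i - (n - ?d)"
          have k: "k < ?d" "n - ?d + k = i" using False d n by (auto simp: k_def)
          have "letters w ! k \<le> l" using w nth_mem[OF k(1)] by blast
          hence "structure_const (n - ?d + k) (letters w ! k) = 0" using k z by simp
          hence "evw structure_const (n - ?d) (letters w) = 0"
            unfolding evw_prod using k(1) by (intro prod_zero) auto
          thus ?thesis by simp
        qed (use c in \<open>simp add: S_def\<close>)
        thus "(if ?d \<le> n then c (n - ?d) * evw structure_const (n - ?d) (letters w) else 0) = 0" by simp
      qed
      thus ?thesis by simp
    qed
    thus ?thesis using c chain_act_fin_supp by (simp add: S_def)
  qed
  have "\<forall>x\<in>from_coords ` S. \<forall>a\<in>carrier (sym_alg l). ract M x a \<in> from_coords ` S"
  proof (intro ballI)
    fix x a assume "x \<in> from_coords ` S" "a \<in> carrier (sym_alg l)"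
    then obtain c t where c: "c \<in> S" "x = from_coords c" and t: "t \<in> TT l" "a = cls l t"
      by (auto simp: cls_carrier)
    have "ract M x a = from_coords (chain_act structure_const c t)"
      using from_coords_act[OF t(1), of c] c t by (simp add: S_def act_by_def)
    thus "ract M x a \<in> from_coords ` S" using closed[OF c(1) t(1)] by blast
  qed
  moreover have "mcomp M 0 \<subseteq> from_coords ` S"
    unfolding realizesD(6)[OF realizes_from_coords] by (auto simp: S_def fin_supp_unit unit_fn_def)
  ultimately have "from_coords ` S = carrier M"
    using pm sub by (simp add: point_module_def)
  then obtain c where c: "c \<in> S" "from_coords (unit_fn (Suc i) 1) = from_coords c"
    using from_coords_closed[of "unit_fn (Suc i) 1"] by (metis imageE)
  hence "unit_fn (Suc i) 1 = c" using from_coords_inj fin_supp_unit by (auto simp: S_def dest: inj_onD)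
  thus False using c(1) by (auto simp: S_def unit_fn_def)
qed

text \<open>A relation \<open>h\<close> annihilates the basis vector of degree \<open>s\<close>, while it acts there by its value
  under \<open>P\<^sub>s \<otimes> P\<^bsub>s+1\<^esub>\<close>.\<close>

lemma structure_const_chain: "chain l structure_const"
  unfolding chain_def kills_def
proof (intro allI ballI)
  fix s h assume h: "h \<in> ext_square l"
  hence h2: "h \<in> tdeg l 2" and hT: "h \<in> TT l" using ext_square_T2 tdeg_TT by blast+
  have "cls l h = cls l 0"
    using h ext_square_sym_ideal hT by (subst cls_eq_iff) (auto simp: subspD[OF subsp_TT])
  hence "act_by (from_coords (unit_fn s 1)) h = act_by (from_coords (unit_fn s 1)) 0" by (simp add: act_by_def)
  hence "from_coords (unit_fn (s + 2) (ev structure_const s h)) = from_coords (\<lambda>j. 0)"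
    using from_coords_act[OF hT fin_supp_unit, of s 1] chain_act_unit_tdeg[OF h2, of structure_const s 1]
    by (simp add: act_by_0 from_coords_zero)
  hence "unit_fn (s + 2) (ev structure_const s h) = (\<lambda>j. 0)"
    using from_coords_inj fin_supp_unit fin_supp_zero by (auto dest: inj_onD)
  hence "unit_fn (s + 2) (ev structure_const s h) (s + 2) = 0" by simp
  thus "ev2 (structure_const s) (structure_const (Suc s)) h = 0" by (simp add: unit_fn_def ev_ev2[OF h2])
qed

end

subsection \<open>The point module of a chain\<close>

text \<open>The coordinates carry a module structure, which \<open>U\<close> transports to the type that has to
  contain the carrier.\<close>

locale chain_module =
  fixes l :: nat and P :: "nat \<Rightarrow> nat \<Rightarrow> kq" and U :: "(nat \<Rightarrow> kq) \<Rightarrow> 'm"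
  assumes nonzero_rows: "\<And>i. \<exists>j\<le>l. P i j \<noteq> 0" and chain: "chain l P" and inj: "inj U"
begin

definition chain_mod :: "(tens set, 'm) gmod" where
  "chain_mod = \<lparr>carrier = U ` fin_supp, monoid.mult = (\<lambda>x y. x), one = U (\<lambda>j. 0), zero = U (\<lambda>j. 0),
    add = (\<lambda>x y. U (fun_add (inv_into UNIV U x) (inv_into UNIV U y))),
    ract = (\<lambda>x a. U (chain_act P (inv_into UNIV U x) (SOME t. t \<in> TT l \<and> cls l t = a))),
    mcomp = (\<lambda>i. U ` range (unit_fn i))\<rparr>"

lemma chain_mod_simps [simp]:
  "carrier chain_mod = U ` fin_supp" "zero chain_mod = U (\<lambda>j. 0)" "add chain_mod (U c) (U d) = U (fun_add c d)"
  "mcomp chain_mod i = U ` range (unit_fn i)" "U c = U d \<longleftrightarrow> c = d"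
  by (simp_all add: chain_mod_def inj inj_eq)

text \<open>The action does not depend on the representative since a chain annihilates the ideal.\<close>

lemma chain_mod_ract:
  assumes "t \<in> TT l"
  shows "ract chain_mod (U c) (cls l t) = U (chain_act P c t)"
proof -
  define s where "s = (SOME s. s \<in> TT l \<and> cls l s = cls l t)"
  have "s \<in> TT l \<and> cls l s = cls l t" unfolding s_def by (rule someI[of _ t]) (simp add: assms)
  hence "s - t \<in> sym_ideal l" using cls_eq_iff assms by blast
  hence "chain_act P c (s - t) = (\<lambda>j. 0)" by (rule chain_act_sym_ideal[OF chain])
  hence "chain_act P c s = chain_act P c t" by (simp add: fun_eq_iff chain_act_linear)
  thus ?thesis by (simp add: chain_mod_def inj flip: s_def)
qed

lemma ab: "abelian_group chain_mod"
proof (rule abelian_groupI)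
  fix x y assume "x \<in> carrier chain_mod" "y \<in> carrier chain_mod"
  then obtain c d where "x = U c" "y = U d" by auto
  thus "x \<oplus>\<^bsub>chain_mod\<^esub> y = y \<oplus>\<^bsub>chain_mod\<^esub> x" by (simp add: fun_add_simps(4)[of c d])
next
  fix x assume "x \<in> carrier chain_mod"
  then obtain c where "c \<in> fin_supp" "x = U c" by auto
  thus "\<exists>y\<in>carrier chain_mod. y \<oplus>\<^bsub>chain_mod\<^esub> x = \<zero>\<^bsub>chain_mod\<^esub>"
    by (intro bexI[of _ "U (fun_scale (-1) c)"]) (simp_all add: fun_add_simps(5) fin_supp_sm)
qed (auto simp: fin_supp_zero fin_supp_add fun_add_simps(1-3))

lemma realizes_chain_mod: "realizes l chain_mod P U"
  unfolding realizes_def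
  by (simp add: chain_mod_ract bij_betw_def inj_on_subset[OF inj])

lemma right_module_chain_mod: "right_module (sym_alg l) chain_mod"
  unfolding right_module_def
proof (intro conjI ballI ring_sym_alg ab)
  fix x assume "x \<in> carrier chain_mod"
  then obtain c where c: "c \<in> fin_supp" "x = U c" by auto
  show "ract chain_mod x \<one>\<^bsub>sym_alg l\<^esub> = x"
    unfolding cls_one c(2) by (simp add: chain_mod_ract chain_act_one)
  fix a assume "a \<in> carrier (sym_alg l)"
  then obtain s where s: "s \<in> TT l" "a = cls l s" by (auto simp: cls_carrier)
  show "ract chain_mod x a \<in> carrier chain_mod" using c s by (simp add: chain_mod_ract chain_act_fin_supp)
  show "ract chain_mod (x \<oplus>\<^bsub>chain_mod\<^esub> y) a = ract chain_mod x a \<oplus>\<^bsub>chain_mod\<^esub> ract chain_mod y a" if "y \<in> carrier chain_mod" for y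
    using that c s by (auto simp: chain_mod_ract chain_act_fun_add)
  fix b assume "b \<in> carrier (sym_alg l)"
  then obtain t where t: "t \<in> TT l" "b = cls l t" by (auto simp: cls_carrier)
  show "ract chain_mod x (a \<oplus>\<^bsub>sym_alg l\<^esub> b) = ract chain_mod x a \<oplus>\<^bsub>chain_mod\<^esub> ract chain_mod x b"
    unfolding s(2) t(2) c(2) cls_add[OF s(1) t(1)]
    by (simp add: chain_mod_ract s t subspD[OF subsp_TT] chain_act_linear)
  show "ract chain_mod x (a \<otimes>\<^bsub>sym_alg l\<^esub> b) = ract chain_mod (ract chain_mod x a) b"
    unfolding s(2) t(2) c(2) cls_mult[OF s(1) t(1)]
    by (simp add: chain_mod_ract s t TT_mult chain_act_mult)
qed

lemma finsum_chain_mod: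
  "finite S \<Longrightarrow> finsum chain_mod (\<lambda>i. U (unit_fn i (a i))) S = U (\<lambda>j. if j \<in> S then a j else 0)"
proof (induction S rule: finite_induct)
  interpret abelian_group chain_mod by (rule ab)
  {
    case empty
    thus ?case by simp
  next
    case (insert i S)
    have "fun_add (unit_fn i (a i)) (\<lambda>j. if j \<in> S then a j else 0) = (\<lambda>j. if j \<in> insert i S then a j else 0)"
      using insert(2) by (auto simp: fun_add_def unit_fn_def fun_eq_iff)
    moreover have "finsum chain_mod (\<lambda>i. U (unit_fn i (a i))) (insert i S)
      = U (unit_fn i (a i)) \<oplus>\<^bsub>chain_mod\<^esub> finsum chain_mod (\<lambda>i. U (unit_fn i (a i))) S"
      by (rule finsum_insert) (use insert in \<open>auto simp: fin_supp_unit\<close>)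
    ultimately show ?case using insert by simp
  }
qed

lemma unit_eq_0: "unit_fn i a = (\<lambda>j. 0) \<longleftrightarrow> a = 0"
  by (auto simp: unit_fn_def fun_eq_iff)

lemma decomp_chain_mod:
  assumes "c \<in> fin_supp"
  shows "\<exists>!f. (\<forall>i. f i \<in> mcomp chain_mod i) \<and> finite {i. f i \<noteq> \<zero>\<^bsub>chain_mod\<^esub>} \<and> U c = finsum chain_mod f {i. f i \<noteq> \<zero>\<^bsub>chain_mod\<^esub>}"
proof (rule ex1I)
  have "U c = finsum chain_mod (\<lambda>i. U (unit_fn i (c i))) {i. c i \<noteq> 0}"
    using assms by (subst finsum_chain_mod) (auto simp: fin_supp_def fun_eq_iff)
  thus "(\<forall>i. U (unit_fn i (c i)) \<in> mcomp chain_mod i) \<and> finite {i. U (unit_fn i (c i)) \<noteq> \<zero>\<^bsub>chain_mod\<^esub>}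
    \<and> U c = finsum chain_mod (\<lambda>i. U (unit_fn i (c i))) {i. U (unit_fn i (c i)) \<noteq> \<zero>\<^bsub>chain_mod\<^esub>}"
    using assms by (simp add: unit_eq_0 fin_supp_def)
  fix g assume g: "(\<forall>i. g i \<in> mcomp chain_mod i) \<and> finite {i. g i \<noteq> \<zero>\<^bsub>chain_mod\<^esub>} \<and> U c = finsum chain_mod g {i. g i \<noteq> \<zero>\<^bsub>chain_mod\<^esub>}"
  have "\<forall>i. \<exists>a. g i = U (unit_fn i a)" using g by auto
  hence "\<exists>a. \<forall>i. g i = U (unit_fn i (a i))" by (rule choice)
  then obtain a where a: "\<forall>i. g i = U (unit_fn i (a i))" ..
  hence ga: "g = (\<lambda>i. U (unit_fn i (a i)))" by auto
  have fin: "finite {i. a i \<noteq> 0}" and "U c = finsum chain_mod (\<lambda>i. U (unit_fn i (a i))) {i. a i \<noteq> 0}"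
    using g unfolding ga by (simp_all add: unit_eq_0)
  hence "c = (\<lambda>j. if j \<in> {i. a i \<noteq> 0} then a j else 0)" by (simp only: finsum_chain_mod chain_mod_simps)
  hence "c = a" by (auto simp: fun_eq_iff)
  thus "g = (\<lambda>i. U (unit_fn i (c i)))" using ga by simp
qed

lemma graded_chain_mod: "graded_right_module (sym_alg l) chain_mod"
  unfolding graded_right_module_def
proof (intro conjI right_module_chain_mod allI ballI)
  fix i
  show "additive_subgroup (mcomp chain_mod i) chain_mod"
    unfolding realizesD(6)[OF realizes_chain_mod]
    by (rule realizes_subgroup[OF realizes_chain_mod ab])
       (auto simp: fin_supp_unit image_iff fun_add_def fun_scale_def unit_fn_def fun_eq_iff)
  fix j x a assume "x \<in> mcomp chain_mod i" "a \<in> hcomp (sym_alg l) j"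
  then obtain e t where e: "x = U (unit_fn i e)" and t: "t \<in> tdeg l j" "a = cls l t"
    by (auto simp: sym_alg_simps)
  have "ract chain_mod x a = U (unit_fn (i + j) (e * ev P i t))"
    unfolding e t(2) chain_mod_ract[OF subsetD[OF tdeg_TT t(1)]] chain_act_unit_tdeg[OF t(1)] ..
  thus "ract chain_mod x a \<in> mcomp chain_mod (i + j)" by simp
next
  fix x assume "x \<in> carrier chain_mod"
  then obtain c where "c \<in> fin_supp" "x = U c" by auto
  thus "\<exists>!f. (\<forall>i. f i \<in> mcomp chain_mod i) \<and> finite {i. f i \<noteq> \<zero>\<^bsub>chain_mod\<^esub>} \<and> x = finsum chain_mod f {i. f i \<noteq> \<zero>\<^bsub>chain_mod\<^esub>}"
    using decomp_chain_mod[of c] by (simp only:)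
qed

end

context chain_module
begin

text \<open>From a vector of degree \<open>i\<close> all vectors of degree \<open>i + 1\<close> are reached, as the form \<open>P\<^sub>i\<close> is not
  zero.\<close>

lemma point_module_chain_mod: "point_module (sym_alg l) chain_mod"
  unfolding point_module_def
proof (intro conjI graded_chain_mod allI impI)
  fix N assume N: "additive_subgroup N chain_mod \<and> (\<forall>x\<in>N. \<forall>a\<in>carrier (sym_alg l). ract chain_mod x a \<in> N) \<and> mcomp chain_mod 0 \<subseteq> N"
  note sub = conjunct1[OF N] and act = conjunct1[OF conjunct2[OF N]] and gen = conjunct2[OF conjunct2[OF N]]
  have u: "U (unit_fn i a) \<in> N" for i a
  proof (induction i arbitrary: a)
    case 0
    show ?case by (rule subsetD[OF gen]) (simp only: chain_mod_simps image_eqI rangeI)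
  next
    case (Suc i)
    obtain j where j: "j \<le> l" "P i j \<noteq> 0" using nonzero_rows by blast
    hence "cls l (mon [j]) \<in> carrier (sym_alg l)" by (intro cls_in_carrier) simp
    hence "ract chain_mod (U (unit_fn i (a / P i j))) (cls l (mon [j])) \<in> N" by (rule bspec[OF bspec[OF act Suc]])
    thus ?case using j by (simp add: chain_mod_ract chain_act_unit_mon)
  qed
  have "U c \<in> N" if "c \<in> fin_supp" for c
    using that
  proof (induction rule: fin_supp_induct)
    case zero
    show ?case using additive_subgroup.zero_closed[OF sub] unfolding chain_mod_simps .
  next
    case (add c i a)
    show ?case using additive_subgroup.a_closed[OF sub u[of i a] add(4)] unfolding chain_mod_simps .
  qed
  thus "N = carrier chain_mod" using additive_subgroup.a_subset[OF sub] by auto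
next
  fix i
  have e: "ract chain_mod (U (unit_fn i 1)) (scal (sym_alg l) c) = U (unit_fn i c)" for c
    by (auto simp: sym_alg_simps chain_mod_ract chain_act_sc fun_scale_def unit_fn_def)
  have m: "U (unit_fn i 1) \<in> mcomp chain_mod i" unfolding chain_mod_simps by (intro imageI rangeI)
  have n: "U (unit_fn i 1) \<noteq> \<zero>\<^bsub>chain_mod\<^esub>" unfolding chain_mod_simps unit_eq_0 by (rule one_neq_zero)
  have g: "mcomp chain_mod i = {ract chain_mod (U (unit_fn i 1)) (scal (sym_alg l) c) | c. True}"
    unfolding e chain_mod_simps image_image by (simp add: full_SetCompr_eq)
  show "\<exists>b\<in>mcomp chain_mod i. b \<noteq> \<zero>\<^bsub>chain_mod\<^esub> \<and> mcomp chain_mod i = {ract chain_mod b (scal (sym_alg l) c) | c. True}"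
    by (rule bexI[of _ "U (unit_fn i 1)"], rule conjI, rule n, rule g, rule m)
qed

end

section \<open>The parametrization of point modules\<close>

context pairing
begin

lemma point_module_realizes:
  assumes "point_module (sym_alg l) M"
  obtains P \<Psi> where "realizes l M P \<Psi>" "abelian_group M" "nonzero_rows P" "chain l P"
    "module_points l \<beta> M = (\<lambda>k. line_of (P k))"
proof -
  interpret pm: sym_point_module l M by (rule sym_point_module.intro[OF assms])
  show ?thesis
    by (rule that[OF pm.realizes_from_coords pm.abelian_group_axioms _ pm.structure_const_chain])
       (simp_all add: nonzero_rows_def pm.structure_const_nonzero_rows fun_eq_iff
          module_points_line_of[OF pm.realizes_from_coords pm.abelian_group_axioms])
qed

text \<open>Isomorphic modules have the same points because structure constants can be transported.
  Conversely, if the points agree, then the forms are proportional, and a change of bases makes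
  the structure constants equal.\<close>

lemma iso_iff_module_points:
  assumes M: "point_module (sym_alg l) M" and N: "point_module (sym_alg l) N"
  shows "gmod_iso (sym_alg l) M N \<longleftrightarrow> module_points l \<beta> M = module_points l \<beta> N"
proof -
  obtain P \<Psi> where P: "realizes l M P \<Psi>" "abelian_group M" "nonzero_rows P" "chain l P"
    "module_points l \<beta> M = (\<lambda>k. line_of (P k))"
    by (rule point_module_realizes[OF M])
  obtain Q \<Xi> where Q: "realizes l N Q \<Xi>" "abelian_group N" "nonzero_rows Q" "chain l Q"
    "module_points l \<beta> N = (\<lambda>k. line_of (Q k))"
    by (rule point_module_realizes[OF N])
  show ?thesis
  proof
    assume "gmod_iso (sym_alg l) M N"
    from iso_realizes[OF P(1) this] obtain \<Theta> where "realizes l N P \<Theta>" ..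
    thus "module_points l \<beta> M = module_points l \<beta> N"
      unfolding P(5) by (simp add: module_points_line_of[OF _ Q(2)] fun_eq_iff)
  next
    assume "module_points l \<beta> M = module_points l \<beta> N"
    hence "line_of (P k) = line_of (Q k)" for k unfolding P(5) Q(5) by (rule fun_cong)
    hence "\<forall>k. \<exists>c. c \<noteq> 0 \<and> (\<forall>i\<le>l. Q k i = c * P k i)"
      using line_of_eq_iff[of "Q k" "P k" for k] Q(3) by (simp add: nonzero_rows_def)
    hence "\<exists>\<nu>. \<forall>k. \<nu> k \<noteq> 0 \<and> (\<forall>i\<le>l. Q k i = \<nu> k * P k i)" by (rule choice)
    then obtain \<nu> where \<nu>: "\<forall>k. \<nu> k \<noteq> 0 \<and> (\<forall>i\<le>l. Q k i = \<nu> k * P k i)" ..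
    hence "\<exists>\<Theta>. realizes l M Q \<Theta>" by (intro realizes_rescale[OF P(1), of \<nu>]) auto
    then obtain \<Theta> where "realizes l M Q \<Theta>" ..
    thus "gmod_iso (sym_alg l) M N" by (rule realizes_iso[OF _ Q(1)])
  qed
qed

lemma iso_class_eq:
  "point_module (sym_alg l) M \<Longrightarrow> iso_class (sym_alg l) M
    = {N. point_module (sym_alg l) N \<and> module_points l \<beta> M = module_points l \<beta> N}"
  unfolding iso_class_def using iso_iff_module_points by blast

lemma point_modules_parametrized_by_chains:
  fixes U :: "(nat \<Rightarrow> kq) \<Rightarrow> 'm"
  assumes U: "inj U"
  shows "point_modules_parametrized TYPE('m) l \<beta> {\<lambda>k. line_of (R k) | R. nonzero_rows R \<and> chain l R}"
proof -
  let ?A = "sym_alg l"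
  define mp where "mp = (module_points l \<beta> :: (tens set, 'm) gmod \<Rightarrow> nat \<Rightarrow> tens set)"
  define PM where "PM = {M :: (tens set, 'm) gmod. point_module ?A M}"
  have cl: "iso_class ?A M = {N \<in> PM. mp M = mp N}" if "M \<in> PM" for M
    using iso_class_eq[of M] that by (simp add: PM_def mp_def)
  define \<Phi> where "\<Phi> C = mp (SOME M. M \<in> C)" for C
  have \<Phi>: "\<Phi> (iso_class ?A M) = mp M" if "M \<in> PM" for M
  proof -
    have "M \<in> iso_class ?A M" using that by (simp add: cl)
    hence "(SOME N. N \<in> iso_class ?A M) \<in> iso_class ?A M" by (rule someI)
    thus ?thesis unfolding \<Phi>_def using cl[OF that] by auto
  qed
  have classes: "point_module_classes ?A = iso_class ?A ` PM"
    by (auto simp: point_module_classes_def PM_def)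
  have "inj_on \<Phi> (iso_class ?A ` PM)"
  proof (rule inj_onI)
    fix C D assume "C \<in> iso_class ?A ` PM" "D \<in> iso_class ?A ` PM" and e: "\<Phi> C = \<Phi> D"
    then obtain M N where "M \<in> PM" "C = iso_class ?A M" "N \<in> PM" "D = iso_class ?A N" by blast
    with e show "C = D" using \<Phi> cl by simp
  qed
  moreover have "\<Phi> ` iso_class ?A ` PM = mp ` PM"
    using \<Phi> by (simp add: image_image)
  moreover have "mp ` PM = {\<lambda>k. line_of (R k) | R. nonzero_rows R \<and> chain l R}"
  proof (intro equalityI subsetI)
    fix x assume "x \<in> mp ` PM"
    then obtain M where M: "M \<in> PM" "x = mp M" by blast
    have pm: "point_module ?A M" using M(1) by (simp add: PM_def)
    obtain P \<Psi> where P: "realizes l M P \<Psi>" "abelian_group M" "nonzero_rows P" "chain l P"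
      "module_points l \<beta> M = (\<lambda>k. line_of (P k))"
      by (rule point_module_realizes[OF pm])
    thus "x \<in> {\<lambda>k. line_of (R k) | R. nonzero_rows R \<and> chain l R}" unfolding M(2) mp_def by auto
  next
    fix x assume "x \<in> {\<lambda>k. line_of (R k) | R. nonzero_rows R \<and> chain l R}"
    then obtain R where R: "nonzero_rows R" "chain l R" "x = (\<lambda>k. line_of (R k))" by blast
    interpret cm: chain_module l R U by unfold_locales (use R U in \<open>auto simp: nonzero_rows_def\<close>)
    have "x = mp cm.chain_mod"
      unfolding R(3) mp_def using module_points_line_of[OF cm.realizes_chain_mod cm.ab] by (simp add: fun_eq_iff)
    thus "x \<in> mp ` PM" using cm.point_module_chain_mod unfolding PM_def by blast
  qed
  ultimately have "bij_betw \<Phi> (point_module_classes ?A) {\<lambda>k. line_of (R k) | R. nonzero_rows R \<and> chain l R}"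
    unfolding classes bij_betw_def by simp
  moreover have "\<forall>M :: (tens set, 'm) gmod. point_module ?A M \<longrightarrow> \<Phi> (iso_class ?A M) = module_points l \<beta> M"
    using \<Phi> by (simp add: PM_def mp_def)
  ultimately show ?thesis unfolding point_modules_parametrized_def by blast
qed

end

theorem theorem4p6:
  fixes l :: nat
    and \<beta> :: "tens \<Rightarrow> tens \<Rightarrow> kq"
    and U :: "(nat \<Rightarrow> kq) \<Rightarrow> 'm"
  assumes "l \<ge> 1"
    and "dual_pairing l \<beta>"
    and "inj U"
  shows "(odd l \<longrightarrow> (\<forall>\<phi>. module_embedding l 1 l \<phi> \<longrightarrow>
            point_modules_parametrized TYPE('m) l \<beta>
              (geometric_object l \<beta> (veronese 1 l) \<phi>))) \<and>
         (even l \<longrightarrow> (\<forall>\<phi>. module_embedding l 2 (l div 2) \<phi> \<longrightarrow>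
            point_modules_parametrized TYPE('m) l \<beta>
              (geometric_object l \<beta> (veronese 2 (l div 2)) \<phi>)))"
proof -
  interpret pairing l \<beta> by (rule pairing.intro[OF assms(2)])
  have chains: "point_modules_parametrized TYPE('m) l \<beta> (inv_limit l \<beta> (sym_ideal l))"
    unfolding inv_limit_sym_ideal by (rule point_modules_parametrized_by_chains[OF assms(3)])
  show ?thesis
  proof (intro conjI impI allI)
    fix \<phi> assume "odd l" "module_embedding l 1 l \<phi>"
    hence "geometric_object l \<beta> (veronese 1 l) \<phi> = inv_limit l \<beta> (sym_ideal l)"
      using assms(1) by (intro geometric_object_eq) simp_all
    thus "point_modules_parametrized TYPE('m) l \<beta> (geometric_object l \<beta> (veronese 1 l) \<phi>)"
      using chains by simp
  next
    fix \<phi> assume "even l" "module_embedding l 2 (l div 2) \<phi>"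
    hence "geometric_object l \<beta> (veronese 2 (l div 2)) \<phi> = inv_limit l \<beta> (sym_ideal l)"
      using assms(1) by (intro geometric_object_eq) simp_all
    thus "point_modules_parametrized TYPE('m) l \<beta> (geometric_object l \<beta> (veronese 2 (l div 2)) \<phi>)"
      using chains by simp
  qed
qed

end
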